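(* Let $\mathcal{S}$ be a small category admitting binary products which, with its subcategories $\mathcal{S}^{sm}$ and $\mathcal{S}^{cl}$, satisfies the standing assumptions listed in the context. Let $\mathbb{H}_1,\mathbb{H}_2$ be localic triangulated $\mathcal{S}$-fibered categories endowed with smooth-adjointable triangulated external tensor structures $(\boxtimes_1,m_1)$ and $(\boxtimes_2,m_2)$, respectively, and let $R=(\mathcal{R},\theta):\mathbb{H}_1\to\mathbb{H}_2$ be a smooth-adjointable triangulated morphism of $\mathcal{S}$-fibered categories. Then giving an external tensor core on $R$ (with respect to $(\boxtimes_1,m_1)$ and $(\boxtimes_2,m_2)$) is the same as giving a triangulated external tensor structure on $R$ (with respect to $(\boxtimes_1,m_1)$ and $(\boxtimes_2,m_2)$): a family of natural isomorphisms $\rho_{S_1,S_2}:R_{S_1}(A_1)\boxtimes_2R_{S_2}(A_2)\xrightarrow{\sim}R_{S_1\times S_2}(A_1\boxtimes_1A_2)$ is an external tensor core on $R$ if and only if it is a triangulated external tensor structure on $R$.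
   Context: Standing assumptions on $\mathcal{S}$: a small category with binary products and two (possibly non-full) subcategories $\mathcal{S}^{sm},\mathcal{S}^{cl}$ such that: (i) both have the same objects as $\mathcal{S}$ and contain all isomorphisms; (ii) for every $p:P\to S$ in $\mathcal{S}^{sm}$ and every $f:T\to S$ in $\mathcal{S}$ the fibered product $P\times_S T$ exists, and every base change of a morphism of $\mathcal{S}^{sm}$ lies in $\mathcal{S}^{sm}$; (iii) in every Cartesian square with sides $z':P_Z\to P$, $p':P_Z\to Z$, $p:P\to S$ in $\mathcal{S}^{sm}$, $z:Z\to S$ in $\mathcal{S}^{cl}$, the morphism $z'$ is in $\mathcal{S}^{cl}$; and if $gz$ is in $\mathcal{S}^{cl}$ then $z$ is in $\mathcal{S}^{cl}$; (iv) every morphism $f$ of $\mathcal{S}$ factors as $f=p\circ t$ with $t$ in $\mathcal{S}^{cl}$, $p$ in $\mathcal{S}^{sm}$; (v) $\mathcal{S}$ has an initial object $\emptyset$; (vi) for every $z:Z\to S$ in $\mathcal{S}^{cl}$ there is a distinguished $u:U\to S$ in $\mathcal{S}^{sm}$ (the open immersion complementary to $z$) such that for every $T$ the map $u\circ-:\operatorname{Hom}_{\mathcal{S}}(T,U)\to\operatorname{Hom}_{\mathcal{S}}(T,S)$ identifies $\operatorname{Hom}_{\mathcal{S}}(T,U)$ with the set of those $f:T\to S$ for which the square with sides $\emptyset\to T$, $\emptyset\to Z$, $f$, $z$ is Cartesian. Morphisms of $\mathcal{S}^{sm}$ are called smooth, morphisms of $\mathcal{S}^{cl}$ closed immersions.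 An $\mathcal{S}$-fibered category $\mathbb{H}$: categories $\mathbb{H}(S)$, functors $f^*:\mathbb{H}(S)\to\mathbb{H}(T)$ for $f:T\to S$, and natural isomorphisms $\mathrm{conn}_{f,g}:(gf)^*A\xrightarrow{\sim}f^*g^*A$ with $\mathrm{id}_S^*=\mathrm{id}$ and $f^*\mathrm{conn}_{g,h}\circ\mathrm{conn}_{f,hg}=\mathrm{conn}_{f,g}\circ\mathrm{conn}_{gf,h}$; composites of these are written as equalities. It is triangulated if all $\mathbb{H}(S)$ are triangulated, all $f^*$ triangulated functors, all connection isomorphisms compatible with shifts. A triangulated $\mathbb{H}$ is localic if: (a) $\mathbb{H}(\emptyset)=0$; (b) for every smooth $p$, $p^*$ has a left adjoint $p_\#$, and for every Cartesian square $pf'=fp'$ with $p$ smooth, the transformation $p'_\#f'^*A\xrightarrow{\eta}p'_\#f'^*p^*p_\#A=p'_\#p'^*f^*p_\#A\xrightarrow{\epsilon}f^*p_\#A$ is invertible; (c) for every closed immersion $z$, $z^*$ has a right adjoint $z_*$, which is fully faithful; (d) for every closed immersion $z$ with complementary open immersion $u$, the pair $(z^*,u^* )$ is jointly conservative. A morphism $R=(\mathcal{R},\theta):\mathbb{H}_1\to\mathbb{H}_2$: functors $R_S:\mathbb{H}_1(S)\to\mathbb{H}_2(S)$ and natural isomorphisms $\theta_f:f^*R_S(A)\xrightarrow{\sim}R_T(f^*A)$ with $\theta_{gf}=\theta_f\circ f^*\theta_g$ modulo $(gf)^*=f^*g^*$; triangulated if the $R_S$ are triangulated functors and the $\theta_f$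 compatible with shifts; smooth-adjointable if for every smooth $p:P\to S$ the composite $p_\#R_P(A)\xrightarrow{\eta}p_\#R_P(p^*p_\#A)\xrightarrow{\theta_p^{-1}}p_\#p^*R_S(p_\#A)\xrightarrow{\epsilon}R_S(p_\#A)$ is invertible. An external tensor structure $(\boxtimes,m)$ on $\mathbb{H}$: functors $\boxtimes:\mathbb{H}(S_1)\times\mathbb{H}(S_2)\to\mathbb{H}(S_1\times S_2)$ and natural isomorphisms $m_{f_1,f_2}:f_1^*A_1\boxtimes f_2^*A_2\xrightarrow{\sim}(f_1\times f_2)^*(A_1\boxtimes A_2)$ with $m_{g_1f_1,g_2f_2}=(f_1\times f_2)^*m_{g_1,g_2}\circ m_{f_1,f_2}$ modulo connection isomorphisms; triangulated if $\boxtimes$ is triangulated in each variable (bitriangulated) and $m$ is compatible with shifts; smooth-adjointable if for all smooth $p_i:P_i\to S_i$ the composite $(p_1\times p_2)_\#(A_1\boxtimes A_2)\xrightarrow{\eta}(p_1\times p_2)_\#(p_1^*p_{1,\#}A_1\boxtimes p_2^*p_{2,\#}A_2)\xrightarrow{m}(p_1\times p_2)_\#(p_1\times p_2)^*(p_{1,\#}A_1\boxtimes p_{2,\#}A_2)\xrightarrow{\epsilon}p_{1,\#}A_1\boxtimes p_{2,\#}A_2$ is invertible. For closed immersions $z:Z\to S$, $z_i:Z_i\to S_i$, with $(z_1\times z_2)_*$ denoting the right adjoint of $(z_1\times z_2)^*$, the following transformations are invertible in this setting: $\bar\theta_z:R_S(z_*A)\xrightarrow{\eta}z_*z^*R_S(z_*A)\xrightarrow{\theta_z}z_*R_Z(z^*z_*A)\xrightarrow{\epsilon}z_*R_Z(A)$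 and $\bar m_{j;z_1,z_2}:z_{1,*}A_1\boxtimes_jz_{2,*}A_2\xrightarrow{\eta}(z_1\times z_2)_*(z_1\times z_2)^*(z_{1,*}A_1\boxtimes_jz_{2,*}A_2)\xrightarrow{m_j^{-1}}(z_1\times z_2)_*(z_1^*z_{1,*}A_1\boxtimes_jz_2^*z_{2,*}A_2)\xrightarrow{\epsilon}(z_1\times z_2)_*(A_1\boxtimes_jA_2)$. An external tensor structure $\rho$ on $R$ (over $\mathcal{S}$, resp. over $\mathcal{S}^{sm}$) is a family of natural isomorphisms $\rho_{S_1,S_2}:R_{S_1}(A_1)\boxtimes_2R_{S_2}(A_2)\xrightarrow{\sim}R_{S_1\times S_2}(A_1\boxtimes_1A_2)$ such that for all $f_i:T_i\to S_i$ in $\mathcal{S}$ (resp. $\mathcal{S}^{sm}$) the two morphisms $\theta_{f_1\times f_2}\circ(f_1\times f_2)^*\rho_{S_1,S_2}\circ m_2$ and $R_{T_1\times T_2}(m_1)\circ\rho_{T_1,T_2}\circ(\theta_{f_1}\boxtimes_2\theta_{f_2})$ from $f_1^*R_{S_1}(A_1)\boxtimes_2f_2^*R_{S_2}(A_2)$ to $R_{T_1\times T_2}((f_1\times f_2)^*(A_1\boxtimes_1A_2))$ coincide. Over $\mathcal{S}^{cl,op}$ the condition is: for all closed immersions $z_i:Z_i\to S_i$ the morphisms $\bar\theta_{z_1\times z_2}^{-1}\circ(z_1\times z_2)_*\rho_{Z_1,Z_2}\circ\bar m_2$ and $R_{S_1\times S_2}(\bar m_1)\circ\rho_{S_1,S_2}\circ(\bar\theta_{z_1}^{-1}\boxtimes_2\bar\theta_{z_2}^{-1})$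 from $z_{1,*}R_{Z_1}(A_1)\boxtimes_2z_{2,*}R_{Z_2}(A_2)$ to $R_{S_1\times S_2}((z_1\times z_2)_*(A_1\boxtimes_1A_2))$ coincide. Triangulated means that $\rho$ is compatible with shifts in each variable. An external tensor core on $R$ consists of a triangulated external tensor structure $\rho^{sm}$ over $\mathcal{S}^{sm}$ and a triangulated external tensor structure $\rho^{cl}$ over $\mathcal{S}^{cl,op}$ with $\rho^{sm}_{S_1,S_2}=\rho^{cl}_{S_1,S_2}$ for all $S_1,S_2$ (the common family is denoted $\rho$).
   Formalization: It is additionally assumed that for closed immersions z_1, z_2 the functors (z_1×z_2)^* on H_1 and H_2 have right adjoints and θ̄_{z_1×z_2} is invertible, as the condition over S^{cl,op} requires; the listed axioms do not guarantee this. *)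

theory Defs
  imports "HOL-Algebra.Group"
begin

section \<open>Categories, functors, adjunctions\<close>

text \<open>A category is given by carrier sets of objects and arrows. The operations are only constrained
  on the carriers. The application \<open>g \<cdot>\<^bsub>C\<^esub> f\<close> means ``first \<open>f\<close>, then \<open>g\<close>''.\<close>

record ('o, 'm) cat =
  Obj  :: "'o set"
  Arr  :: "'m set"
  Dom  :: "'m \<Rightarrow> 'o"
  Cod  :: "'m \<Rightarrow> 'o"
  Id   :: "'o \<Rightarrow> 'm"
  Comp :: "'m \<Rightarrow> 'm \<Rightarrow> 'm"  (infixr "\<cdot>\<index>" 70)

definition Hom :: "('o, 'm, 'z) cat_scheme \<Rightarrow> 'o \<Rightarrow> 'o \<Rightarrow> 'm set" where
  "Hom C X Y = {f \<in> Arr C. Dom C f = X \<and> Cod C f = Y}"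

locale category =
  fixes C :: "('o, 'm, 'z) cat_scheme" (structure)
  assumes Dom_Obj: "f \<in> Arr C \<Longrightarrow> Dom C f \<in> Obj C"
    and Cod_Obj: "f \<in> Arr C \<Longrightarrow> Cod C f \<in> Obj C"
    and Id_Hom: "X \<in> Obj C \<Longrightarrow> Id C X \<in> Hom C X X"
    and Comp_Hom: "\<lbrakk>f \<in> Hom C X Y; g \<in> Hom C Y Z\<rbrakk> \<Longrightarrow> g \<cdot> f \<in> Hom C X Z"
    and Comp_Id: "f \<in> Hom C X Y \<Longrightarrow> f \<cdot> Id C X = f"
    and Id_Comp: "f \<in> Hom C X Y \<Longrightarrow> Id C Y \<cdot> f = f"
    and Comp_assoc:
      "\<lbrakk>f \<in> Hom C X Y; g \<in> Hom C Y Z; h \<in> Hom C Z W\<rbrakk> \<Longrightarrow> (h \<cdot> g) \<cdot> f = h \<cdot> (g \<cdot> f)"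

definition is_inverse :: "('o, 'm, 'z) cat_scheme \<Rightarrow> 'm \<Rightarrow> 'm \<Rightarrow> bool" where
  "is_inverse C f g \<longleftrightarrow> g \<in> Hom C (Cod C f) (Dom C f) \<and>
     g \<cdot>\<^bsub>C\<^esub> f = Id C (Dom C f) \<and> f \<cdot>\<^bsub>C\<^esub> g = Id C (Cod C f)"

definition is_iso :: "('o, 'm, 'z) cat_scheme \<Rightarrow> 'm \<Rightarrow> bool" where
  "is_iso C f \<longleftrightarrow> f \<in> Arr C \<and> (\<exists>g. is_inverse C f g)"

definition inv_arr :: "('o, 'm, 'z) cat_scheme \<Rightarrow> 'm \<Rightarrow> 'm" where
  "inv_arr C f = (THE g. is_inverse C f g)"

definition prod_cat ::
  "('o, 'm, 'z) cat_scheme \<Rightarrow> ('p, 'n, 'y) cat_scheme \<Rightarrow> ('o \<times> 'p, 'm \<times> 'n) cat" where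
  "prod_cat C D =
    \<lparr>Obj = Obj C \<times> Obj D, Arr = Arr C \<times> Arr D,
     Dom = (\<lambda>(f, g). (Dom C f, Dom D g)), Cod = (\<lambda>(f, g). (Cod C f, Cod D g)),
     Id = (\<lambda>(X, Y). (Id C X, Id D Y)),
     Comp = (\<lambda>(f', g') (f, g). (f' \<cdot>\<^bsub>C\<^esub> f, g' \<cdot>\<^bsub>D\<^esub> g))\<rparr>"

definition is_initial :: "('o, 'm, 'z) cat_scheme \<Rightarrow> 'o \<Rightarrow> bool" where
  "is_initial C X \<longleftrightarrow> X \<in> Obj C \<and> (\<forall>Y\<in>Obj C. \<exists>!f. f \<in> Hom C X Y)"

definition initial_arr :: "('o, 'm, 'z) cat_scheme \<Rightarrow> 'o \<Rightarrow> 'o \<Rightarrow> 'm" where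
  "initial_arr C X Y = (THE f. f \<in> Hom C X Y)"

definition is_zero_obj :: "('o, 'm, 'z) cat_scheme \<Rightarrow> 'o \<Rightarrow> bool" where
  "is_zero_obj C X \<longleftrightarrow> is_initial C X \<and> (\<forall>Y\<in>Obj C. \<exists>!f. f \<in> Hom C Y X)"

definition is_product ::
  "('o, 'm, 'z) cat_scheme \<Rightarrow> 'o \<Rightarrow> 'o \<Rightarrow> 'o \<Rightarrow> 'm \<Rightarrow> 'm \<Rightarrow> bool" where
  "is_product C X Y P p q \<longleftrightarrow> p \<in> Hom C P X \<and> q \<in> Hom C P Y \<and>
     (\<forall>T\<in>Obj C. \<forall>f\<in>Hom C T X. \<forall>g\<in>Hom C T Y.
        \<exists>!h. h \<in> Hom C T P \<and> p \<cdot>\<^bsub>C\<^esub> h = f \<and> q \<cdot>\<^bsub>C\<^esub> h = g)"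

text \<open>\<open>is_cartesian C a b f g\<close>: the square \<open>f \<cdot> a = g \<cdot> b\<close> is Cartesian,
  where \<open>a\<close> is parallel to \<open>g\<close> and \<open>b\<close> is parallel to \<open>f\<close>.\<close>

definition is_cartesian ::
  "('o, 'm, 'z) cat_scheme \<Rightarrow> 'm \<Rightarrow> 'm \<Rightarrow> 'm \<Rightarrow> 'm \<Rightarrow> bool" where
  "is_cartesian C a b f g \<longleftrightarrow>
     a \<in> Arr C \<and> b \<in> Arr C \<and> f \<in> Arr C \<and> g \<in> Arr C \<and>
     Dom C a = Dom C b \<and> Cod C a = Dom C f \<and> Cod C b = Dom C g \<and> Cod C f = Cod C g \<and>
     f \<cdot>\<^bsub>C\<^esub> a = g \<cdot>\<^bsub>C\<^esub> b \<and>
     (\<forall>T\<in>Obj C. \<forall>x\<in>Hom C T (Dom C f). \<forall>y\<in>Hom C T (Dom C g).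
        f \<cdot>\<^bsub>C\<^esub> x = g \<cdot>\<^bsub>C\<^esub> y \<longrightarrow>
        (\<exists>!h. h \<in> Hom C T (Dom C a) \<and> a \<cdot>\<^bsub>C\<^esub> h = x \<and> b \<cdot>\<^bsub>C\<^esub> h = y))"

record ('o, 'm, 'p, 'n) func =
  Fo :: "'o \<Rightarrow> 'p"
  Fa :: "'m \<Rightarrow> 'n"

definition is_functor ::
  "('o, 'm, 'z) cat_scheme \<Rightarrow> ('p, 'n, 'y) cat_scheme \<Rightarrow> ('o, 'm, 'p, 'n) func \<Rightarrow> bool" where
  "is_functor C D F \<longleftrightarrow>
     (\<forall>X\<in>Obj C. Fo F X \<in> Obj D \<and> Fa F (Id C X) = Id D (Fo F X)) \<and>
     (\<forall>f\<in>Arr C. Fa F f \<in> Hom D (Fo F (Dom C f)) (Fo F (Cod C f))) \<and>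
     (\<forall>f\<in>Arr C. \<forall>g\<in>Arr C. Cod C f = Dom C g \<longrightarrow> Fa F (g \<cdot>\<^bsub>C\<^esub> f) = Fa F g \<cdot>\<^bsub>D\<^esub> Fa F f)"

definition id_func :: "('o, 'm, 'o, 'm) func" where
  "id_func = \<lparr>Fo = (\<lambda>X. X), Fa = (\<lambda>f. f)\<rparr>"

definition comp_func ::
  "('p, 'n, 'q, 'k) func \<Rightarrow> ('o, 'm, 'p, 'n) func \<Rightarrow> ('o, 'm, 'q, 'k) func"
  (infixr "\<odot>" 75) where
  "G \<odot> F = \<lparr>Fo = (\<lambda>X. Fo G (Fo F X)), Fa = (\<lambda>f. Fa G (Fa F f))\<rparr>"

definition prod_func ::
  "('o, 'm, 'p, 'n) func \<Rightarrow> ('o', 'm', 'p', 'n') func \<Rightarrow>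
   ('o \<times> 'o', 'm \<times> 'm', 'p \<times> 'p', 'n \<times> 'n') func" where
  "prod_func F G = \<lparr>Fo = (\<lambda>(X, Y). (Fo F X, Fo G Y)), Fa = (\<lambda>(f, g). (Fa F f, Fa G g))\<rparr>"

definition fully_faithful ::
  "('o, 'm, 'z) cat_scheme \<Rightarrow> ('p, 'n, 'y) cat_scheme \<Rightarrow> ('o, 'm, 'p, 'n) func \<Rightarrow> bool" where
  "fully_faithful C D F \<longleftrightarrow>
     (\<forall>X\<in>Obj C. \<forall>Y\<in>Obj C. bij_betw (Fa F) (Hom C X Y) (Hom D (Fo F X) (Fo F Y)))"

definition ess_surj ::
  "('o, 'm, 'z) cat_scheme \<Rightarrow> ('p, 'n, 'y) cat_scheme \<Rightarrow> ('o, 'm, 'p, 'n) func \<Rightarrow> bool" where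
  "ess_surj C D F \<longleftrightarrow> (\<forall>Y\<in>Obj D. \<exists>X\<in>Obj C. \<exists>i\<in>Hom D (Fo F X) Y. is_iso D i)"

definition nat_trans ::
  "('o, 'm, 'z) cat_scheme \<Rightarrow> ('p, 'n, 'y) cat_scheme \<Rightarrow>
   ('o, 'm, 'p, 'n) func \<Rightarrow> ('o, 'm, 'p, 'n) func \<Rightarrow> ('o \<Rightarrow> 'n) \<Rightarrow> bool" where
  "nat_trans C D F G t \<longleftrightarrow>
     (\<forall>X\<in>Obj C. t X \<in> Hom D (Fo F X) (Fo G X)) \<and>
     (\<forall>f\<in>Arr C. Fa G f \<cdot>\<^bsub>D\<^esub> t (Dom C f) = t (Cod C f) \<cdot>\<^bsub>D\<^esub> Fa F f)"

definition nat_iso ::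
  "('o, 'm, 'z) cat_scheme \<Rightarrow> ('p, 'n, 'y) cat_scheme \<Rightarrow>
   ('o, 'm, 'p, 'n) func \<Rightarrow> ('o, 'm, 'p, 'n) func \<Rightarrow> ('o \<Rightarrow> 'n) \<Rightarrow> bool" where
  "nat_iso C D F G t \<longleftrightarrow> nat_trans C D F G t \<and> (\<forall>X\<in>Obj C. is_iso D (t X))"

text \<open>\<open>F\<close> from \<open>C\<close> to \<open>D\<close> is left adjoint to \<open>G\<close>.\<close>

definition adjunction ::
  "('o, 'm, 'z) cat_scheme \<Rightarrow> ('p, 'n, 'y) cat_scheme \<Rightarrow>
   ('o, 'm, 'p, 'n) func \<Rightarrow> ('p, 'n, 'o, 'm) func \<Rightarrow> ('o \<Rightarrow> 'm) \<Rightarrow> ('p \<Rightarrow> 'n) \<Rightarrow> bool" where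
  "adjunction C D F G \<eta> \<epsilon> \<longleftrightarrow>
     is_functor C D F \<and> is_functor D C G \<and>
     nat_trans C C id_func (G \<odot> F) \<eta> \<and> nat_trans D D (F \<odot> G) id_func \<epsilon> \<and>
     (\<forall>X\<in>Obj C. \<epsilon> (Fo F X) \<cdot>\<^bsub>D\<^esub> Fa F (\<eta> X) = Id D (Fo F X)) \<and>
     (\<forall>Y\<in>Obj D. Fa G (\<epsilon> Y) \<cdot>\<^bsub>C\<^esub> \<eta> (Fo G Y) = Id C (Fo G Y))"


section \<open>Triangulated categories\<close>

text \<open>A distinguished triangle \<open>X \<rightarrow> Y \<rightarrow> Z \<rightarrow> X[1]\<close> is recorded as the triple of its arrows.\<close>

record ('o, 'm) tricat = "('o, 'm) cat" +
  Add   :: "'m \<Rightarrow> 'm \<Rightarrow> 'm"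
  Zero  :: "'o \<Rightarrow> 'o \<Rightarrow> 'm"
  Shift :: "('o, 'm, 'o, 'm) func"
  Dist  :: "('m \<times> 'm \<times> 'm) set"

definition hom_group :: "('o, 'm, 'z) tricat_scheme \<Rightarrow> 'o \<Rightarrow> 'o \<Rightarrow> 'm monoid" where
  "hom_group C X Y = \<lparr>carrier = Hom C X Y, mult = Add C, one = Zero C X Y\<rparr>"

definition neg_arr :: "('o, 'm, 'z) tricat_scheme \<Rightarrow> 'm \<Rightarrow> 'm" where
  "neg_arr C f = inv\<^bsub>hom_group C (Dom C f) (Cod C f)\<^esub> f"

definition is_triangle :: "('o, 'm, 'z) tricat_scheme \<Rightarrow> 'm \<Rightarrow> 'm \<Rightarrow> 'm \<Rightarrow> bool" where
  "is_triangle C f g h \<longleftrightarrow> f \<in> Arr C \<and> g \<in> Arr C \<and> h \<in> Arr C \<and>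
     Cod C f = Dom C g \<and> Cod C g = Dom C h \<and> Cod C h = Fo (Shift C) (Dom C f)"

definition additive_func ::
  "('o, 'm, 'z) tricat_scheme \<Rightarrow> ('p, 'n, 'y) tricat_scheme \<Rightarrow> ('o, 'm, 'p, 'n) func \<Rightarrow> bool" where
  "additive_func C D F \<longleftrightarrow>
     (\<forall>X\<in>Obj C. \<forall>Y\<in>Obj C. \<forall>f\<in>Hom C X Y. \<forall>g\<in>Hom C X Y.
        Fa F (Add C f g) = Add D (Fa F f) (Fa F g))"

locale additive_category = category C for C :: "('o, 'm, 'z) tricat_scheme" (structure) +
  assumes hom_comm_group: "\<lbrakk>X \<in> Obj C; Y \<in> Obj C\<rbrakk> \<Longrightarrow> comm_group (hom_group C X Y)"
    and Comp_Add_left: "\<lbrakk>f \<in> Hom C X Y; g \<in> Hom C Y Z; g' \<in> Hom C Y Z\<rbrakk>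
      \<Longrightarrow> Add C g g' \<cdot> f = Add C (g \<cdot> f) (g' \<cdot> f)"
    and Comp_Add_right: "\<lbrakk>f \<in> Hom C X Y; f' \<in> Hom C X Y; g \<in> Hom C Y Z\<rbrakk>
      \<Longrightarrow> g \<cdot> Add C f f' = Add C (g \<cdot> f) (g \<cdot> f')"
    and ex_zero_obj: "\<exists>Z. is_zero_obj C Z"
    and ex_product: "\<lbrakk>X \<in> Obj C; Y \<in> Obj C\<rbrakk> \<Longrightarrow> \<exists>P p q. is_product C X Y P p q"

locale triangulated_category = additive_category C
  for C :: "('o, 'm, 'z) tricat_scheme" (structure) +
  assumes shift_functor: "is_functor C C (Shift C)"
    and shift_additive: "additive_func C C (Shift C)"
    and shift_fully_faithful: "fully_faithful C C (Shift C)"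
    and shift_ess_surj: "ess_surj C C (Shift C)"
    and Dist_triangle: "(f, g, h) \<in> Dist C \<Longrightarrow> is_triangle C f g h"
    and TR1_iso: "\<lbrakk>(f, g, h) \<in> Dist C; is_triangle C f' g' h';
        a \<in> Hom C (Dom C f) (Dom C f'); b \<in> Hom C (Dom C g) (Dom C g');
        c \<in> Hom C (Dom C h) (Dom C h'); is_iso C a; is_iso C b; is_iso C c;
        b \<cdot> f = f' \<cdot> a; c \<cdot> g = g' \<cdot> b; Fa (Shift C) a \<cdot> h = h' \<cdot> c\<rbrakk>
      \<Longrightarrow> (f', g', h') \<in> Dist C"
    and TR1_id: "\<lbrakk>X \<in> Obj C; is_zero_obj C Z\<rbrakk>
      \<Longrightarrow> (Id C X, Zero C X Z, Zero C Z (Fo (Shift C) X)) \<in> Dist C"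
    and TR1_cone: "f \<in> Arr C \<Longrightarrow> \<exists>g h. (f, g, h) \<in> Dist C"
    and TR2: "is_triangle C f g h
      \<Longrightarrow> (f, g, h) \<in> Dist C \<longleftrightarrow> (g, h, neg_arr C (Fa (Shift C) f)) \<in> Dist C"
    and TR3: "\<lbrakk>(f, g, h) \<in> Dist C; (f', g', h') \<in> Dist C;
        a \<in> Hom C (Dom C f) (Dom C f'); b \<in> Hom C (Dom C g) (Dom C g'); b \<cdot> f = f' \<cdot> a\<rbrakk>
      \<Longrightarrow> \<exists>c\<in>Hom C (Dom C h) (Dom C h'). c \<cdot> g = g' \<cdot> b \<and> Fa (Shift C) a \<cdot> h = h' \<cdot> c"
    and TR4: "\<lbrakk>f \<in> Hom C X Y; g \<in> Hom C Y Z;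
        (f, a, b) \<in> Dist C; (g, c, d) \<in> Dist C; (g \<cdot> f, e, k) \<in> Dist C\<rbrakk>
      \<Longrightarrow> \<exists>s\<in>Hom C (Cod C a) (Cod C e). \<exists>t\<in>Hom C (Cod C e) (Cod C c).
            (s, t, Fa (Shift C) a \<cdot> d) \<in> Dist C \<and>
            s \<cdot> a = e \<cdot> g \<and> k \<cdot> s = b \<and> t \<cdot> e = c \<and> d \<cdot> t = Fa (Shift C) f \<cdot> k"

text \<open>A triangulated functor is a pair of a functor \<open>F\<close> and a natural isomorphism
  \<open>\<phi>\<^sub>X : F (X[1]) \<rightarrow> (F X)[1]\<close>.\<close>

definition triangulated_functor ::
  "('o, 'm, 'z) tricat_scheme \<Rightarrow> ('p, 'n, 'y) tricat_scheme \<Rightarrow>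
   ('o, 'm, 'p, 'n) func \<Rightarrow> ('o \<Rightarrow> 'n) \<Rightarrow> bool" where
  "triangulated_functor C D F \<phi> \<longleftrightarrow>
     is_functor C D F \<and> additive_func C D F \<and>
     nat_iso C D (F \<odot> Shift C) (Shift D \<odot> F) \<phi> \<and>
     (\<forall>f g h. (f, g, h) \<in> Dist C \<longrightarrow>
        (Fa F f, Fa F g, \<phi> (Dom C f) \<cdot>\<^bsub>D\<^esub> Fa F h) \<in> Dist D)"


section \<open>The base category\<close>

text \<open>\<open>Compl S z\<close> is the distinguished open immersion complementary to \<open>z\<close>.\<close>

record ('s, 'a) base = "('s, 'a) cat" +
  Prod  :: "'s \<Rightarrow> 's \<Rightarrow> 's"
  Pr1   :: "'s \<Rightarrow> 's \<Rightarrow> 'a"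
  Pr2   :: "'s \<Rightarrow> 's \<Rightarrow> 'a"
  Sm    :: "'a set"
  Cl    :: "'a set"
  Empt  :: "'s"
  Compl :: "'a \<Rightarrow> 'a"

definition prod_arr :: "('s, 'a, 'z) base_scheme \<Rightarrow> 'a \<Rightarrow> 'a \<Rightarrow> 'a" where
  "prod_arr S f1 f2 = (THE h.
     h \<in> Hom S (Prod S (Dom S f1) (Dom S f2)) (Prod S (Cod S f1) (Cod S f2)) \<and>
     Pr1 S (Cod S f1) (Cod S f2) \<cdot>\<^bsub>S\<^esub> h = f1 \<cdot>\<^bsub>S\<^esub> Pr1 S (Dom S f1) (Dom S f2) \<and>
     Pr2 S (Cod S f1) (Cod S f2) \<cdot>\<^bsub>S\<^esub> h = f2 \<cdot>\<^bsub>S\<^esub> Pr2 S (Dom S f1) (Dom S f2))"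

definition wide_subcategory :: "('o, 'm, 'z) cat_scheme \<Rightarrow> 'm set \<Rightarrow> bool" where
  "wide_subcategory C M \<longleftrightarrow> M \<subseteq> Arr C \<and> (\<forall>f. is_iso C f \<longrightarrow> f \<in> M) \<and>
     (\<forall>f\<in>M. \<forall>g\<in>M. Cod C f = Dom C g \<longrightarrow> g \<cdot>\<^bsub>C\<^esub> f \<in> M)"

locale base_category = category S for S :: "('s, 'a, 'z) base_scheme" (structure) +
  assumes product: "\<lbrakk>X \<in> Obj S; Y \<in> Obj S\<rbrakk>
      \<Longrightarrow> is_product S X Y (Prod S X Y) (Pr1 S X Y) (Pr2 S X Y)"
    and Sm_subcategory: "wide_subcategory S (Sm S)"
    and Cl_subcategory: "wide_subcategory S (Cl S)"
    and Sm_pullback: "\<lbrakk>p \<in> Sm S; f \<in> Arr S; Cod S f = Cod S p\<rbrakk>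
      \<Longrightarrow> \<exists>f' p'. is_cartesian S f' p' p f"
    and Sm_base_change: "\<lbrakk>p \<in> Sm S; is_cartesian S f' p' p f\<rbrakk> \<Longrightarrow> p' \<in> Sm S"
    and Cl_base_change: "\<lbrakk>p \<in> Sm S; z \<in> Cl S; is_cartesian S z' p' p z\<rbrakk> \<Longrightarrow> z' \<in> Cl S"
    and Cl_cancel: "\<lbrakk>z \<in> Arr S; g \<in> Arr S; Cod S z = Dom S g; g \<cdot> z \<in> Cl S\<rbrakk> \<Longrightarrow> z \<in> Cl S"
    and factorization: "f \<in> Arr S
      \<Longrightarrow> \<exists>t\<in>Cl S. \<exists>p\<in>Sm S. Cod S t = Dom S p \<and> f = p \<cdot> t"
    and initial: "is_initial S (Empt S)"
    and Compl_Sm: "z \<in> Cl S \<Longrightarrow> Compl S z \<in> Sm S \<and> Cod S (Compl S z) = Cod S z"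
    and Compl_universal: "\<lbrakk>z \<in> Cl S; T \<in> Obj S\<rbrakk> \<Longrightarrow>
      bij_betw (\<lambda>g. Compl S z \<cdot> g) (Hom S T (Dom S (Compl S z)))
        {f \<in> Hom S T (Cod S z).
           is_cartesian S (initial_arr S (Empt S) T) (initial_arr S (Empt S) (Dom S z)) f z}"


section \<open>Fibered categories\<close>

text \<open>For \<open>f : T \<rightarrow> S\<close> the functor \<open>pull H f\<close> goes from \<open>fib H S\<close> to \<open>fib H T\<close>, with shift isomorphism
  \<open>pull_shift H f A : f\<^sup>*(A[1]) \<rightarrow> (f\<^sup>*A)[1]\<close>; \<open>conn H f g A\<close> goes from \<open>(g f)\<^sup>*A\<close> to \<open>f\<^sup>*g\<^sup>*A\<close>.
  All fibers share one type of objects and one type of arrows but have their own carriers.\<close>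

record ('s, 'a, 'o, 'm) fibcat =
  fib        :: "'s \<Rightarrow> ('o, 'm) tricat"
  pull       :: "'a \<Rightarrow> ('o, 'm, 'o, 'm) func"
  pull_shift :: "'a \<Rightarrow> 'o \<Rightarrow> 'm"
  conn       :: "'a \<Rightarrow> 'a \<Rightarrow> 'o \<Rightarrow> 'm"

locale fibered_category =
  fixes S :: "('s, 'a) base" and H :: "('s, 'a, 'o, 'm) fibcat"
  assumes fib_category: "X \<in> Obj S \<Longrightarrow> category (fib H X)"
    and pull_functor: "f \<in> Hom S T X \<Longrightarrow> is_functor (fib H X) (fib H T) (pull H f)"
    and pull_Id_Obj: "\<lbrakk>X \<in> Obj S; A \<in> Obj (fib H X)\<rbrakk> \<Longrightarrow> Fo (pull H (Id S X)) A = A"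
    and pull_Id_Arr: "\<lbrakk>X \<in> Obj S; a \<in> Arr (fib H X)\<rbrakk> \<Longrightarrow> Fa (pull H (Id S X)) a = a"
    and conn_nat_iso: "\<lbrakk>f \<in> Hom S T X; g \<in> Hom S X Y\<rbrakk> \<Longrightarrow>
      nat_iso (fib H Y) (fib H T) (pull H (g \<cdot>\<^bsub>S\<^esub> f)) (pull H f \<odot> pull H g) (conn H f g)"
    and conn_cocycle:
      "\<lbrakk>f \<in> Hom S T X; g \<in> Hom S X Y; h \<in> Hom S Y Z; A \<in> Obj (fib H Z)\<rbrakk> \<Longrightarrow>
        Fa (pull H f) (conn H g h A) \<cdot>\<^bsub>fib H T\<^esub> conn H f (h \<cdot>\<^bsub>S\<^esub> g) A
        = conn H f g (Fo (pull H h) A) \<cdot>\<^bsub>fib H T\<^esub> conn H (g \<cdot>\<^bsub>S\<^esub> f) h A"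

locale triangulated_fibered_category = fibered_category S H
  for S :: "('s, 'a) base" and H :: "('s, 'a, 'o, 'm) fibcat" +
  assumes fib_triangulated: "X \<in> Obj S \<Longrightarrow> triangulated_category (fib H X)"
    and pull_triangulated: "f \<in> Hom S T X \<Longrightarrow>
      triangulated_functor (fib H X) (fib H T) (pull H f) (pull_shift H f)"
    and conn_shift: "\<lbrakk>f \<in> Hom S T X; g \<in> Hom S X Y; A \<in> Obj (fib H Y)\<rbrakk> \<Longrightarrow>
      Fa (Shift (fib H T)) (conn H f g A) \<cdot>\<^bsub>fib H T\<^esub> pull_shift H (g \<cdot>\<^bsub>S\<^esub> f) A
      = pull_shift H f (Fo (pull H g) A) \<cdot>\<^bsub>fib H T\<^esub> Fa (pull H f) (pull_shift H g A)
          \<cdot>\<^bsub>fib H T\<^esub> conn H f g (Fo (Shift (fib H Y)) A)"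

text \<open>The adjoints \<open>p\<^sub>#\<close> and \<open>z\<^sub>*\<close> are properties of \<open>H\<close>; a choice of functor, unit and counit is fixed
  by Hilbert choice. It is only meaningful when the adjoint exists.\<close>

definition has_sharp :: "('s, 'a) base \<Rightarrow> ('s, 'a, 'o, 'm) fibcat \<Rightarrow> 'a \<Rightarrow> bool" where
  "has_sharp S H p \<longleftrightarrow>
     (\<exists>F \<eta> \<epsilon>. adjunction (fib H (Dom S p)) (fib H (Cod S p)) F (pull H p) \<eta> \<epsilon>)"

definition sharp_adj :: "('s, 'a) base \<Rightarrow> ('s, 'a, 'o, 'm) fibcat \<Rightarrow> 'a \<Rightarrow>
    ('o, 'm, 'o, 'm) func \<times> ('o \<Rightarrow> 'm) \<times> ('o \<Rightarrow> 'm)" where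
  "sharp_adj S H p = (SOME (F, \<eta>, \<epsilon>).
     adjunction (fib H (Dom S p)) (fib H (Cod S p)) F (pull H p) \<eta> \<epsilon>)"

definition sharp where "sharp S H p = fst (sharp_adj S H p)"
definition sharp_unit where "sharp_unit S H p = fst (snd (sharp_adj S H p))"
definition sharp_counit where "sharp_counit S H p = snd (snd (sharp_adj S H p))"

definition has_star :: "('s, 'a) base \<Rightarrow> ('s, 'a, 'o, 'm) fibcat \<Rightarrow> 'a \<Rightarrow> bool" where
  "has_star S H z \<longleftrightarrow>
     (\<exists>G \<eta> \<epsilon>. adjunction (fib H (Cod S z)) (fib H (Dom S z)) (pull H z) G \<eta> \<epsilon>)"

definition star_adj :: "('s, 'a) base \<Rightarrow> ('s, 'a, 'o, 'm) fibcat \<Rightarrow> 'a \<Rightarrow>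
    ('o, 'm, 'o, 'm) func \<times> ('o \<Rightarrow> 'm) \<times> ('o \<Rightarrow> 'm)" where
  "star_adj S H z = (SOME (G, \<eta>, \<epsilon>).
     adjunction (fib H (Cod S z)) (fib H (Dom S z)) (pull H z) G \<eta> \<epsilon>)"

definition star where "star S H z = fst (star_adj S H z)"
definition star_unit where "star_unit S H z = fst (snd (star_adj S H z))"
definition star_counit where "star_counit S H z = snd (snd (star_adj S H z))"

text \<open>For a Cartesian square \<open>p f' = f p'\<close>, the exchange map \<open>p'\<^sub># f'\<^sup>* A \<rightarrow> f\<^sup>* p\<^sub># A\<close>.\<close>

definition exchange ::
  "('s, 'a) base \<Rightarrow> ('s, 'a, 'o, 'm) fibcat \<Rightarrow> 'a \<Rightarrow> 'a \<Rightarrow> 'a \<Rightarrow> 'a \<Rightarrow> 'o \<Rightarrow> 'm" where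
  "exchange S H f' p' p f A =
    (let P' = fib H (Dom S p'); T = fib H (Cod S p'); pA = Fo (sharp S H p) A
     in sharp_counit S H p' (Fo (pull H f) pA) \<cdot>\<^bsub>T\<^esub>
        Fa (sharp S H p')
          (conn H p' f pA \<cdot>\<^bsub>P'\<^esub> inv_arr P' (conn H f' p pA)
             \<cdot>\<^bsub>P'\<^esub> Fa (pull H f') (sharp_unit S H p A)))"

locale localic = triangulated_fibered_category S H
  for S :: "('s, 'a) base" and H :: "('s, 'a, 'o, 'm) fibcat" +
  assumes fib_Empt: "A \<in> Obj (fib H (Empt S)) \<Longrightarrow> is_zero_obj (fib H (Empt S)) A"
    and Sm_has_sharp: "p \<in> Sm S \<Longrightarrow> has_sharp S H p"
    and exchange_iso: "\<lbrakk>p \<in> Sm S; is_cartesian S f' p' p f; A \<in> Obj (fib H (Dom S p))\<rbrakk>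
      \<Longrightarrow> is_iso (fib H (Dom S f)) (exchange S H f' p' p f A)"
    and Cl_has_star: "z \<in> Cl S \<Longrightarrow> has_star S H z"
    and star_fully_faithful: "z \<in> Cl S
      \<Longrightarrow> fully_faithful (fib H (Dom S z)) (fib H (Cod S z)) (star S H z)"
    and jointly_conservative: "\<lbrakk>z \<in> Cl S; a \<in> Arr (fib H (Cod S z));
        is_iso (fib H (Dom S z)) (Fa (pull H z) a);
        is_iso (fib H (Dom S (Compl S z))) (Fa (pull H (Compl S z)) a)\<rbrakk>
      \<Longrightarrow> is_iso (fib H (Cod S z)) a"


section \<open>Morphisms of fibered categories\<close>

text \<open>\<open>mor_shift R X A : R\<^sub>X(A[1]) \<rightarrow> (R\<^sub>X A)[1]\<close> and \<open>theta R f A : f\<^sup>* R\<^sub>X A \<rightarrow> R\<^sub>T f\<^sup>*A\<close>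
  for \<open>f : T \<rightarrow> X\<close>.\<close>

record ('s, 'a, 'o, 'm, 'p, 'n) fibmor =
  mor       :: "'s \<Rightarrow> ('o, 'm, 'p, 'n) func"
  mor_shift :: "'s \<Rightarrow> 'o \<Rightarrow> 'n"
  theta     :: "'a \<Rightarrow> 'o \<Rightarrow> 'n"

locale fibered_morphism =
  fixes S :: "('s, 'a) base" and H1 :: "('s, 'a, 'o, 'm) fibcat" and H2 :: "('s, 'a, 'p, 'n) fibcat"
    and R :: "('s, 'a, 'o, 'm, 'p, 'n) fibmor"
  assumes mor_functor: "X \<in> Obj S \<Longrightarrow> is_functor (fib H1 X) (fib H2 X) (mor R X)"
    and theta_nat_iso: "f \<in> Hom S T X \<Longrightarrow>
      nat_iso (fib H1 X) (fib H2 T) (pull H2 f \<odot> mor R X) (mor R T \<odot> pull H1 f) (theta R f)"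
    and theta_comp: "\<lbrakk>f \<in> Hom S T X; g \<in> Hom S X Y; A \<in> Obj (fib H1 Y)\<rbrakk> \<Longrightarrow>
      Fa (mor R T) (conn H1 f g A) \<cdot>\<^bsub>fib H2 T\<^esub> theta R (g \<cdot>\<^bsub>S\<^esub> f) A
      = theta R f (Fo (pull H1 g) A) \<cdot>\<^bsub>fib H2 T\<^esub> Fa (pull H2 f) (theta R g A)
          \<cdot>\<^bsub>fib H2 T\<^esub> conn H2 f g (Fo (mor R Y) A)"

locale triangulated_fibered_morphism = fibered_morphism S H1 H2 R
  for S :: "('s, 'a) base" and H1 :: "('s, 'a, 'o, 'm) fibcat" and H2 :: "('s, 'a, 'p, 'n) fibcat"
    and R :: "('s, 'a, 'o, 'm, 'p, 'n) fibmor" +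
  assumes mor_triangulated: "X \<in> Obj S \<Longrightarrow>
      triangulated_functor (fib H1 X) (fib H2 X) (mor R X) (mor_shift R X)"
    and theta_shift: "\<lbrakk>f \<in> Hom S T X; A \<in> Obj (fib H1 X)\<rbrakk> \<Longrightarrow>
      Fa (Shift (fib H2 T)) (theta R f A) \<cdot>\<^bsub>fib H2 T\<^esub> pull_shift H2 f (Fo (mor R X) A)
          \<cdot>\<^bsub>fib H2 T\<^esub> Fa (pull H2 f) (mor_shift R X A)
      = mor_shift R T (Fo (pull H1 f) A) \<cdot>\<^bsub>fib H2 T\<^esub> Fa (mor R T) (pull_shift H1 f A)
          \<cdot>\<^bsub>fib H2 T\<^esub> theta R f (Fo (Shift (fib H1 X)) A)"

text \<open>The map \<open>p\<^sub># R\<^sub>P A \<rightarrow> R\<^sub>X p\<^sub># A\<close> for \<open>p : P \<rightarrow> X\<close>.\<close>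

definition theta_sharp ::
  "('s, 'a) base \<Rightarrow> ('s, 'a, 'o, 'm) fibcat \<Rightarrow> ('s, 'a, 'p, 'n) fibcat \<Rightarrow>
   ('s, 'a, 'o, 'm, 'p, 'n) fibmor \<Rightarrow> 'a \<Rightarrow> 'o \<Rightarrow> 'n" where
  "theta_sharp S H1 H2 R p A =
    (let P = fib H2 (Dom S p); X = fib H2 (Cod S p); pA = Fo (sharp S H1 p) A
     in sharp_counit S H2 p (Fo (mor R (Cod S p)) pA) \<cdot>\<^bsub>X\<^esub>
        Fa (sharp S H2 p)
          (inv_arr P (theta R p pA) \<cdot>\<^bsub>P\<^esub> Fa (mor R (Dom S p)) (sharp_unit S H1 p A)))"

definition smooth_adjointable_morphism ::
  "('s, 'a) base \<Rightarrow> ('s, 'a, 'o, 'm) fibcat \<Rightarrow> ('s, 'a, 'p, 'n) fibcat \<Rightarrow>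
   ('s, 'a, 'o, 'm, 'p, 'n) fibmor \<Rightarrow> bool" where
  "smooth_adjointable_morphism S H1 H2 R \<longleftrightarrow>
     (\<forall>p\<in>Sm S. \<forall>A\<in>Obj (fib H1 (Dom S p)).
        is_iso (fib H2 (Cod S p)) (theta_sharp S H1 H2 R p A))"

text \<open>The map \<open>R\<^sub>X z\<^sub>* A \<rightarrow> z\<^sub>* R\<^sub>Z A\<close> for \<open>z : Z \<rightarrow> X\<close>.\<close>

definition theta_bar ::
  "('s, 'a) base \<Rightarrow> ('s, 'a, 'o, 'm) fibcat \<Rightarrow> ('s, 'a, 'p, 'n) fibcat \<Rightarrow>
   ('s, 'a, 'o, 'm, 'p, 'n) fibmor \<Rightarrow> 'a \<Rightarrow> 'o \<Rightarrow> 'n" where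
  "theta_bar S H1 H2 R z A =
    (let Z = fib H2 (Dom S z); X = fib H2 (Cod S z); zA = Fo (star S H1 z) A
     in Fa (star S H2 z)
          (Fa (mor R (Dom S z)) (star_counit S H1 z A) \<cdot>\<^bsub>Z\<^esub> theta R z zA)
        \<cdot>\<^bsub>X\<^esub> star_unit S H2 z (Fo (mor R (Cod S z)) zA))"


section \<open>External tensor structures on fibered categories\<close>

text \<open>\<open>tens E X\<^sub>1 X\<^sub>2\<close> is the functor \<open>\<boxtimes> : H(X\<^sub>1) \<times> H(X\<^sub>2) \<rightarrow> H(X\<^sub>1 \<times> X\<^sub>2)\<close>, with shift isomorphisms
  \<open>tens_shift1 : A\<^sub>1[1] \<boxtimes> A\<^sub>2 \<rightarrow> (A\<^sub>1 \<boxtimes> A\<^sub>2)[1]\<close> and \<open>tens_shift2 : A\<^sub>1 \<boxtimes> A\<^sub>2[1] \<rightarrow> (A\<^sub>1 \<boxtimes> A\<^sub>2)[1]\<close>;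
  \<open>mon E f\<^sub>1 f\<^sub>2\<close> is the isomorphism \<open>m\<close>, indexed by pairs of objects.\<close>

record ('s, 'a, 'o, 'm) ext_tensor =
  tens        :: "'s \<Rightarrow> 's \<Rightarrow> ('o \<times> 'o, 'm \<times> 'm, 'o, 'm) func"
  tens_shift1 :: "'s \<Rightarrow> 's \<Rightarrow> 'o \<times> 'o \<Rightarrow> 'm"
  tens_shift2 :: "'s \<Rightarrow> 's \<Rightarrow> 'o \<times> 'o \<Rightarrow> 'm"
  mon         :: "'a \<Rightarrow> 'a \<Rightarrow> 'o \<times> 'o \<Rightarrow> 'm"

definition tens_left ::
  "('s, 'a, 'o, 'm) fibcat \<Rightarrow> ('s, 'a, 'o, 'm) ext_tensor \<Rightarrow> 's \<Rightarrow> 's \<Rightarrow> 'o \<Rightarrow> ('o, 'm, 'o, 'm) func"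
where
  "tens_left H E X1 X2 A2 =
     \<lparr>Fo = (\<lambda>A1. Fo (tens E X1 X2) (A1, A2)), Fa = (\<lambda>a. Fa (tens E X1 X2) (a, Id (fib H X2) A2))\<rparr>"

definition tens_right ::
  "('s, 'a, 'o, 'm) fibcat \<Rightarrow> ('s, 'a, 'o, 'm) ext_tensor \<Rightarrow> 's \<Rightarrow> 's \<Rightarrow> 'o \<Rightarrow> ('o, 'm, 'o, 'm) func"
where
  "tens_right H E X1 X2 A1 =
     \<lparr>Fo = (\<lambda>A2. Fo (tens E X1 X2) (A1, A2)), Fa = (\<lambda>a. Fa (tens E X1 X2) (Id (fib H X1) A1, a))\<rparr>"

locale external_tensor =
  fixes S :: "('s, 'a) base" and H :: "('s, 'a, 'o, 'm) fibcat" and E :: "('s, 'a, 'o, 'm) ext_tensor"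
  assumes tens_functor: "\<lbrakk>X1 \<in> Obj S; X2 \<in> Obj S\<rbrakk> \<Longrightarrow>
      is_functor (prod_cat (fib H X1) (fib H X2)) (fib H (Prod S X1 X2)) (tens E X1 X2)"
    and mon_nat_iso: "\<lbrakk>f1 \<in> Hom S T1 X1; f2 \<in> Hom S T2 X2\<rbrakk> \<Longrightarrow>
      nat_iso (prod_cat (fib H X1) (fib H X2)) (fib H (Prod S T1 T2))
        (tens E T1 T2 \<odot> prod_func (pull H f1) (pull H f2))
        (pull H (prod_arr S f1 f2) \<odot> tens E X1 X2) (mon E f1 f2)"
    and mon_comp: "\<lbrakk>f1 \<in> Hom S T1 X1; f2 \<in> Hom S T2 X2; g1 \<in> Hom S X1 Y1; g2 \<in> Hom S X2 Y2;
        A1 \<in> Obj (fib H Y1); A2 \<in> Obj (fib H Y2)\<rbrakk> \<Longrightarrow>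
      conn H (prod_arr S f1 f2) (prod_arr S g1 g2) (Fo (tens E Y1 Y2) (A1, A2))
        \<cdot>\<^bsub>fib H (Prod S T1 T2)\<^esub> mon E (g1 \<cdot>\<^bsub>S\<^esub> f1) (g2 \<cdot>\<^bsub>S\<^esub> f2) (A1, A2)
      = Fa (pull H (prod_arr S f1 f2)) (mon E g1 g2 (A1, A2))
        \<cdot>\<^bsub>fib H (Prod S T1 T2)\<^esub> mon E f1 f2 (Fo (pull H g1) A1, Fo (pull H g2) A2)
        \<cdot>\<^bsub>fib H (Prod S T1 T2)\<^esub> Fa (tens E T1 T2) (conn H f1 g1 A1, conn H f2 g2 A2)"

locale triangulated_external_tensor = external_tensor S H E
  for S :: "('s, 'a) base" and H :: "('s, 'a, 'o, 'm) fibcat" and E :: "('s, 'a, 'o, 'm) ext_tensor" +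
  assumes tens_left_triangulated: "\<lbrakk>X1 \<in> Obj S; X2 \<in> Obj S; A2 \<in> Obj (fib H X2)\<rbrakk> \<Longrightarrow>
      triangulated_functor (fib H X1) (fib H (Prod S X1 X2))
        (tens_left H E X1 X2 A2) (\<lambda>A1. tens_shift1 E X1 X2 (A1, A2))"
    and tens_right_triangulated: "\<lbrakk>X1 \<in> Obj S; X2 \<in> Obj S; A1 \<in> Obj (fib H X1)\<rbrakk> \<Longrightarrow>
      triangulated_functor (fib H X2) (fib H (Prod S X1 X2))
        (tens_right H E X1 X2 A1) (\<lambda>A2. tens_shift2 E X1 X2 (A1, A2))"
    and tens_shift1_natural: "\<lbrakk>X1 \<in> Obj S; X2 \<in> Obj S\<rbrakk> \<Longrightarrow>
      nat_iso (prod_cat (fib H X1) (fib H X2)) (fib H (Prod S X1 X2))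
        (tens E X1 X2 \<odot> prod_func (Shift (fib H X1)) id_func)
        (Shift (fib H (Prod S X1 X2)) \<odot> tens E X1 X2) (tens_shift1 E X1 X2)"
    and tens_shift2_natural: "\<lbrakk>X1 \<in> Obj S; X2 \<in> Obj S\<rbrakk> \<Longrightarrow>
      nat_iso (prod_cat (fib H X1) (fib H X2)) (fib H (Prod S X1 X2))
        (tens E X1 X2 \<odot> prod_func id_func (Shift (fib H X2)))
        (Shift (fib H (Prod S X1 X2)) \<odot> tens E X1 X2) (tens_shift2 E X1 X2)"
    and mon_shift1: "\<lbrakk>f1 \<in> Hom S T1 X1; f2 \<in> Hom S T2 X2;
        A1 \<in> Obj (fib H X1); A2 \<in> Obj (fib H X2)\<rbrakk> \<Longrightarrow>
      Fa (Shift (fib H (Prod S T1 T2))) (mon E f1 f2 (A1, A2))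
        \<cdot>\<^bsub>fib H (Prod S T1 T2)\<^esub> tens_shift1 E T1 T2 (Fo (pull H f1) A1, Fo (pull H f2) A2)
        \<cdot>\<^bsub>fib H (Prod S T1 T2)\<^esub>
          Fa (tens E T1 T2) (pull_shift H f1 A1, Id (fib H T2) (Fo (pull H f2) A2))
      = pull_shift H (prod_arr S f1 f2) (Fo (tens E X1 X2) (A1, A2))
        \<cdot>\<^bsub>fib H (Prod S T1 T2)\<^esub> Fa (pull H (prod_arr S f1 f2)) (tens_shift1 E X1 X2 (A1, A2))
        \<cdot>\<^bsub>fib H (Prod S T1 T2)\<^esub> mon E f1 f2 (Fo (Shift (fib H X1)) A1, A2)"
    and mon_shift2: "\<lbrakk>f1 \<in> Hom S T1 X1; f2 \<in> Hom S T2 X2;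
        A1 \<in> Obj (fib H X1); A2 \<in> Obj (fib H X2)\<rbrakk> \<Longrightarrow>
      Fa (Shift (fib H (Prod S T1 T2))) (mon E f1 f2 (A1, A2))
        \<cdot>\<^bsub>fib H (Prod S T1 T2)\<^esub> tens_shift2 E T1 T2 (Fo (pull H f1) A1, Fo (pull H f2) A2)
        \<cdot>\<^bsub>fib H (Prod S T1 T2)\<^esub>
          Fa (tens E T1 T2) (Id (fib H T1) (Fo (pull H f1) A1), pull_shift H f2 A2)
      = pull_shift H (prod_arr S f1 f2) (Fo (tens E X1 X2) (A1, A2))
        \<cdot>\<^bsub>fib H (Prod S T1 T2)\<^esub> Fa (pull H (prod_arr S f1 f2)) (tens_shift2 E X1 X2 (A1, A2))
        \<cdot>\<^bsub>fib H (Prod S T1 T2)\<^esub> mon E f1 f2 (A1, Fo (Shift (fib H X2)) A2)"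

text \<open>The map \<open>(p\<^sub>1 \<times> p\<^sub>2)\<^sub># (A\<^sub>1 \<boxtimes> A\<^sub>2) \<rightarrow> p\<^sub>1\<^sub># A\<^sub>1 \<boxtimes> p\<^sub>2\<^sub># A\<^sub>2\<close>.\<close>

definition mon_sharp ::
  "('s, 'a) base \<Rightarrow> ('s, 'a, 'o, 'm) fibcat \<Rightarrow> ('s, 'a, 'o, 'm) ext_tensor \<Rightarrow>
   'a \<Rightarrow> 'a \<Rightarrow> 'o \<times> 'o \<Rightarrow> 'm" where
  "mon_sharp S H E p1 p2 = (\<lambda>(A1, A2).
     let P = fib H (Prod S (Dom S p1) (Dom S p2)); X = fib H (Prod S (Cod S p1) (Cod S p2));
         pA = (Fo (sharp S H p1) A1, Fo (sharp S H p2) A2); p = prod_arr S p1 p2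
     in sharp_counit S H p (Fo (tens E (Cod S p1) (Cod S p2)) pA) \<cdot>\<^bsub>X\<^esub>
        Fa (sharp S H p)
          (mon E p1 p2 pA \<cdot>\<^bsub>P\<^esub>
           Fa (tens E (Dom S p1) (Dom S p2)) (sharp_unit S H p1 A1, sharp_unit S H p2 A2)))"

definition smooth_adjointable_tensor ::
  "('s, 'a) base \<Rightarrow> ('s, 'a, 'o, 'm) fibcat \<Rightarrow> ('s, 'a, 'o, 'm) ext_tensor \<Rightarrow> bool" where
  "smooth_adjointable_tensor S H E \<longleftrightarrow>
     (\<forall>p1\<in>Sm S. \<forall>p2\<in>Sm S. \<forall>A1\<in>Obj (fib H (Dom S p1)). \<forall>A2\<in>Obj (fib H (Dom S p2)).
        is_iso (fib H (Prod S (Cod S p1) (Cod S p2))) (mon_sharp S H E p1 p2 (A1, A2)))"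

text \<open>The map \<open>z\<^sub>1\<^sub>* A\<^sub>1 \<boxtimes> z\<^sub>2\<^sub>* A\<^sub>2 \<rightarrow> (z\<^sub>1 \<times> z\<^sub>2)\<^sub>* (A\<^sub>1 \<boxtimes> A\<^sub>2)\<close>.\<close>

definition mon_bar ::
  "('s, 'a) base \<Rightarrow> ('s, 'a, 'o, 'm) fibcat \<Rightarrow> ('s, 'a, 'o, 'm) ext_tensor \<Rightarrow>
   'a \<Rightarrow> 'a \<Rightarrow> 'o \<times> 'o \<Rightarrow> 'm" where
  "mon_bar S H E z1 z2 = (\<lambda>(A1, A2).
     let Z = fib H (Prod S (Dom S z1) (Dom S z2)); X = fib H (Prod S (Cod S z1) (Cod S z2));
         zA = (Fo (star S H z1) A1, Fo (star S H z2) A2); z = prod_arr S z1 z2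
     in Fa (star S H z)
          (Fa (tens E (Dom S z1) (Dom S z2)) (star_counit S H z1 A1, star_counit S H z2 A2)
           \<cdot>\<^bsub>Z\<^esub> inv_arr Z (mon E z1 z2 zA))
        \<cdot>\<^bsub>X\<^esub> star_unit S H z (Fo (tens E (Cod S z1) (Cod S z2)) zA))"


section \<open>External tensor structures and cores on morphisms\<close>

text \<open>In the rest of the theory \<open>\<rho> X\<^sub>1 X\<^sub>2 (A\<^sub>1, A\<^sub>2) : R A\<^sub>1 \<boxtimes>\<^sub>2 R A\<^sub>2 \<rightarrow> R (A\<^sub>1 \<boxtimes>\<^sub>1 A\<^sub>2)\<close>.\<close>

locale mor_tensor_family =
  fixes S :: "('s, 'a) base" and H1 :: "('s, 'a, 'o, 'm) fibcat" and H2 :: "('s, 'a, 'p, 'n) fibcat"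
    and E1 :: "('s, 'a, 'o, 'm) ext_tensor" and E2 :: "('s, 'a, 'p, 'n) ext_tensor"
    and R :: "('s, 'a, 'o, 'm, 'p, 'n) fibmor" and \<rho> :: "'s \<Rightarrow> 's \<Rightarrow> 'o \<times> 'o \<Rightarrow> 'n"
  assumes rho_nat_iso: "\<lbrakk>X1 \<in> Obj S; X2 \<in> Obj S\<rbrakk> \<Longrightarrow>
      nat_iso (prod_cat (fib H1 X1) (fib H1 X2)) (fib H2 (Prod S X1 X2))
        (tens E2 X1 X2 \<odot> prod_func (mor R X1) (mor R X2))
        (mor R (Prod S X1 X2) \<odot> tens E1 X1 X2) (\<rho> X1 X2)"

text \<open>\<open>M\<close> is the set of arrows of the subcategory of \<open>S\<close> over which the structure lives.\<close>

locale mor_tensor_over = mor_tensor_family S H1 H2 E1 E2 R \<rho>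
  for M :: "'a set"
    and S :: "('s, 'a) base" and H1 :: "('s, 'a, 'o, 'm) fibcat" and H2 :: "('s, 'a, 'p, 'n) fibcat"
    and E1 :: "('s, 'a, 'o, 'm) ext_tensor" and E2 :: "('s, 'a, 'p, 'n) ext_tensor"
    and R :: "('s, 'a, 'o, 'm, 'p, 'n) fibmor" and \<rho> :: "'s \<Rightarrow> 's \<Rightarrow> 'o \<times> 'o \<Rightarrow> 'n" +
  assumes rho_pull: "\<lbrakk>f1 \<in> M; f2 \<in> M; f1 \<in> Hom S T1 X1; f2 \<in> Hom S T2 X2;
        A1 \<in> Obj (fib H1 X1); A2 \<in> Obj (fib H1 X2)\<rbrakk> \<Longrightarrow>
      theta R (prod_arr S f1 f2) (Fo (tens E1 X1 X2) (A1, A2))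
        \<cdot>\<^bsub>fib H2 (Prod S T1 T2)\<^esub> Fa (pull H2 (prod_arr S f1 f2)) (\<rho> X1 X2 (A1, A2))
        \<cdot>\<^bsub>fib H2 (Prod S T1 T2)\<^esub> mon E2 f1 f2 (Fo (mor R X1) A1, Fo (mor R X2) A2)
      = Fa (mor R (Prod S T1 T2)) (mon E1 f1 f2 (A1, A2))
        \<cdot>\<^bsub>fib H2 (Prod S T1 T2)\<^esub> \<rho> T1 T2 (Fo (pull H1 f1) A1, Fo (pull H1 f2) A2)
        \<cdot>\<^bsub>fib H2 (Prod S T1 T2)\<^esub> Fa (tens E2 T1 T2) (theta R f1 A1, theta R f2 A2)"

locale mor_tensor_Cl_op = mor_tensor_family S H1 H2 E1 E2 R \<rho>
  for S :: "('s, 'a) base" and H1 :: "('s, 'a, 'o, 'm) fibcat" and H2 :: "('s, 'a, 'p, 'n) fibcat"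
    and E1 :: "('s, 'a, 'o, 'm) ext_tensor" and E2 :: "('s, 'a, 'p, 'n) ext_tensor"
    and R :: "('s, 'a, 'o, 'm, 'p, 'n) fibmor" and \<rho> :: "'s \<Rightarrow> 's \<Rightarrow> 'o \<times> 'o \<Rightarrow> 'n" +
  assumes rho_star: "\<lbrakk>z1 \<in> Cl S; z2 \<in> Cl S; z1 \<in> Hom S Z1 X1; z2 \<in> Hom S Z2 X2;
        A1 \<in> Obj (fib H1 Z1); A2 \<in> Obj (fib H1 Z2)\<rbrakk> \<Longrightarrow>
      inv_arr (fib H2 (Prod S X1 X2))
          (theta_bar S H1 H2 R (prod_arr S z1 z2) (Fo (tens E1 Z1 Z2) (A1, A2)))
        \<cdot>\<^bsub>fib H2 (Prod S X1 X2)\<^esub> Fa (star S H2 (prod_arr S z1 z2)) (\<rho> Z1 Z2 (A1, A2))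
        \<cdot>\<^bsub>fib H2 (Prod S X1 X2)\<^esub> mon_bar S H2 E2 z1 z2 (Fo (mor R Z1) A1, Fo (mor R Z2) A2)
      = Fa (mor R (Prod S X1 X2)) (mon_bar S H1 E1 z1 z2 (A1, A2))
        \<cdot>\<^bsub>fib H2 (Prod S X1 X2)\<^esub> \<rho> X1 X2 (Fo (star S H1 z1) A1, Fo (star S H1 z2) A2)
        \<cdot>\<^bsub>fib H2 (Prod S X1 X2)\<^esub>
          Fa (tens E2 X1 X2) (inv_arr (fib H2 X1) (theta_bar S H1 H2 R z1 A1),
                              inv_arr (fib H2 X2) (theta_bar S H1 H2 R z2 A2))"

definition rho_triangulated ::
  "('s, 'a) base \<Rightarrow> ('s, 'a, 'o, 'm) fibcat \<Rightarrow> ('s, 'a, 'p, 'n) fibcat \<Rightarrow>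
   ('s, 'a, 'o, 'm) ext_tensor \<Rightarrow> ('s, 'a, 'p, 'n) ext_tensor \<Rightarrow>
   ('s, 'a, 'o, 'm, 'p, 'n) fibmor \<Rightarrow> ('s \<Rightarrow> 's \<Rightarrow> 'o \<times> 'o \<Rightarrow> 'n) \<Rightarrow> bool" where
  "rho_triangulated S H1 H2 E1 E2 R \<rho> \<longleftrightarrow>
    (\<forall>X1\<in>Obj S. \<forall>X2\<in>Obj S. \<forall>A1\<in>Obj (fib H1 X1). \<forall>A2\<in>Obj (fib H1 X2).
      let X = Prod S X1 X2; D = fib H2 X; R1 = Fo (mor R X1) A1; R2 = Fo (mor R X2) A2
      in Fa (Shift D) (\<rho> X1 X2 (A1, A2)) \<cdot>\<^bsub>D\<^esub> tens_shift1 E2 X1 X2 (R1, R2)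
            \<cdot>\<^bsub>D\<^esub> Fa (tens E2 X1 X2) (mor_shift R X1 A1, Id (fib H2 X2) R2)
         = mor_shift R X (Fo (tens E1 X1 X2) (A1, A2))
            \<cdot>\<^bsub>D\<^esub> Fa (mor R X) (tens_shift1 E1 X1 X2 (A1, A2))
            \<cdot>\<^bsub>D\<^esub> \<rho> X1 X2 (Fo (Shift (fib H1 X1)) A1, A2) \<and>
         Fa (Shift D) (\<rho> X1 X2 (A1, A2)) \<cdot>\<^bsub>D\<^esub> tens_shift2 E2 X1 X2 (R1, R2)
            \<cdot>\<^bsub>D\<^esub> Fa (tens E2 X1 X2) (Id (fib H2 X1) R1, mor_shift R X2 A2)
         = mor_shift R X (Fo (tens E1 X1 X2) (A1, A2))
            \<cdot>\<^bsub>D\<^esub> Fa (mor R X) (tens_shift2 E1 X1 X2 (A1, A2))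
            \<cdot>\<^bsub>D\<^esub> \<rho> X1 X2 (A1, Fo (Shift (fib H1 X2)) A2))"

definition triangulated_mor_tensor where
  "triangulated_mor_tensor S H1 H2 E1 E2 R \<rho> \<longleftrightarrow>
     mor_tensor_over (Arr S) S H1 H2 E1 E2 R \<rho> \<and> rho_triangulated S H1 H2 E1 E2 R \<rho>"

definition triangulated_mor_tensor_Sm where
  "triangulated_mor_tensor_Sm S H1 H2 E1 E2 R \<rho> \<longleftrightarrow>
     mor_tensor_over (Sm S) S H1 H2 E1 E2 R \<rho> \<and> rho_triangulated S H1 H2 E1 E2 R \<rho>"

definition triangulated_mor_tensor_Cl_op where
  "triangulated_mor_tensor_Cl_op S H1 H2 E1 E2 R \<rho> \<longleftrightarrow>
     mor_tensor_Cl_op S H1 H2 E1 E2 R \<rho> \<and> rho_triangulated S H1 H2 E1 E2 R \<rho>"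

definition external_tensor_core where
  "external_tensor_core S H1 H2 E1 E2 R \<rho>sm \<rho>cl \<longleftrightarrow>
     triangulated_mor_tensor_Sm S H1 H2 E1 E2 R \<rho>sm \<and>
     triangulated_mor_tensor_Cl_op S H1 H2 E1 E2 R \<rho>cl \<and>
     (\<forall>X1\<in>Obj S. \<forall>X2\<in>Obj S. \<forall>A1\<in>Obj (fib H1 X1). \<forall>A2\<in>Obj (fib H1 X2).
        \<rho>sm X1 X2 (A1, A2) = \<rho>cl X1 X2 (A1, A2))"

text \<open>The compatibility over the opposite of \<open>Cl S\<close> mentions \<open>(z\<^sub>1 \<times> z\<^sub>2)\<^sub>*\<close> and the inverse of
  \<open>theta_bar\<close> at \<open>z\<^sub>1 \<times> z\<^sub>2\<close>. The axioms of \<open>base_category\<close> do not force \<open>z\<^sub>1 \<times> z\<^sub>2\<close> to be a closed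
  immersion, so the definedness of these is a separate requirement. It is automatic when products of
  closed immersions are closed immersions.\<close>

definition closed_products_adjointable where
  "closed_products_adjointable S H1 H2 R \<longleftrightarrow>
     (\<forall>z1\<in>Cl S. \<forall>z2\<in>Cl S.
        has_star S H1 (prod_arr S z1 z2) \<and> has_star S H2 (prod_arr S z1 z2) \<and>
        (\<forall>A\<in>Obj (fib H1 (Prod S (Dom S z1) (Dom S z2))).
           is_iso (fib H2 (Prod S (Cod S z1) (Cod S z2)))
             (theta_bar S H1 H2 R (prod_arr S z1 z2) A)))"

end

theory Submission
  imports Defs
begin

text \<open>
Fix the family \<open>\<rho>\<close> and call a pair of arrows \<open>f\<^sub>i : T\<^sub>i \<rightarrow> X\<^sub>i\<close> compatible at \<open>(A\<^sub>1, A\<^sub>2)\<close> if the hexagon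
comparing \<open>\<rho>\<close> over \<open>X\<^sub>1 \<times> X\<^sub>2\<close> with \<open>\<rho>\<close> over \<open>T\<^sub>1 \<times> T\<^sub>2\<close> through \<open>m\<close> and \<open>\<theta>\<close> commutes there. The
compatibility with shifts and the naturality of \<open>\<rho>\<close> are common to both notions, so the theorem
says that all pairs are compatible exactly when the smooth pairs are, and the closed pairs satisfy
the condition on direct images.

Two reductions give this.

\<^item> Hexagons paste: if \<open>(g\<^sub>1, g\<^sub>2)\<close> is compatible at \<open>(A\<^sub>1, A\<^sub>2)\<close> and \<open>(f\<^sub>1, f\<^sub>2)\<close> is compatible at
  \<open>(g\<^sub>1\<^sup>*A\<^sub>1, g\<^sub>2\<^sup>*A\<^sub>2)\<close>, then \<open>(g\<^sub>1 f\<^sub>1, g\<^sub>2 f\<^sub>2)\<close> is compatible at \<open>(A\<^sub>1, A\<^sub>2)\<close> (\<open>compatible_Comp\<close>).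
  As every arrow is a closed immersion followed by a smooth arrow, compatibility of all pairs
  amounts to compatibility of the smooth pairs and of the closed pairs.

\<^item> For closed immersions \<open>z\<^sub>1, z\<^sub>2\<close> the condition on direct images at \<open>(A\<^sub>1, A\<^sub>2)\<close> is the mate of the
  hexagon at \<open>(z\<^sub>1\<^sub>*A\<^sub>1, z\<^sub>2\<^sub>*A\<^sub>2)\<close>. Transposing its two sides along
  \<open>(z\<^sub>1 \<times> z\<^sub>2)\<^sup>* \<stileturn> (z\<^sub>1 \<times> z\<^sub>2)\<^sub>*\<close> produces the two sides of that hexagon, up to the invertible map \<open>m\<close>
  and up to composition with \<open>R (\<epsilon> \<boxtimes> \<epsilon>)\<close>, which is invertible because \<open>z\<^sub>1\<^sub>*\<close> and \<open>z\<^sub>2\<^sub>*\<close> are fully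
  faithful (\<open>rho_star_iff_compatible\<close>). Nothing is lost by looking only at objects \<open>z\<^sub>i\<^sub>*A\<^sub>i\<close>: the
  sides of the hexagon are natural in \<open>(A\<^sub>1, A\<^sub>2)\<close>, and the unit \<open>A \<rightarrow> z\<^sub>*z\<^sup>*A\<close> becomes invertible under
  \<open>z\<^sup>*\<close>, so the hexagon at \<open>(z\<^sub>1\<^sub>*z\<^sub>1\<^sup>*A\<^sub>1, z\<^sub>2\<^sub>*z\<^sub>2\<^sup>*A\<^sub>2)\<close> implies the one at \<open>(A\<^sub>1, A\<^sub>2)\<close>
  (\<open>compatible_if_at_units\<close>).

The condition on direct images is stated with inverses of the exchange maps \<open>R z\<^sub>* \<rightarrow> z\<^sub>* R\<close>. For a
closed immersion \<open>z\<close> with complement \<open>u\<close> such a map is invertible because it is so after \<open>z\<^sup>*\<close>, by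
the invertible counits, and after \<open>u\<^sup>*\<close>, where source and target vanish: base change along the empty
intersection of \<open>u\<close> and \<open>z\<close> shows \<open>u\<^sup>*z\<^sub>* = 0\<close> (\<open>theta_bar_is_iso\<close>).
\<close>

section \<open>Isomorphisms and pasting in a category\<close>

context category
begin

lemma Hom_Obj:
  assumes "f \<in> Hom C X Y"
  shows "X \<in> Obj C" and "Y \<in> Obj C"
  using assms Dom_Obj Cod_Obj by (auto simp: Hom_def)

lemma Comp_Arr:
  assumes "f \<in> Arr C" "g \<in> Arr C" "Cod C f = Dom C g"
  shows "g \<cdot> f \<in> Arr C" and "Dom C (g \<cdot> f) = Dom C f" and "Cod C (g \<cdot> f) = Cod C g"
  using assms Comp_Hom[of f "Dom C f" "Cod C f" g "Cod C g"] by (auto simp: Hom_def)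

lemma Comp_assoc_Arr:
  assumes "f \<in> Arr C" "g \<in> Arr C" "h \<in> Arr C" "Cod C f = Dom C g" "Cod C g = Dom C h"
  shows "(h \<cdot> g) \<cdot> f = h \<cdot> (g \<cdot> f)"
  using assms Comp_assoc[of f _ _ g _ h] by (auto simp: Hom_def)

text \<open>Rewriting to right-nested composites. The side conditions speak of \<open>Dom\<close> and \<open>Cod\<close> and not of
membership in a \<open>Hom\<close> set, so the simplifier can discharge them without guessing intermediate
objects.\<close>

lemmas normalize = Comp_Arr Comp_assoc_Arr

lemma is_iso_Hom:
  assumes "is_iso C f" "f \<in> Hom C X Y"
  shows "inv_arr C f \<in> Hom C Y X" and "inv_arr C f \<cdot> f = Id C X" and "f \<cdot> inv_arr C f = Id C Y"
proof -
  obtain g where g: "is_inverse C f g"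
    using assms(1) unfolding is_iso_def by blast
  have "g' = g" if g': "is_inverse C f g'" for g'
  proof -
    have t: "g \<in> Hom C Y X" "g' \<in> Hom C Y X"
      using g g' assms(2) unfolding is_inverse_def by (auto simp: Hom_def)
    have "g' = g' \<cdot> (f \<cdot> g)"
      using g assms(2) Comp_Id[OF t(2)] by (simp add: is_inverse_def Hom_def)
    also have "\<dots> = (g' \<cdot> f) \<cdot> g"
      using Comp_assoc[OF t(1) assms(2) t(2)] by simp
    also have "\<dots> = g"
      using g' assms(2) Id_Comp[OF t(1)] by (simp add: is_inverse_def Hom_def)
    finally show ?thesis .
  qed
  then have "inv_arr C f = g"
    unfolding inv_arr_def using g by blast
  then show "inv_arr C f \<in> Hom C Y X" "inv_arr C f \<cdot> f = Id C X" "f \<cdot> inv_arr C f = Id C Y"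
    using g assms(2) by (auto simp: is_inverse_def Hom_def)
qed

lemma is_isoI:
  assumes "f \<in> Hom C X Y" "g \<in> Hom C Y X" "g \<cdot> f = Id C X" "f \<cdot> g = Id C Y"
  shows "is_iso C f"
  unfolding is_iso_def is_inverse_def using assms by (auto simp: Hom_def)

lemma inv_cancel:
  assumes "is_iso C f" "f \<in> Hom C Y Z"
  shows "a \<in> Hom C X Y \<Longrightarrow> inv_arr C f \<cdot> f \<cdot> a = a"
    and "b \<in> Hom C X Z \<Longrightarrow> f \<cdot> inv_arr C f \<cdot> b = b"
    and "c \<in> Hom C Z W \<Longrightarrow> (c \<cdot> f) \<cdot> inv_arr C f = c"
    and "d \<in> Hom C Y W \<Longrightarrow> (d \<cdot> inv_arr C f) \<cdot> f = d"
proof -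
  note f = is_iso_Hom[OF assms]
  show "inv_arr C f \<cdot> f \<cdot> a = a" if "a \<in> Hom C X Y"
    using Comp_assoc[OF that assms(2) f(1)] Id_Comp[OF that] f by simp
  show "f \<cdot> inv_arr C f \<cdot> b = b" if "b \<in> Hom C X Z"
    using Comp_assoc[OF that f(1) assms(2)] Id_Comp[OF that] f by simp
  show "(c \<cdot> f) \<cdot> inv_arr C f = c" if "c \<in> Hom C Z W"
    using Comp_assoc[OF f(1) assms(2) that] Comp_Id[OF that] f by simp
  show "(d \<cdot> inv_arr C f) \<cdot> f = d" if "d \<in> Hom C Y W"
    using Comp_assoc[OF assms(2) f(1) that] Comp_Id[OF that] f by simp
qed

lemma is_iso_mono:
  assumes "is_iso C f" "f \<in> Hom C Y Z" "a \<in> Hom C X Y" "b \<in> Hom C X Y" "f \<cdot> a = f \<cdot> b"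
  shows "a = b"
  using inv_cancel(1)[OF assms(1,2,3)] inv_cancel(1)[OF assms(1,2,4)] assms(5) by metis

lemma is_iso_epi:
  assumes "is_iso C f" "f \<in> Hom C X Y" "a \<in> Hom C Y Z" "b \<in> Hom C Y Z" "a \<cdot> f = b \<cdot> f"
  shows "a = b"
  using inv_cancel(3)[OF assms(1,2,3)] inv_cancel(3)[OF assms(1,2,4)] assms(5) by metis

lemma inv_arr_eqI:
  assumes "f \<in> Hom C X Y" "g \<in> Hom C Y X" "g \<cdot> f = Id C X" "f \<cdot> g = Id C Y"
  shows "inv_arr C f = g"
proof -
  note iso = is_isoI[OF assms]
  show ?thesis
    using is_iso_mono[OF iso assms(1) is_iso_Hom(1)[OF iso assms(1)] assms(2)]
      is_iso_Hom(3)[OF iso assms(1)] assms(4) by simp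
qed

lemma is_iso_inv:
  assumes "is_iso C f" "f \<in> Hom C X Y"
  shows "is_iso C (inv_arr C f)"
  using is_isoI is_iso_Hom[OF assms] assms(2) by blast

lemma is_iso_Comp:
  assumes "is_iso C f" "is_iso C g" "f \<in> Hom C X Y" "g \<in> Hom C Y Z"
  shows "is_iso C (g \<cdot> f)"
proof -
  note f = is_iso_Hom[OF assms(1,3)] and g = is_iso_Hom[OF assms(2,4)]
  show ?thesis
  proof (rule is_isoI)
    show "g \<cdot> f \<in> Hom C X Z"
      using assms Comp_Hom by blast
    show "inv_arr C f \<cdot> inv_arr C g \<in> Hom C Z X"
      using f g Comp_Hom by blast
    show "(inv_arr C f \<cdot> inv_arr C g) \<cdot> g \<cdot> f = Id C X"
      using Comp_assoc[OF Comp_Hom[OF assms(3,4)] g(1) f(1)] inv_cancel(1)[OF assms(2,4,3)] f by simp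
    show "(g \<cdot> f) \<cdot> inv_arr C f \<cdot> inv_arr C g = Id C Z"
      using Comp_assoc[OF Comp_Hom[OF g(1) f(1)] assms(3,4)] inv_cancel(2)[OF assms(1,3) g(1)] g
      by simp
  qed
qed

lemma is_iso_left_factor:
  assumes "is_iso C (g \<cdot> f)" "is_iso C f" "f \<in> Hom C X Y" "g \<in> Hom C Y Z"
  shows "is_iso C g"
  using is_iso_Comp[OF is_iso_inv[OF assms(2,3)] assms(1) is_iso_Hom(1)[OF assms(2,3)]
      Comp_Hom[OF assms(3,4)]] inv_cancel(3)[OF assms(2-4)] by simp

lemma is_iso_right_factor:
  assumes "is_iso C (g \<cdot> f)" "is_iso C g" "f \<in> Hom C X Y" "g \<in> Hom C Y Z"
  shows "is_iso C f"
  using is_iso_Comp[OF assms(1) is_iso_inv[OF assms(2,4)] Comp_Hom[OF assms(3,4)]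
      is_iso_Hom(1)[OF assms(2,4)]] inv_cancel(1)[OF assms(2,4,3)] by simp

lemma inv_square_iff:
  assumes "is_iso C s" "is_iso C t" "s \<in> Hom C X X'" "t \<in> Hom C Y Y'"
    and "x \<in> Hom C X' Y'" "y \<in> Hom C X Y"
  shows "inv_arr C t \<cdot> x = y \<cdot> inv_arr C s \<longleftrightarrow> x \<cdot> s = t \<cdot> y"
proof -
  note s = is_iso_Hom[OF assms(1,3)] and t = is_iso_Hom[OF assms(2,4)]
  note ts = Comp_Hom[OF assms(5) t(1)] Comp_Hom[OF s(1) assms(6)]
  have "inv_arr C t \<cdot> x = y \<cdot> inv_arr C s \<longleftrightarrow> x = t \<cdot> y \<cdot> inv_arr C s"
    using inv_cancel(2)[OF assms(2,4,5)] inv_cancel(1)[OF assms(2,4) ts(2)] by auto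
  also have "\<dots> \<longleftrightarrow> x = (t \<cdot> y) \<cdot> inv_arr C s"
    using Comp_assoc[OF s(1) assms(6,4)] by simp
  also have "\<dots> \<longleftrightarrow> x \<cdot> s = t \<cdot> y"
    using inv_cancel(3)[OF assms(1,3,5)] inv_cancel(4)[OF assms(1,3) Comp_Hom[OF assms(6,4)]]
    by auto
  finally show ?thesis .
qed

text \<open>The diagram chase behind the pasting of two compatibility hexagons. In the application the objects
and arrows are those of the fiber over \<open>T\<^sub>1 \<times> T\<^sub>2\<close>: \<open>u \<cdot> v \<cdot> w = n \<cdot> r \<cdot> t\<close> is the hexagon for
\<open>(g\<^sub>1 f\<^sub>1, g\<^sub>2 f\<^sub>2)\<close>; \<open>hexagon_g\<close> is the inverse image of the one for \<open>(g\<^sub>1, g\<^sub>2)\<close>, \<open>hexagon_f\<close> the one for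
\<open>(f\<^sub>1, f\<^sub>2)\<close>; \<open>theta\<close>, \<open>mon\<close>, \<open>theta_tens\<close>, \<open>mon_R\<close> express \<open>\<theta>\<close> and \<open>m\<close> of a composite through the
connection isomorphisms; the remaining equations are naturality squares. The map \<open>c\<close> is a
connection isomorphism, so the equation may be checked after composition with it.\<close>

lemma hexagon_pasting:
  assumes typing:
      "k \<in> Hom C X0 X1" "w \<in> Hom C X0 Y0" "v \<in> Hom C Y0 Z0" "u \<in> Hom C Z0 W0"
      "t \<in> Hom C X0 X0'" "r \<in> Hom C X0' V0" "n \<in> Hom C V0 W0"
      "c \<in> Hom C W0 W1" "c' \<in> Hom C Z0 Z1" "b \<in> Hom C Z1 Z2" "a \<in> Hom C Z2 W1"
      "c'' \<in> Hom C Y0 Y1" "v' \<in> Hom C Y1 Z1" "mf \<in> Hom C X1 Q" "mg \<in> Hom C Q Y1"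
      "e3 \<in> Hom C Q Q'" "e2 \<in> Hom C Q' Q''" "e1 \<in> Hom C Q'' Z2"
      "a' \<in> Hom C Q'' P" "e1' \<in> Hom C P W1" "h \<in> Hom C X1 X2" "mf' \<in> Hom C X2 Q'"
      "t' \<in> Hom C X2 X3" "r' \<in> Hom C X3 X4" "n' \<in> Hom C X4 P"
      "s \<in> Hom C X0' X3" "s' \<in> Hom C V0 X4"
    and c_iso: "is_iso C c"
    and theta: "c \<cdot> u = a \<cdot> b \<cdot> c'"
    and conn: "c' \<cdot> v = v' \<cdot> c''"
    and mon: "c'' \<cdot> w = mg \<cdot> mf \<cdot> k"
    and hexagon_g: "b \<cdot> v' \<cdot> mg = e1 \<cdot> e2 \<cdot> e3"
    and theta_nat: "e1' \<cdot> a' = a \<cdot> e1"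
    and mon_nat: "e3 \<cdot> mf = mf' \<cdot> h"
    and hexagon_f: "a' \<cdot> e2 \<cdot> mf' = n' \<cdot> r' \<cdot> t'"
    and theta_tens: "t' \<cdot> h \<cdot> k = s \<cdot> t"
    and rho_nat: "s' \<cdot> r = r' \<cdot> s"
    and mon_R: "e1' \<cdot> n' \<cdot> s' = c \<cdot> n"
  shows "u \<cdot> v \<cdot> w = n \<cdot> r \<cdot> t"
proof (rule is_iso_mono[OF c_iso typing(8)])
  show "u \<cdot> v \<cdot> w \<in> Hom C X0 W0" "n \<cdot> r \<cdot> t \<in> Hom C X0 W0"
    using typing by (auto intro!: Comp_Hom)
  note simps = normalize typing[unfolded Hom_def, simplified]
  have "c \<cdot> u \<cdot> v \<cdot> w = (c \<cdot> u) \<cdot> v \<cdot> w"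
    by (simp add: simps)
  also have "\<dots> = a \<cdot> b \<cdot> (c' \<cdot> v) \<cdot> w"
    unfolding theta by (simp add: simps)
  also have "\<dots> = a \<cdot> b \<cdot> v' \<cdot> (c'' \<cdot> w)"
    unfolding conn by (simp add: simps)
  also have "\<dots> = a \<cdot> (b \<cdot> v' \<cdot> mg) \<cdot> mf \<cdot> k"
    unfolding mon by (simp add: simps)
  also have "\<dots> = (a \<cdot> e1) \<cdot> e2 \<cdot> (e3 \<cdot> mf) \<cdot> k"
    unfolding hexagon_g by (simp add: simps)
  also have "\<dots> = e1' \<cdot> (a' \<cdot> e2 \<cdot> mf') \<cdot> h \<cdot> k"
    unfolding theta_nat[symmetric] mon_nat by (simp add: simps)
  also have "\<dots> = e1' \<cdot> n' \<cdot> r' \<cdot> (t' \<cdot> h \<cdot> k)"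
    unfolding hexagon_f by (simp add: simps)
  also have "\<dots> = e1' \<cdot> n' \<cdot> (r' \<cdot> s) \<cdot> t"
    unfolding theta_tens by (simp add: simps)
  also have "\<dots> = (e1' \<cdot> n' \<cdot> s') \<cdot> r \<cdot> t"
    unfolding rho_nat[symmetric] by (simp add: simps)
  also have "\<dots> = c \<cdot> n \<cdot> r \<cdot> t"
    unfolding mon_R by (simp add: simps)
  finally show "c \<cdot> u \<cdot> v \<cdot> w = c \<cdot> n \<cdot> r \<cdot> t" .
qed

end


section \<open>Functors, natural transformations and products of categories\<close>

lemma functor_Obj: "is_functor C D F \<Longrightarrow> X \<in> Obj C \<Longrightarrow> Fo F X \<in> Obj D"
  unfolding is_functor_def by blast

lemma functor_Hom: "is_functor C D F \<Longrightarrow> f \<in> Hom C X Y \<Longrightarrow> Fa F f \<in> Hom D (Fo F X) (Fo F Y)"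
  unfolding is_functor_def by (auto simp: Hom_def)

lemma functor_Id: "is_functor C D F \<Longrightarrow> X \<in> Obj C \<Longrightarrow> Fa F (Id C X) = Id D (Fo F X)"
  unfolding is_functor_def by blast

lemma functor_Comp:
  "is_functor C D F \<Longrightarrow> f \<in> Hom C X Y \<Longrightarrow> g \<in> Hom C Y Z
    \<Longrightarrow> Fa F (g \<cdot>\<^bsub>C\<^esub> f) = Fa F g \<cdot>\<^bsub>D\<^esub> Fa F f"
  unfolding is_functor_def Hom_def by auto

lemma functor_Comp3:
  assumes "category C" "is_functor C D F" "f \<in> Hom C X Y" "g \<in> Hom C Y Z" "h \<in> Hom C Z W"
  shows "Fa F (h \<cdot>\<^bsub>C\<^esub> g \<cdot>\<^bsub>C\<^esub> f) = Fa F h \<cdot>\<^bsub>D\<^esub> Fa F g \<cdot>\<^bsub>D\<^esub> Fa F f"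
  using assms by (simp add: functor_Comp[OF assms(2)] functor_Comp[OF assms(2) category.Comp_Hom])

lemma
  assumes "category C" "category D" "is_functor C D F" "is_iso C f" "f \<in> Hom C X Y"
  shows functor_is_iso: "is_iso D (Fa F f)"
    and functor_inv_arr: "inv_arr D (Fa F f) = Fa F (inv_arr C f)"
proof -
  interpret C: category C by fact
  interpret D: category D by fact
  note f = C.is_iso_Hom[OF assms(4,5)]
  have 1: "Fa F f \<in> Hom D (Fo F X) (Fo F Y)" "Fa F (inv_arr C f) \<in> Hom D (Fo F Y) (Fo F X)"
    using assms(3,5) f by (simp_all add: functor_Hom)
  have 2: "Fa F (inv_arr C f) \<cdot>\<^bsub>D\<^esub> Fa F f = Id D (Fo F X)"
    using functor_Comp[OF assms(3,5) f(1)] f functor_Id[OF assms(3)] C.Hom_Obj[OF assms(5)] by simp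
  have 3: "Fa F f \<cdot>\<^bsub>D\<^esub> Fa F (inv_arr C f) = Id D (Fo F Y)"
    using functor_Comp[OF assms(3) f(1) assms(5)] f functor_Id[OF assms(3)] C.Hom_Obj[OF assms(5)]
    by simp
  show "is_iso D (Fa F f)"
    using D.is_isoI[OF 1 2 3] .
  show "inv_arr D (Fa F f) = Fa F (inv_arr C f)"
    using D.inv_arr_eqI[OF 1 2 3] .
qed

lemma functor_comp_func:
  "is_functor C D F \<Longrightarrow> is_functor D E G \<Longrightarrow> is_functor C E (G \<odot> F)"
  unfolding is_functor_def comp_func_def Hom_def by auto

lemma nat_trans_Hom: "nat_trans C D F G t \<Longrightarrow> X \<in> Obj C \<Longrightarrow> t X \<in> Hom D (Fo F X) (Fo G X)"
  unfolding nat_trans_def by blast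

lemma nat_trans_natural:
  "nat_trans C D F G t \<Longrightarrow> a \<in> Hom C X Y \<Longrightarrow> Fa G a \<cdot>\<^bsub>D\<^esub> t X = t Y \<cdot>\<^bsub>D\<^esub> Fa F a"
  unfolding nat_trans_def Hom_def by auto

text \<open>With the two whiskerings below, this yields the naturality of long composites such as the sides of
the compatibility hexagon without a diagram chase.\<close>

lemma nat_trans_vertical:
  assumes "category C" "category D" "is_functor C D F" "is_functor C D G" "is_functor C D K"
    and s: "nat_trans C D F G s" and t: "nat_trans C D G K t"
  shows "nat_trans C D F K (\<lambda>X. t X \<cdot>\<^bsub>D\<^esub> s X)"
proof -
  interpret C: category C by fact
  interpret D: category D by fact
  show ?thesis
    unfolding nat_trans_def
  proof (intro conjI ballI)
    show "t X \<cdot>\<^bsub>D\<^esub> s X \<in> Hom D (Fo F X) (Fo K X)" if "X \<in> Obj C" for X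
      using that nat_trans_Hom[OF s] nat_trans_Hom[OF t] D.Comp_Hom by blast
  next
    fix f assume "f \<in> Arr C"
    then obtain X Y where f: "f \<in> Hom C X Y" "X = Dom C f" "Y = Cod C f"
      by (auto simp: Hom_def)
    note O = C.Hom_Obj[OF f(1)]
    note ty = nat_trans_Hom[OF s O(1)] nat_trans_Hom[OF s O(2)] nat_trans_Hom[OF t O(1)]
      nat_trans_Hom[OF t O(2)] functor_Hom[OF assms(3) f(1)] functor_Hom[OF assms(4) f(1)]
      functor_Hom[OF assms(5) f(1)]
    have "Fa K f \<cdot>\<^bsub>D\<^esub> t X \<cdot>\<^bsub>D\<^esub> s X = t Y \<cdot>\<^bsub>D\<^esub> Fa G f \<cdot>\<^bsub>D\<^esub> s X"
      using D.Comp_assoc[OF ty(1,3,7)] D.Comp_assoc[OF ty(1,6,4)] nat_trans_natural[OF t f(1)]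
      by simp
    also have "\<dots> = (t Y \<cdot>\<^bsub>D\<^esub> s Y) \<cdot>\<^bsub>D\<^esub> Fa F f"
      using D.Comp_assoc[OF ty(5,2,4)] nat_trans_natural[OF s f(1)] by simp
    finally show "Fa K f \<cdot>\<^bsub>D\<^esub> t (Dom C f) \<cdot>\<^bsub>D\<^esub> s (Dom C f)
        = (t (Cod C f) \<cdot>\<^bsub>D\<^esub> s (Cod C f)) \<cdot>\<^bsub>D\<^esub> Fa F f"
      using f by simp
  qed
qed

lemma nat_trans_whisker_left:
  assumes "category C" "is_functor C D F" "is_functor C D G" "is_functor D E K" "nat_trans C D F G t"
  shows "nat_trans C E (K \<odot> F) (K \<odot> G) (\<lambda>X. Fa K (t X))"
proof -
  interpret C: category C by fact
  show ?thesis
    unfolding nat_trans_def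
  proof (intro conjI ballI)
    show "Fa K (t X) \<in> Hom E (Fo (K \<odot> F) X) (Fo (K \<odot> G) X)" if "X \<in> Obj C" for X
      using functor_Hom[OF assms(4) nat_trans_Hom[OF assms(5) that]] by (simp add: comp_func_def)
  next
    fix f assume "f \<in> Arr C"
    then have f: "f \<in> Hom C (Dom C f) (Cod C f)"
      by (simp add: Hom_def)
    note O = C.Hom_Obj[OF f]
    show "Fa (K \<odot> G) f \<cdot>\<^bsub>E\<^esub> Fa K (t (Dom C f)) = Fa K (t (Cod C f)) \<cdot>\<^bsub>E\<^esub> Fa (K \<odot> F) f"
      using nat_trans_natural[OF assms(5) f] nat_trans_Hom[OF assms(5) O(1)]
        nat_trans_Hom[OF assms(5) O(2)] functor_Hom[OF assms(2) f] functor_Hom[OF assms(3) f]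
      by (simp add: comp_func_def functor_Comp[OF assms(4), symmetric])
  qed
qed

lemma nat_trans_whisker_right:
  assumes "is_functor B C K" "nat_trans C D F G t"
  shows "nat_trans B D (F \<odot> K) (G \<odot> K) (\<lambda>X. t (Fo K X))"
  unfolding nat_trans_def
proof (intro conjI ballI)
  show "t (Fo K X) \<in> Hom D (Fo (F \<odot> K) X) (Fo (G \<odot> K) X)" if "X \<in> Obj B" for X
    using nat_trans_Hom[OF assms(2) functor_Obj[OF assms(1) that]] by (simp add: comp_func_def)
  show "Fa (G \<odot> K) f \<cdot>\<^bsub>D\<^esub> t (Fo K (Dom B f)) = t (Fo K (Cod B f)) \<cdot>\<^bsub>D\<^esub> Fa (F \<odot> K) f"
    if "f \<in> Arr B" for f
    using nat_trans_natural[OF assms(2) functor_Hom[OF assms(1)], of f "Dom B f" "Cod B f"] that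
    by (simp add: comp_func_def Hom_def)
qed

lemma comp_func_assoc: "(F \<odot> G) \<odot> K = F \<odot> (G \<odot> K)"
  by (simp add: comp_func_def)

lemma prod_func_comp: "prod_func (F \<odot> G) (F' \<odot> G') = prod_func F F' \<odot> prod_func G G'"
  by (simp add: comp_func_def prod_func_def case_prod_unfold)

lemma prod_cat_Obj [simp]: "(X, Y) \<in> Obj (prod_cat C D) \<longleftrightarrow> X \<in> Obj C \<and> Y \<in> Obj D"
  by (simp add: prod_cat_def)

lemma prod_cat_Hom [simp]:
  "(f, g) \<in> Hom (prod_cat C D) (X, X') (Y, Y') \<longleftrightarrow> f \<in> Hom C X Y \<and> g \<in> Hom D X' Y'"
  by (auto simp: prod_cat_def Hom_def)

lemma prod_cat_Comp [simp]: "(f', g') \<cdot>\<^bsub>prod_cat C D\<^esub> (f, g) = (f' \<cdot>\<^bsub>C\<^esub> f, g' \<cdot>\<^bsub>D\<^esub> g)"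
  by (simp add: prod_cat_def)

lemma prod_cat_Id [simp]: "Id (prod_cat C D) (X, Y) = (Id C X, Id D Y)"
  by (simp add: prod_cat_def)

lemma category_prod_cat:
  assumes "category C" "category D"
  shows "category (prod_cat C D)"
proof -
  interpret C: category C by fact
  interpret D: category D by fact
  show ?thesis
    by unfold_locales
      (auto simp: prod_cat_def Hom_def C.Dom_Obj C.Cod_Obj D.Dom_Obj D.Cod_Obj
        C.normalize D.normalize C.Id_Hom[unfolded Hom_def, simplified]
        D.Id_Hom[unfolded Hom_def, simplified] C.Comp_Id[unfolded Hom_def, simplified]
        D.Comp_Id[unfolded Hom_def, simplified] C.Id_Comp[unfolded Hom_def, simplified]
        D.Id_Comp[unfolded Hom_def, simplified])
qed

lemma functor_prod_func:
  "is_functor C D F \<Longrightarrow> is_functor C' D' F'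
    \<Longrightarrow> is_functor (prod_cat C C') (prod_cat D D') (prod_func F F')"
  unfolding is_functor_def prod_cat_def prod_func_def Hom_def by auto

lemma nat_trans_prod:
  "nat_trans C D F G s \<Longrightarrow> nat_trans C' D' F' G' s'
    \<Longrightarrow> nat_trans (prod_cat C C') (prod_cat D D') (prod_func F F') (prod_func G G')
          (\<lambda>(X, Y). (s X, s' Y))"
  unfolding nat_trans_def prod_cat_def prod_func_def Hom_def by auto

lemma
  assumes "category C" "category D" "is_iso C f" "is_iso D g" "f \<in> Hom C X Y" "g \<in> Hom D X' Y'"
  shows prod_cat_is_iso: "is_iso (prod_cat C D) (f, g)"
    and prod_cat_inv_arr: "inv_arr (prod_cat C D) (f, g) = (inv_arr C f, inv_arr D g)"
proof -
  interpret P: category "prod_cat C D"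
    using category_prod_cat[OF assms(1,2)] .
  note f = category.is_iso_Hom[OF assms(1,3,5)] and g = category.is_iso_Hom[OF assms(2,4,6)]
  have 1: "(f, g) \<in> Hom (prod_cat C D) (X, X') (Y, Y')"
      "(inv_arr C f, inv_arr D g) \<in> Hom (prod_cat C D) (Y, Y') (X, X')"
    using assms f g by simp_all
  have 2: "(inv_arr C f, inv_arr D g) \<cdot>\<^bsub>prod_cat C D\<^esub> (f, g) = Id (prod_cat C D) (X, X')"
      "(f, g) \<cdot>\<^bsub>prod_cat C D\<^esub> (inv_arr C f, inv_arr D g) = Id (prod_cat C D) (Y, Y')"
    using f g by simp_all
  show "is_iso (prod_cat C D) (f, g)"
    using P.is_isoI[OF 1 2] .
  show "inv_arr (prod_cat C D) (f, g) = (inv_arr C f, inv_arr D g)"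
    using P.inv_arr_eqI[OF 1 2] .
qed

lemma bifunctor_Hom:
  "is_functor (prod_cat C D) E F \<Longrightarrow> f \<in> Hom C X Y \<Longrightarrow> g \<in> Hom D X' Y'
    \<Longrightarrow> Fa F (f, g) \<in> Hom E (Fo F (X, X')) (Fo F (Y, Y'))"
  by (simp add: functor_Hom)

lemma bifunctor_Comp:
  assumes "is_functor (prod_cat C D) E F" "f \<in> Hom C X Y" "f' \<in> Hom C Y Z"
    "g \<in> Hom D X' Y'" "g' \<in> Hom D Y' Z'"
  shows "Fa F (f' \<cdot>\<^bsub>C\<^esub> f, g' \<cdot>\<^bsub>D\<^esub> g) = Fa F (f', g') \<cdot>\<^bsub>E\<^esub> Fa F (f, g)"
  using functor_Comp[OF assms(1), of "(f, g)" "(X, X')" "(Y, Y')" "(f', g')" "(Z, Z')"] assms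
  by simp

lemma
  assumes "category C" "category D" "category E" "is_functor (prod_cat C D) E F"
    "is_iso C f" "is_iso D g" "f \<in> Hom C X Y" "g \<in> Hom D X' Y'"
  shows bifunctor_is_iso: "is_iso E (Fa F (f, g))"
    and bifunctor_inv_arr: "inv_arr E (Fa F (f, g)) = Fa F (inv_arr C f, inv_arr D g)"
  using functor_is_iso[OF category_prod_cat[OF assms(1,2)] assms(3,4)
      prod_cat_is_iso[OF assms(1,2,5-8)], of "(X, X')" "(Y, Y')"]
    functor_inv_arr[OF category_prod_cat[OF assms(1,2)] assms(3,4)
      prod_cat_is_iso[OF assms(1,2,5-8)], of "(X, X')" "(Y, Y')"]
    prod_cat_inv_arr[OF assms(1,2,5-8)] assms(7,8) by simp_all

section \<open>Adjunctions\<close>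

locale adjoint_pair = C: category C + D: category D
  for C :: "('o, 'm, 'z) cat_scheme" and D :: "('p, 'n, 'y) cat_scheme" +
  fixes F :: "('o, 'm, 'p, 'n) func" and G :: "('p, 'n, 'o, 'm) func" and \<eta> \<epsilon>
  assumes adj: "adjunction C D F G \<eta> \<epsilon>"
begin

lemma left_functor: "is_functor C D F" and right_functor: "is_functor D C G"
  using adj unfolding adjunction_def by auto

lemma unit_Hom: "X \<in> Obj C \<Longrightarrow> \<eta> X \<in> Hom C X (Fo G (Fo F X))"
  and counit_Hom: "Y \<in> Obj D \<Longrightarrow> \<epsilon> Y \<in> Hom D (Fo F (Fo G Y)) Y"
  using adj unfolding adjunction_def nat_trans_def comp_func_def id_func_def by auto

lemma unit_natural: "a \<in> Hom C X X' \<Longrightarrow> Fa G (Fa F a) \<cdot>\<^bsub>C\<^esub> \<eta> X = \<eta> X' \<cdot>\<^bsub>C\<^esub> a"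
  and counit_natural: "b \<in> Hom D Y Y' \<Longrightarrow> b \<cdot>\<^bsub>D\<^esub> \<epsilon> Y = \<epsilon> Y' \<cdot>\<^bsub>D\<^esub> Fa F (Fa G b)"
  using adj unfolding adjunction_def nat_trans_def comp_func_def id_func_def Hom_def by auto

lemma triangle_left: "X \<in> Obj C \<Longrightarrow> \<epsilon> (Fo F X) \<cdot>\<^bsub>D\<^esub> Fa F (\<eta> X) = Id D (Fo F X)"
  and triangle_right: "Y \<in> Obj D \<Longrightarrow> Fa G (\<epsilon> Y) \<cdot>\<^bsub>C\<^esub> \<eta> (Fo G Y) = Id C (Fo G Y)"
  using adj unfolding adjunction_def by auto

lemma right_transpose_Hom:
  assumes "X \<in> Obj C" "x \<in> Hom D (Fo F X) Y"
  shows "Fa G x \<cdot>\<^bsub>C\<^esub> \<eta> X \<in> Hom C X (Fo G Y)"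
  using C.Comp_Hom[OF unit_Hom[OF assms(1)] functor_Hom[OF right_functor assms(2)]] .

text \<open>The bijection between arrows \<open>F X \<rightarrow> Y\<close> and \<open>X \<rightarrow> G Y\<close>. The exchange maps of \<open>R\<close> and of the tensor
structure with \<open>z\<^sub>*\<close> are defined as right transposes, and this lemma recovers the simple arrow they
come from.\<close>

lemma left_right_transpose:
  assumes "X \<in> Obj C" "x \<in> Hom D (Fo F X) Y"
  shows "\<epsilon> Y \<cdot>\<^bsub>D\<^esub> Fa F (Fa G x \<cdot>\<^bsub>C\<^esub> \<eta> X) = x"
proof -
  note Y = D.Hom_Obj(2)[OF assms(2)]
  note Gx = functor_Hom[OF right_functor assms(2)] and u = unit_Hom[OF assms(1)]
  have "\<epsilon> Y \<cdot>\<^bsub>D\<^esub> Fa F (Fa G x \<cdot>\<^bsub>C\<^esub> \<eta> X) = (\<epsilon> Y \<cdot>\<^bsub>D\<^esub> Fa F (Fa G x)) \<cdot>\<^bsub>D\<^esub> Fa F (\<eta> X)"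
    using functor_Comp[OF left_functor u Gx] D.Comp_assoc[OF functor_Hom[OF left_functor u]
        functor_Hom[OF left_functor Gx] counit_Hom[OF Y]] by simp
  also have "\<dots> = x \<cdot>\<^bsub>D\<^esub> \<epsilon> (Fo F X) \<cdot>\<^bsub>D\<^esub> Fa F (\<eta> X)"
    using counit_natural[OF assms(2)] D.Comp_assoc[OF functor_Hom[OF left_functor u]
        counit_Hom[OF functor_Obj[OF left_functor assms(1)]] assms(2)] by simp
  also have "\<dots> = x"
    using triangle_left[OF assms(1)] assms(2) D.Comp_Id by simp
  finally show ?thesis .
qed

lemma right_left_transpose:
  assumes "Y \<in> Obj D" "g \<in> Hom C X (Fo G Y)"
  shows "Fa G (\<epsilon> Y \<cdot>\<^bsub>D\<^esub> Fa F g) \<cdot>\<^bsub>C\<^esub> \<eta> X = g"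
proof -
  note X = C.Hom_Obj(1)[OF assms(2)]
  note Fg = functor_Hom[OF left_functor assms(2)] and e = counit_Hom[OF assms(1)]
  have "Fa G (\<epsilon> Y \<cdot>\<^bsub>D\<^esub> Fa F g) \<cdot>\<^bsub>C\<^esub> \<eta> X = Fa G (\<epsilon> Y) \<cdot>\<^bsub>C\<^esub> Fa G (Fa F g) \<cdot>\<^bsub>C\<^esub> \<eta> X"
    using functor_Comp[OF right_functor Fg e] C.Comp_assoc[OF unit_Hom[OF X]
        functor_Hom[OF right_functor Fg] functor_Hom[OF right_functor e]] by simp
  also have "\<dots> = (Fa G (\<epsilon> Y) \<cdot>\<^bsub>C\<^esub> \<eta> (Fo G Y)) \<cdot>\<^bsub>C\<^esub> g"
    using unit_natural[OF assms(2)] C.Comp_assoc[OF assms(2)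
        unit_Hom[OF functor_Obj[OF right_functor assms(1)]] functor_Hom[OF right_functor e]] by simp
  also have "\<dots> = g"
    using triangle_right[OF assms(1)] assms(2) C.Id_Comp by simp
  finally show ?thesis .
qed

lemma right_transpose_inject:
  assumes "X \<in> Obj C" "x \<in> Hom D (Fo F X) Y" "x' \<in> Hom D (Fo F X) Y"
    "Fa G x \<cdot>\<^bsub>C\<^esub> \<eta> X = Fa G x' \<cdot>\<^bsub>C\<^esub> \<eta> X"
  shows "x = x'"
  using left_right_transpose[OF assms(1,2)] left_right_transpose[OF assms(1,3)] assms(4) by metis

lemma left_transpose_inject:
  assumes "Y \<in> Obj D" "g \<in> Hom C X (Fo G Y)" "g' \<in> Hom C X (Fo G Y)"
    "\<epsilon> Y \<cdot>\<^bsub>D\<^esub> Fa F g = \<epsilon> Y \<cdot>\<^bsub>D\<^esub> Fa F g'"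
  shows "g = g'"
  using right_left_transpose[OF assms(1,2)] right_left_transpose[OF assms(1,3)] assms(4) by metis

text \<open>As \<open>G\<close> is full, the unit at \<open>G Y\<close> is \<open>G \<delta>\<close> for some \<open>\<delta> : Y \<rightarrow> F G Y\<close>. The two triangle identities
make \<open>\<delta>\<close> inverse to the counit, one of them after cancelling the faithful functor \<open>G\<close>.\<close>

lemma counit_is_iso:
  assumes "fully_faithful D C G" "Y \<in> Obj D"
  shows "is_iso D (\<epsilon> Y)"
proof -
  let ?Y = "Fo F (Fo G Y)"
  have GY: "Fo G Y \<in> Obj C" and Y': "?Y \<in> Obj D"
    using assms(2) functor_Obj left_functor right_functor by metis+
  have "Fa G ` Hom D Y ?Y = Hom C (Fo G Y) (Fo G ?Y)"
    using assms(1,2) Y' unfolding fully_faithful_def by (simp add: bij_betw_def)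
  then obtain \<delta> where d: "\<delta> \<in> Hom D Y ?Y" "Fa G \<delta> = \<eta> (Fo G Y)"
    using unit_Hom[OF GY] by (metis imageE)
  note e = counit_Hom[OF assms(2)]
  have "Fa G (\<epsilon> Y \<cdot>\<^bsub>D\<^esub> \<delta>) = Fa G (Id D Y)"
    using functor_Comp[OF right_functor d(1) e] d(2) triangle_right[OF assms(2)]
      functor_Id[OF right_functor assms(2)] by simp
  moreover have "inj_on (Fa G) (Hom D Y Y)"
    using assms unfolding fully_faithful_def by (simp add: bij_betw_def)
  ultimately have 1: "\<epsilon> Y \<cdot>\<^bsub>D\<^esub> \<delta> = Id D Y"
    using D.Comp_Hom[OF d(1) e] D.Id_Hom[OF assms(2)] by (simp add: inj_on_def)
  have 2: "\<delta> \<cdot>\<^bsub>D\<^esub> \<epsilon> Y = Id D ?Y"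
    using counit_natural[OF d(1)] d(2) triangle_left[OF GY] by simp
  show ?thesis
    using D.is_isoI[OF e d(1) 2 1] .
qed

text \<open>By the triangle identity \<open>F \<eta>\<close> is a right inverse of an invertible counit.\<close>

lemma left_unit_is_iso:
  assumes "fully_faithful D C G" "X \<in> Obj C"
  shows "is_iso D (Fa F (\<eta> X))"
proof -
  have O: "Fo F X \<in> Obj D"
    using functor_Obj[OF left_functor assms(2)] .
  have "is_iso D (Id D (Fo F X))"
    using D.is_isoI D.Id_Hom[OF O] D.Id_Comp[OF D.Id_Hom[OF O]] by blast
  then show ?thesis
    using D.is_iso_right_factor[OF _ counit_is_iso[OF assms(1) O]
        functor_Hom[OF left_functor unit_Hom[OF assms(2)]] counit_Hom[OF O]]
      triangle_left[OF assms(2)] by simp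
qed

end


section \<open>Fibered categories, their morphisms and external tensor structures\<close>

context base_category
begin

lemma Prod_Obj:
  assumes "X \<in> Obj S" "Y \<in> Obj S"
  shows "Prod S X Y \<in> Obj S"
  using product[OF assms] Hom_Obj unfolding is_product_def by blast

lemma
  assumes "f1 \<in> Hom S T1 X1" "f2 \<in> Hom S T2 X2"
  shows prod_arr_Hom: "prod_arr S f1 f2 \<in> Hom S (Prod S T1 T2) (Prod S X1 X2)"
    and Pr1_prod_arr: "Pr1 S X1 X2 \<cdot> prod_arr S f1 f2 = f1 \<cdot> Pr1 S T1 T2"
    and Pr2_prod_arr: "Pr2 S X1 X2 \<cdot> prod_arr S f1 f2 = f2 \<cdot> Pr2 S T1 T2"
    and prod_arr_unique: "\<lbrakk>h \<in> Hom S (Prod S T1 T2) (Prod S X1 X2);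
        Pr1 S X1 X2 \<cdot> h = f1 \<cdot> Pr1 S T1 T2; Pr2 S X1 X2 \<cdot> h = f2 \<cdot> Pr2 S T1 T2\<rbrakk>
      \<Longrightarrow> prod_arr S f1 f2 = h"
proof -
  note O = Hom_Obj[OF assms(1)] Hom_Obj[OF assms(2)]
  note T = product[OF O(1,3)] and X = product[OF O(2,4)]
  let ?P = "\<lambda>h. h \<in> Hom S (Prod S T1 T2) (Prod S X1 X2) \<and>
      Pr1 S X1 X2 \<cdot> h = f1 \<cdot> Pr1 S T1 T2 \<and> Pr2 S X1 X2 \<cdot> h = f2 \<cdot> Pr2 S T1 T2"
  have "f1 \<cdot> Pr1 S T1 T2 \<in> Hom S (Prod S T1 T2) X1" "f2 \<cdot> Pr2 S T1 T2 \<in> Hom S (Prod S T1 T2) X2"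
    using T assms Comp_Hom unfolding is_product_def by blast+
  then have ex1: "\<exists>!h. ?P h"
    using X Prod_Obj[OF O(1,3)] unfolding is_product_def by blast
  have eq: "prod_arr S f1 f2 = (THE h. ?P h)"
    using assms by (simp add: prod_arr_def Hom_def)
  have "?P (prod_arr S f1 f2)"
    unfolding eq using theI'[OF ex1] .
  then show "prod_arr S f1 f2 \<in> Hom S (Prod S T1 T2) (Prod S X1 X2)"
    "Pr1 S X1 X2 \<cdot> prod_arr S f1 f2 = f1 \<cdot> Pr1 S T1 T2"
    "Pr2 S X1 X2 \<cdot> prod_arr S f1 f2 = f2 \<cdot> Pr2 S T1 T2"
    by auto
  show "prod_arr S f1 f2 = h" if "h \<in> Hom S (Prod S T1 T2) (Prod S X1 X2)"
    "Pr1 S X1 X2 \<cdot> h = f1 \<cdot> Pr1 S T1 T2" "Pr2 S X1 X2 \<cdot> h = f2 \<cdot> Pr2 S T1 T2"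
    unfolding eq using the1_equality[OF ex1, of h] that by blast
qed

lemma prod_arr_Comp:
  assumes f: "f1 \<in> Hom S T1 X1" "f2 \<in> Hom S T2 X2" and g: "g1 \<in> Hom S X1 Y1" "g2 \<in> Hom S X2 Y2"
  shows "prod_arr S (g1 \<cdot> f1) (g2 \<cdot> f2) = prod_arr S g1 g2 \<cdot> prod_arr S f1 f2"
proof (rule prod_arr_unique[OF Comp_Hom[OF f(1) g(1)] Comp_Hom[OF f(2) g(2)]])
  note pf = prod_arr_Hom[OF f] and pg = prod_arr_Hom[OF g]
  note O = Hom_Obj[OF f(1)] Hom_Obj[OF f(2)] Hom_Obj[OF g(1)] Hom_Obj[OF g(2)]
  have T: "Pr1 S T1 T2 \<in> Hom S (Prod S T1 T2) T1" "Pr2 S T1 T2 \<in> Hom S (Prod S T1 T2) T2"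
    and X: "Pr1 S X1 X2 \<in> Hom S (Prod S X1 X2) X1" "Pr2 S X1 X2 \<in> Hom S (Prod S X1 X2) X2"
    and Y: "Pr1 S Y1 Y2 \<in> Hom S (Prod S Y1 Y2) Y1" "Pr2 S Y1 Y2 \<in> Hom S (Prod S Y1 Y2) Y2"
    using product O unfolding is_product_def by blast+
  show "prod_arr S g1 g2 \<cdot> prod_arr S f1 f2 \<in> Hom S (Prod S T1 T2) (Prod S Y1 Y2)"
    using Comp_Hom[OF pf pg] .
  show "Pr1 S Y1 Y2 \<cdot> prod_arr S g1 g2 \<cdot> prod_arr S f1 f2 = (g1 \<cdot> f1) \<cdot> Pr1 S T1 T2"
    using Comp_assoc[OF pf pg Y(1)] Comp_assoc[OF pf X(1) g(1)] Comp_assoc[OF T(1) f(1) g(1)]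
      Pr1_prod_arr[OF f] Pr1_prod_arr[OF g] by simp
  show "Pr2 S Y1 Y2 \<cdot> prod_arr S g1 g2 \<cdot> prod_arr S f1 f2 = (g2 \<cdot> f2) \<cdot> Pr2 S T1 T2"
    using Comp_assoc[OF pf pg Y(2)] Comp_assoc[OF pf X(2) g(2)] Comp_assoc[OF T(2) f(2) g(2)]
      Pr2_prod_arr[OF f] Pr2_prod_arr[OF g] by simp
qed

end

context fibered_category
begin

lemma conn_Hom:
  "\<lbrakk>f \<in> Hom S T X; g \<in> Hom S X Y; A \<in> Obj (fib H Y)\<rbrakk> \<Longrightarrow>
    conn H f g A \<in> Hom (fib H T) (Fo (pull H (g \<cdot>\<^bsub>S\<^esub> f)) A) (Fo (pull H f) (Fo (pull H g) A))"
  using conn_nat_iso unfolding nat_iso_def nat_trans_def comp_func_def by fastforce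

lemma conn_is_iso:
  "\<lbrakk>f \<in> Hom S T X; g \<in> Hom S X Y; A \<in> Obj (fib H Y)\<rbrakk> \<Longrightarrow> is_iso (fib H T) (conn H f g A)"
  using conn_nat_iso unfolding nat_iso_def by blast

lemma conn_natural:
  assumes "f \<in> Hom S T X" "g \<in> Hom S X Y" "a \<in> Hom (fib H Y) A B"
  shows "Fa (pull H f) (Fa (pull H g) a) \<cdot>\<^bsub>fib H T\<^esub> conn H f g A
    = conn H f g B \<cdot>\<^bsub>fib H T\<^esub> Fa (pull H (g \<cdot>\<^bsub>S\<^esub> f)) a"
  using nat_trans_natural[OF _ assms(3)] conn_nat_iso[OF assms(1,2)]
  unfolding nat_iso_def comp_func_def by fastforce

text \<open>Hilbert choice does pick an adjunction as soon as one exists; the same holds for \<open>p\<^sub>#\<close> below.\<close>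

lemma star_adjoint_pair:
  assumes "has_star S H z" "z \<in> Hom S Z X" "Z \<in> Obj S" "X \<in> Obj S"
  shows "adjoint_pair (fib H X) (fib H Z) (pull H z) (star S H z) (star_unit S H z)
    (star_counit S H z)"
proof -
  have "\<exists>t. case t of (G, \<eta>, \<epsilon>) \<Rightarrow> adjunction (fib H (Cod S z)) (fib H (Dom S z)) (pull H z) G \<eta> \<epsilon>"
    using assms(1) unfolding has_star_def by auto
  from someI_ex[OF this]
  have "adjunction (fib H (Cod S z)) (fib H (Dom S z)) (pull H z) (star S H z) (star_unit S H z)
      (star_counit S H z)"
    by (auto simp: star_def star_unit_def star_counit_def star_adj_def split: prod.splits)
  then show ?thesis
    using assms(2-4) fib_category by (simp add: adjoint_pair_def adjoint_pair_axioms_def Hom_def)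
qed

lemma sharp_adjoint_pair:
  assumes "has_sharp S H p" "p \<in> Hom S P X" "P \<in> Obj S" "X \<in> Obj S"
  shows "adjoint_pair (fib H P) (fib H X) (sharp S H p) (pull H p) (sharp_unit S H p)
    (sharp_counit S H p)"
proof -
  have "\<exists>t. case t of (F, \<eta>, \<epsilon>) \<Rightarrow> adjunction (fib H (Dom S p)) (fib H (Cod S p)) F (pull H p) \<eta> \<epsilon>"
    using assms(1) unfolding has_sharp_def by auto
  from someI_ex[OF this]
  have "adjunction (fib H (Dom S p)) (fib H (Cod S p)) (sharp S H p) (pull H p) (sharp_unit S H p)
      (sharp_counit S H p)"
    by (auto simp: sharp_def sharp_unit_def sharp_counit_def sharp_adj_def split: prod.splits)
  then show ?thesis
    using assms(2-4) fib_category by (simp add: adjoint_pair_def adjoint_pair_axioms_def Hom_def)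
qed

end

context fibered_morphism
begin

lemma theta_Hom:
  "\<lbrakk>f \<in> Hom S T X; A \<in> Obj (fib H1 X)\<rbrakk> \<Longrightarrow>
    theta R f A \<in> Hom (fib H2 T) (Fo (pull H2 f) (Fo (mor R X) A)) (Fo (mor R T) (Fo (pull H1 f) A))"
  using theta_nat_iso unfolding nat_iso_def nat_trans_def comp_func_def by fastforce

lemma theta_is_iso: "\<lbrakk>f \<in> Hom S T X; A \<in> Obj (fib H1 X)\<rbrakk> \<Longrightarrow> is_iso (fib H2 T) (theta R f A)"
  using theta_nat_iso unfolding nat_iso_def by blast

lemma theta_natural:
  assumes "f \<in> Hom S T X" "a \<in> Hom (fib H1 X) A B"
  shows "Fa (mor R T) (Fa (pull H1 f) a) \<cdot>\<^bsub>fib H2 T\<^esub> theta R f A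
    = theta R f B \<cdot>\<^bsub>fib H2 T\<^esub> Fa (pull H2 f) (Fa (mor R X) a)"
  using nat_trans_natural[OF _ assms(2)] theta_nat_iso[OF assms(1)]
  unfolding nat_iso_def comp_func_def by fastforce

end

context external_tensor
begin

lemma mon_Hom:
  assumes "f1 \<in> Hom S T1 X1" "f2 \<in> Hom S T2 X2" "A1 \<in> Obj (fib H X1)" "A2 \<in> Obj (fib H X2)"
  shows "mon E f1 f2 (A1, A2) \<in> Hom (fib H (Prod S T1 T2))
    (Fo (tens E T1 T2) (Fo (pull H f1) A1, Fo (pull H f2) A2))
    (Fo (pull H (prod_arr S f1 f2)) (Fo (tens E X1 X2) (A1, A2)))"
  using nat_trans_Hom[of _ _ _ _ _ "(A1, A2)"] mon_nat_iso[OF assms(1,2)] assms(3,4)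
  unfolding nat_iso_def comp_func_def prod_func_def by fastforce

lemma mon_is_iso:
  assumes "f1 \<in> Hom S T1 X1" "f2 \<in> Hom S T2 X2" "A1 \<in> Obj (fib H X1)" "A2 \<in> Obj (fib H X2)"
  shows "is_iso (fib H (Prod S T1 T2)) (mon E f1 f2 (A1, A2))"
  using mon_nat_iso[OF assms(1,2)] assms(3,4) unfolding nat_iso_def by simp

lemma mon_natural:
  assumes "f1 \<in> Hom S T1 X1" "f2 \<in> Hom S T2 X2"
    and "a1 \<in> Hom (fib H X1) A1 B1" "a2 \<in> Hom (fib H X2) A2 B2"
  shows "Fa (pull H (prod_arr S f1 f2)) (Fa (tens E X1 X2) (a1, a2))
      \<cdot>\<^bsub>fib H (Prod S T1 T2)\<^esub> mon E f1 f2 (A1, A2)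
    = mon E f1 f2 (B1, B2)
      \<cdot>\<^bsub>fib H (Prod S T1 T2)\<^esub> Fa (tens E T1 T2) (Fa (pull H f1) a1, Fa (pull H f2) a2)"
  using nat_trans_natural[of _ _ _ _ _ "(a1, a2)" "(A1, A2)" "(B1, B2)"]
    mon_nat_iso[OF assms(1,2)] assms(3,4)
  unfolding nat_iso_def comp_func_def prod_func_def by fastforce

end

context mor_tensor_family
begin

lemma rho_Hom:
  assumes "X1 \<in> Obj S" "X2 \<in> Obj S" "A1 \<in> Obj (fib H1 X1)" "A2 \<in> Obj (fib H1 X2)"
  shows "\<rho> X1 X2 (A1, A2) \<in> Hom (fib H2 (Prod S X1 X2))
    (Fo (tens E2 X1 X2) (Fo (mor R X1) A1, Fo (mor R X2) A2))
    (Fo (mor R (Prod S X1 X2)) (Fo (tens E1 X1 X2) (A1, A2)))"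
  using nat_trans_Hom[of _ _ _ _ _ "(A1, A2)"] rho_nat_iso[OF assms(1,2)] assms(3,4)
  unfolding nat_iso_def comp_func_def prod_func_def by fastforce

lemma rho_natural:
  assumes "X1 \<in> Obj S" "X2 \<in> Obj S"
    and "a1 \<in> Hom (fib H1 X1) A1 B1" "a2 \<in> Hom (fib H1 X2) A2 B2"
  shows "Fa (mor R (Prod S X1 X2)) (Fa (tens E1 X1 X2) (a1, a2))
      \<cdot>\<^bsub>fib H2 (Prod S X1 X2)\<^esub> \<rho> X1 X2 (A1, A2)
    = \<rho> X1 X2 (B1, B2)
      \<cdot>\<^bsub>fib H2 (Prod S X1 X2)\<^esub> Fa (tens E2 X1 X2) (Fa (mor R X1) a1, Fa (mor R X2) a2)"
  using nat_trans_natural[of _ _ _ _ _ "(a1, a2)" "(A1, A2)" "(B1, B2)"]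
    rho_nat_iso[OF assms(1,2)] assms(3,4)
  unfolding nat_iso_def comp_func_def prod_func_def by fastforce

end


section \<open>Exchange maps with direct images under closed immersions\<close>

locale morphism_over_base = base_category S + H1: fibered_category S H1 + H2: fibered_category S H2 +
    fibered_morphism S H1 H2 R
  for S :: "('s, 'a) base" (structure)
    and H1 :: "('s, 'a, 'o, 'm) fibcat" and H2 :: "('s, 'a, 'p, 'n) fibcat"
    and R :: "('s, 'a, 'o, 'm, 'p, 'n) fibmor"
begin

text \<open>By its definition the exchange map \<open>R z\<^sub>* \<rightarrow> z\<^sub>* R\<close> is the right transpose of \<open>R \<epsilon> \<cdot> \<theta>\<close>; hence its left
transpose is \<open>R \<epsilon> \<cdot> \<theta>\<close> again.\<close>

lemma
  assumes z: "z \<in> Hom S Z X" and stars: "has_star S H1 z" "has_star S H2 z"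
    and A: "A \<in> Obj (fib H1 Z)"
  shows theta_bar_Hom: "theta_bar S H1 H2 R z A
      \<in> Hom (fib H2 X) (Fo (mor R X) (Fo (star S H1 z) A)) (Fo (star S H2 z) (Fo (mor R Z) A))"
    and theta_bar_transpose: "star_counit S H2 z (Fo (mor R Z) A)
        \<cdot>\<^bsub>fib H2 Z\<^esub> Fa (pull H2 z) (theta_bar S H1 H2 R z A)
      = Fa (mor R Z) (star_counit S H1 z A) \<cdot>\<^bsub>fib H2 Z\<^esub> theta R z (Fo (star S H1 z) A)"
proof -
  note O = Hom_Obj[OF z]
  interpret A1: adjoint_pair "fib H1 X" "fib H1 Z" "pull H1 z" "star S H1 z" "star_unit S H1 z"
      "star_counit S H1 z"
    using H1.star_adjoint_pair[OF stars(1) z O] .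
  interpret A2: adjoint_pair "fib H2 X" "fib H2 Z" "pull H2 z" "star S H2 z" "star_unit S H2 z"
      "star_counit S H2 z"
    using H2.star_adjoint_pair[OF stars(2) z O] .
  note zA = functor_Obj[OF A1.right_functor A]
  note RzA = functor_Obj[OF mor_functor[OF O(2)] zA]
  have x: "Fa (mor R Z) (star_counit S H1 z A) \<cdot>\<^bsub>fib H2 Z\<^esub> theta R z (Fo (star S H1 z) A)
      \<in> Hom (fib H2 Z) (Fo (pull H2 z) (Fo (mor R X) (Fo (star S H1 z) A))) (Fo (mor R Z) A)"
    using A2.D.Comp_Hom[OF theta_Hom[OF z zA]
        functor_Hom[OF mor_functor[OF O(1)] A1.counit_Hom[OF A]]] .
  have eq: "theta_bar S H1 H2 R z A = Fa (star S H2 z)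
        (Fa (mor R Z) (star_counit S H1 z A) \<cdot>\<^bsub>fib H2 Z\<^esub> theta R z (Fo (star S H1 z) A))
      \<cdot>\<^bsub>fib H2 X\<^esub> star_unit S H2 z (Fo (mor R X) (Fo (star S H1 z) A))"
    using z by (simp add: theta_bar_def Let_def Hom_def)
  show "theta_bar S H1 H2 R z A
      \<in> Hom (fib H2 X) (Fo (mor R X) (Fo (star S H1 z) A)) (Fo (star S H2 z) (Fo (mor R Z) A))"
    unfolding eq using A2.right_transpose_Hom[OF RzA x] .
  show "star_counit S H2 z (Fo (mor R Z) A)
        \<cdot>\<^bsub>fib H2 Z\<^esub> Fa (pull H2 z) (theta_bar S H1 H2 R z A)
      = Fa (mor R Z) (star_counit S H1 z A) \<cdot>\<^bsub>fib H2 Z\<^esub> theta R z (Fo (star S H1 z) A)"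
    unfolding eq using A2.left_right_transpose[OF RzA x] .
qed

end

locale tensor_over_base = base_category S + fibered_category S H + external_tensor S H E
  for S :: "('s, 'a) base" (structure)
    and H :: "('s, 'a, 'o, 'm) fibcat" and E :: "('s, 'a, 'o, 'm) ext_tensor"
begin

text \<open>The same for the exchange of \<open>\<boxtimes>\<close> with direct images, which is the right transpose of
\<open>(\<epsilon> \<boxtimes> \<epsilon>) \<cdot> m\<^sup>-\<^sup>1\<close>.\<close>

lemma
  assumes z: "z1 \<in> Hom S Z1 X1" "z2 \<in> Hom S Z2 X2"
    and stars: "has_star S H z1" "has_star S H z2" "has_star S H (prod_arr S z1 z2)"
    and A: "A1 \<in> Obj (fib H Z1)" "A2 \<in> Obj (fib H Z2)"
  shows mon_bar_Hom: "mon_bar S H E z1 z2 (A1, A2) \<in> Hom (fib H (Prod S X1 X2))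
      (Fo (tens E X1 X2) (Fo (star S H z1) A1, Fo (star S H z2) A2))
      (Fo (star S H (prod_arr S z1 z2)) (Fo (tens E Z1 Z2) (A1, A2)))"
    and mon_bar_transpose: "star_counit S H (prod_arr S z1 z2) (Fo (tens E Z1 Z2) (A1, A2))
        \<cdot>\<^bsub>fib H (Prod S Z1 Z2)\<^esub> Fa (pull H (prod_arr S z1 z2)) (mon_bar S H E z1 z2 (A1, A2))
      = Fa (tens E Z1 Z2) (star_counit S H z1 A1, star_counit S H z2 A2)
        \<cdot>\<^bsub>fib H (Prod S Z1 Z2)\<^esub>
          inv_arr (fib H (Prod S Z1 Z2)) (mon E z1 z2 (Fo (star S H z1) A1, Fo (star S H z2) A2))"
proof -
  let ?z = "prod_arr S z1 z2" and ?Z = "Prod S Z1 Z2" and ?X = "Prod S X1 X2"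
  note O = Hom_Obj[OF z(1)] Hom_Obj[OF z(2)]
  note pz = prod_arr_Hom[OF z]
  note PO = Hom_Obj[OF pz]
  interpret A1: adjoint_pair "fib H X1" "fib H Z1" "pull H z1" "star S H z1" "star_unit S H z1"
      "star_counit S H z1"
    using star_adjoint_pair[OF stars(1) z(1) O(1,2)] .
  interpret A2: adjoint_pair "fib H X2" "fib H Z2" "pull H z2" "star S H z2" "star_unit S H z2"
      "star_counit S H z2"
    using star_adjoint_pair[OF stars(2) z(2) O(3,4)] .
  interpret P: adjoint_pair "fib H ?X" "fib H ?Z" "pull H ?z" "star S H ?z" "star_unit S H ?z"
      "star_counit S H ?z"
    using star_adjoint_pair[OF stars(3) pz PO] .
  note zA = functor_Obj[OF A1.right_functor A(1)] functor_Obj[OF A2.right_functor A(2)]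
  let ?W = "Fo (tens E X1 X2) (Fo (star S H z1) A1, Fo (star S H z2) A2)"
  let ?m = "mon E z1 z2 (Fo (star S H z1) A1, Fo (star S H z2) A2)"
  let ?x = "Fa (tens E Z1 Z2) (star_counit S H z1 A1, star_counit S H z2 A2)
        \<cdot>\<^bsub>fib H ?Z\<^esub> inv_arr (fib H ?Z) ?m"
  have W: "?W \<in> Obj (fib H ?X)"
    using functor_Obj[OF tens_functor[OF O(2,4)]] zA by simp
  have x: "?x \<in> Hom (fib H ?Z) (Fo (pull H ?z) ?W) (Fo (tens E Z1 Z2) (A1, A2))"
    using P.D.Comp_Hom[OF P.D.is_iso_Hom(1)[OF mon_is_iso[OF z zA] mon_Hom[OF z zA]]
        bifunctor_Hom[OF tens_functor[OF O(1,3)] A1.counit_Hom[OF A(1)] A2.counit_Hom[OF A(2)]]] .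
  have eq: "mon_bar S H E z1 z2 (A1, A2) = Fa (star S H ?z) ?x \<cdot>\<^bsub>fib H ?X\<^esub> star_unit S H ?z ?W"
    using z by (simp add: mon_bar_def Let_def Hom_def)
  show "mon_bar S H E z1 z2 (A1, A2) \<in> Hom (fib H ?X) ?W (Fo (star S H ?z) (Fo (tens E Z1 Z2) (A1, A2)))"
    unfolding eq using P.right_transpose_Hom[OF W x] .
  show "star_counit S H ?z (Fo (tens E Z1 Z2) (A1, A2))
        \<cdot>\<^bsub>fib H ?Z\<^esub> Fa (pull H ?z) (mon_bar S H E z1 z2 (A1, A2)) = ?x"
    unfolding eq using P.left_right_transpose[OF W x] .
qed

end


section \<open>Compatibility with inverse images\<close>

locale tensor_family = morphism_over_base S H1 H2 R +
    E1: external_tensor S H1 E1 + E2: external_tensor S H2 E2 + mor_tensor_family S H1 H2 E1 E2 R \<rho>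
  for S :: "('s, 'a) base" (structure)
    and H1 :: "('s, 'a, 'o, 'm) fibcat" and H2 :: "('s, 'a, 'p, 'n) fibcat"
    and E1 :: "('s, 'a, 'o, 'm) ext_tensor" and E2 :: "('s, 'a, 'p, 'n) ext_tensor"
    and R :: "('s, 'a, 'o, 'm, 'p, 'n) fibmor" and \<rho> :: "'s \<Rightarrow> 's \<Rightarrow> 'o \<times> 'o \<Rightarrow> 'n"
begin

text \<open>The two sides of the compatibility hexagon. They take a pair of objects as one argument, so that
each of them has the form of a natural transformation on the product category.\<close>

definition theta_rho_mon :: "'a \<Rightarrow> 'a \<Rightarrow> 'o \<times> 'o \<Rightarrow> 'n" where
  "theta_rho_mon f1 f2 A =
    (let T = fib H2 (Prod S (Dom S f1) (Dom S f2)); X1 = Cod S f1; X2 = Cod S f2;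
         f = prod_arr S f1 f2
     in theta R f (Fo (tens E1 X1 X2) A) \<cdot>\<^bsub>T\<^esub> Fa (pull H2 f) (\<rho> X1 X2 A)
        \<cdot>\<^bsub>T\<^esub> mon E2 f1 f2 (Fo (prod_func (mor R X1) (mor R X2)) A))"

definition mon_rho_theta :: "'a \<Rightarrow> 'a \<Rightarrow> 'o \<times> 'o \<Rightarrow> 'n" where
  "mon_rho_theta f1 f2 A =
    (let T1 = Dom S f1; T2 = Dom S f2; T = fib H2 (Prod S T1 T2)
     in Fa (mor R (Prod S T1 T2)) (mon E1 f1 f2 A)
        \<cdot>\<^bsub>T\<^esub> \<rho> T1 T2 (Fo (prod_func (pull H1 f1) (pull H1 f2)) A)
        \<cdot>\<^bsub>T\<^esub> Fa (tens E2 T1 T2) (case A of (A1, A2) \<Rightarrow> (theta R f1 A1, theta R f2 A2)))"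

definition compatible :: "'a \<Rightarrow> 'a \<Rightarrow> 'o \<Rightarrow> 'o \<Rightarrow> bool" where
  "compatible f1 f2 A1 A2 \<longleftrightarrow> theta_rho_mon f1 f2 (A1, A2) = mon_rho_theta f1 f2 (A1, A2)"

lemma compatible_iff:
  assumes "f1 \<in> Hom S T1 X1" "f2 \<in> Hom S T2 X2"
  shows "compatible f1 f2 A1 A2 \<longleftrightarrow>
      theta R (prod_arr S f1 f2) (Fo (tens E1 X1 X2) (A1, A2))
        \<cdot>\<^bsub>fib H2 (Prod S T1 T2)\<^esub> Fa (pull H2 (prod_arr S f1 f2)) (\<rho> X1 X2 (A1, A2))
        \<cdot>\<^bsub>fib H2 (Prod S T1 T2)\<^esub> mon E2 f1 f2 (Fo (mor R X1) A1, Fo (mor R X2) A2)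
      = Fa (mor R (Prod S T1 T2)) (mon E1 f1 f2 (A1, A2))
        \<cdot>\<^bsub>fib H2 (Prod S T1 T2)\<^esub> \<rho> T1 T2 (Fo (pull H1 f1) A1, Fo (pull H1 f2) A2)
        \<cdot>\<^bsub>fib H2 (Prod S T1 T2)\<^esub> Fa (tens E2 T1 T2) (theta R f1 A1, theta R f2 A2)"
  using assms
  by (simp add: compatible_def theta_rho_mon_def mon_rho_theta_def Let_def prod_func_def Hom_def)

lemma
  assumes f: "f1 \<in> Hom S T1 X1" "f2 \<in> Hom S T2 X2"
  shows nat_trans_theta_rho_mon:
      "nat_trans (prod_cat (fib H1 X1) (fib H1 X2)) (fib H2 (Prod S T1 T2))
        (tens E2 T1 T2 \<odot> prod_func (pull H2 f1 \<odot> mor R X1) (pull H2 f2 \<odot> mor R X2))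
        (mor R (Prod S T1 T2) \<odot> pull H1 (prod_arr S f1 f2) \<odot> tens E1 X1 X2)
        (theta_rho_mon f1 f2)" (is "nat_trans ?C ?D ?F ?G _")
    and nat_trans_mon_rho_theta:
      "nat_trans (prod_cat (fib H1 X1) (fib H1 X2)) (fib H2 (Prod S T1 T2))
        (tens E2 T1 T2 \<odot> prod_func (pull H2 f1 \<odot> mor R X1) (pull H2 f2 \<odot> mor R X2))
        (mor R (Prod S T1 T2) \<odot> pull H1 (prod_arr S f1 f2) \<odot> tens E1 X1 X2)
        (mon_rho_theta f1 f2)"
proof -
  let ?f = "prod_arr S f1 f2" and ?T = "Prod S T1 T2" and ?X = "Prod S X1 X2"
  let ?RR = "prod_func (mor R X1) (mor R X2)" and ?RR' = "prod_func (mor R T1) (mor R T2)"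
  let ?ff = "prod_func (pull H1 f1) (pull H1 f2)" and ?ff' = "prod_func (pull H2 f1) (pull H2 f2)"
  note O = Hom_Obj[OF f(1)] Hom_Obj[OF f(2)]
  note TX = Prod_Obj[OF O(1,3)] Prod_Obj[OF O(2,4)]
  note fH = prod_arr_Hom[OF f]
  note C = category_prod_cat[OF H1.fib_category[OF O(2)] H1.fib_category[OF O(4)]]
  note D = H2.fib_category[OF TX(1)]
  note RR = functor_prod_func[OF mor_functor[OF O(2)] mor_functor[OF O(4)]]
  note RR' = functor_prod_func[OF mor_functor[OF O(1)] mor_functor[OF O(3)]]
  note ff = functor_prod_func[OF H1.pull_functor[OF f(1)] H1.pull_functor[OF f(2)]]
  note ff' = functor_prod_func[OF H2.pull_functor[OF f(1)] H2.pull_functor[OF f(2)]]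
  note p = H1.pull_functor[OF fH] H2.pull_functor[OF fH]
  note t = E1.tens_functor[OF O(1,3)] E2.tens_functor[OF O(1,3)]
    E1.tens_functor[OF O(2,4)] E2.tens_functor[OF O(2,4)]
  note R = mor_functor[OF TX(1)] mor_functor[OF TX(2)]
  have m1: "nat_trans ?C (fib H1 ?T) (tens E1 T1 T2 \<odot> ?ff) (pull H1 ?f \<odot> tens E1 X1 X2) (mon E1 f1 f2)"
    using E1.mon_nat_iso[OF f] by (simp add: nat_iso_def)
  have m2: "nat_trans (prod_cat (fib H2 X1) (fib H2 X2)) ?D (tens E2 T1 T2 \<odot> ?ff')
      (pull H2 ?f \<odot> tens E2 X1 X2) (mon E2 f1 f2)"
    using E2.mon_nat_iso[OF f] by (simp add: nat_iso_def)
  have r: "nat_trans ?C (fib H2 ?X) (tens E2 X1 X2 \<odot> ?RR) (mor R ?X \<odot> tens E1 X1 X2) (\<rho> X1 X2)"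
    using rho_nat_iso[OF O(2,4)] by (simp add: nat_iso_def)
  have r': "nat_trans (prod_cat (fib H1 T1) (fib H1 T2)) ?D (tens E2 T1 T2 \<odot> ?RR')
      (mor R ?T \<odot> tens E1 T1 T2) (\<rho> T1 T2)"
    using rho_nat_iso[OF O(1,3)] by (simp add: nat_iso_def)
  have th: "nat_trans (fib H1 ?X) ?D (pull H2 ?f \<odot> mor R ?X) (mor R ?T \<odot> pull H1 ?f) (theta R ?f)"
    using theta_nat_iso[OF fH] by (simp add: nat_iso_def)
  have "nat_trans ?C (prod_cat (fib H2 T1) (fib H2 T2))
      (prod_func (pull H2 f1 \<odot> mor R X1) (pull H2 f2 \<odot> mor R X2))
      (prod_func (mor R T1 \<odot> pull H1 f1) (mor R T2 \<odot> pull H1 f2))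
      (\<lambda>(A1, A2). (theta R f1 A1, theta R f2 A2))"
    using nat_trans_prod theta_nat_iso[OF f(1)] theta_nat_iso[OF f(2)] unfolding nat_iso_def by blast
  then have th': "nat_trans ?C (prod_cat (fib H2 T1) (fib H2 T2)) (?ff' \<odot> ?RR) (?RR' \<odot> ?ff)
      (\<lambda>(A1, A2). (theta R f1 A1, theta R f2 A2))"
    by (simp add: prod_func_comp)
  note comp = functor_comp_func

  have 1: "nat_trans ?C ?D (tens E2 T1 T2 \<odot> ?ff' \<odot> ?RR) (pull H2 ?f \<odot> tens E2 X1 X2 \<odot> ?RR)
      (\<lambda>A. mon E2 f1 f2 (Fo ?RR A))"
    using nat_trans_whisker_right[OF RR m2] by (simp add: comp_func_assoc)
  have 2: "nat_trans ?C ?D (pull H2 ?f \<odot> tens E2 X1 X2 \<odot> ?RR) (pull H2 ?f \<odot> mor R ?X \<odot> tens E1 X1 X2)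
      (\<lambda>A. Fa (pull H2 ?f) (\<rho> X1 X2 A))"
    using nat_trans_whisker_left[OF C comp[OF RR t(4)] comp[OF t(3) R(2)] p(2) r] .
  have 3: "nat_trans ?C ?D (pull H2 ?f \<odot> mor R ?X \<odot> tens E1 X1 X2) ?G
      (\<lambda>A. theta R ?f (Fo (tens E1 X1 X2) A))"
    using nat_trans_whisker_right[OF t(3) th] by (simp add: comp_func_assoc)
  have F: "is_functor ?C ?D (tens E2 T1 T2 \<odot> ?ff' \<odot> ?RR)"
    using comp[OF comp[OF RR ff'] t(2)] .
  have G: "is_functor ?C ?D ?G"
    using comp[OF comp[OF t(3) p(1)] R(1)] .
  have K: "is_functor ?C ?D (pull H2 ?f \<odot> mor R ?X \<odot> tens E1 X1 X2)"
    using comp[OF comp[OF t(3) R(2)] p(2)] .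
  have K': "is_functor ?C ?D (pull H2 ?f \<odot> tens E2 X1 X2 \<odot> ?RR)"
    using comp[OF comp[OF RR t(4)] p(2)] .
  show "nat_trans ?C ?D ?F ?G (theta_rho_mon f1 f2)"
    using nat_trans_vertical[OF C D F K G nat_trans_vertical[OF C D F K' K 1 2] 3] f
    by (simp add: theta_rho_mon_def[abs_def] Let_def Hom_def prod_func_comp)

  have 4: "nat_trans ?C ?D (tens E2 T1 T2 \<odot> ?ff' \<odot> ?RR) (tens E2 T1 T2 \<odot> ?RR' \<odot> ?ff)
      (\<lambda>A. Fa (tens E2 T1 T2) (case A of (A1, A2) \<Rightarrow> (theta R f1 A1, theta R f2 A2)))"
    using nat_trans_whisker_left[OF C comp[OF RR ff'] comp[OF ff RR'] t(2) th'] .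
  have 5: "nat_trans ?C ?D (tens E2 T1 T2 \<odot> ?RR' \<odot> ?ff) (mor R ?T \<odot> tens E1 T1 T2 \<odot> ?ff)
      (\<lambda>A. \<rho> T1 T2 (Fo ?ff A))"
    using nat_trans_whisker_right[OF ff r'] by (simp add: comp_func_assoc)
  have 6: "nat_trans ?C ?D (mor R ?T \<odot> tens E1 T1 T2 \<odot> ?ff) ?G (\<lambda>A. Fa (mor R ?T) (mon E1 f1 f2 A))"
    using nat_trans_whisker_left[OF C comp[OF ff t(1)] comp[OF t(3) p(1)] R(1) m1] .
  have L: "is_functor ?C ?D (tens E2 T1 T2 \<odot> ?RR' \<odot> ?ff)"
    using comp[OF comp[OF ff RR'] t(2)] .
  have L': "is_functor ?C ?D (mor R ?T \<odot> tens E1 T1 T2 \<odot> ?ff)"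
    using comp[OF comp[OF ff t(1)] R(1)] .
  show "nat_trans ?C ?D ?F ?G (mon_rho_theta f1 f2)"
    using nat_trans_vertical[OF C D F L' G nat_trans_vertical[OF C D F L L' 4 5] 6] f
    by (simp add: mon_rho_theta_def[abs_def] Let_def Hom_def prod_func_comp)
qed


text \<open>The hexagon for the composites is cut by the connection isomorphisms into the inverse image of the
hexagon for \<open>(g\<^sub>1, g\<^sub>2)\<close>, the hexagon for \<open>(f\<^sub>1, f\<^sub>2)\<close>, the cocycle conditions on \<open>\<theta>\<close> and \<open>m\<close>, and
naturality squares.\<close>

lemma compatible_Comp:
  assumes f: "f1 \<in> Hom S T1 X1" "f2 \<in> Hom S T2 X2" and g: "g1 \<in> Hom S X1 Y1" "g2 \<in> Hom S X2 Y2"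
    and A: "A1 \<in> Obj (fib H1 Y1)" "A2 \<in> Obj (fib H1 Y2)"
    and cg: "compatible g1 g2 A1 A2"
    and cf: "compatible f1 f2 (Fo (pull H1 g1) A1) (Fo (pull H1 g2) A2)"
  shows "compatible (g1 \<cdot> f1) (g2 \<cdot> f2) A1 A2"
proof -
  let ?f = "prod_arr S f1 f2" and ?g = "prod_arr S g1 g2"
  let ?T = "Prod S T1 T2" and ?X = "Prod S X1 X2" and ?Y = "Prod S Y1 Y2"
  let ?B1 = "Fo (pull H1 g1) A1" and ?B2 = "Fo (pull H1 g2) A2"
  let ?RA1 = "Fo (mor R Y1) A1" and ?RA2 = "Fo (mor R Y2) A2"
  let ?A = "Fo (tens E1 Y1 Y2) (A1, A2)"
  let ?RA = "Fo (tens E2 Y1 Y2) (?RA1, ?RA2)"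
  note gf = Comp_Hom[OF f(1) g(1)] Comp_Hom[OF f(2) g(2)]
  note O = Hom_Obj[OF gf(1)] Hom_Obj[OF gf(2)] Hom_Obj[OF g(1)] Hom_Obj[OF g(2)]
  note pf = prod_arr_Hom[OF f] and pg = prod_arr_Hom[OF g]
  note pgf = Comp_Hom[OF pf pg]
  note peq = prod_arr_Comp[OF f g]
  note PO = Hom_Obj[OF pf] Hom_Obj[OF pg]
  note B = functor_Obj[OF H1.pull_functor[OF g(1)] A(1)] functor_Obj[OF H1.pull_functor[OF g(2)] A(2)]
  note RA = functor_Obj[OF mor_functor[OF O(2)] A(1)] functor_Obj[OF mor_functor[OF O(4)] A(2)]
  have AO: "?A \<in> Obj (fib H1 ?Y)" and RAO: "?RA \<in> Obj (fib H2 ?Y)"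
    using functor_Obj[OF E1.tens_functor[OF O(2,4)], of "(A1, A2)"]
      functor_Obj[OF E2.tens_functor[OF O(2,4)], of "(?RA1, ?RA2)"] A RA by auto
  have BO: "Fo (tens E1 X1 X2) (?B1, ?B2) \<in> Obj (fib H1 ?X)"
    using functor_Obj[OF E1.tens_functor[OF O(5,7)], of "(?B1, ?B2)"] B by auto
  note gA = functor_Obj[OF H1.pull_functor[OF pg] AO]
  interpret T: category "fib H2 ?T"
    using H2.fib_category[OF PO(1)] .
  note t = E2.tens_functor[OF O(1,3)]
  note pullf = H2.pull_functor[OF pf]
  note RT = mor_functor[OF PO(1)]
  note rhoA = rho_Hom[OF O(2,4) A]
  note thg = theta_Hom[OF g(1) A(1)] theta_Hom[OF g(2) A(2)]
  note c1 = H1.conn_Hom[OF f(1) g(1) A(1)] H1.conn_Hom[OF f(2) g(2) A(2)]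
  note c2 = H2.conn_Hom[OF f(1) g(1) RA(1)] H2.conn_Hom[OF f(2) g(2) RA(2)]
  note thgf = theta_Hom[OF gf(1) A(1)] theta_Hom[OF gf(2) A(2)]
  note thf = theta_Hom[OF f(1) B(1)] theta_Hom[OF f(2) B(2)]
  note m1g = E1.mon_Hom[OF g A] and m2g = E2.mon_Hom[OF g RA]
  note R1 = mor_functor[OF O(1)] mor_functor[OF O(3)]
  note gfA = functor_Obj[OF H1.pull_functor[OF gf(1)] A(1)] functor_Obj[OF H1.pull_functor[OF gf(2)] A(2)]
  have fthg: "Fa (pull H2 f1) (theta R g1 A1)
      \<in> Hom (fib H2 T1) (Fo (pull H2 f1) (Fo (pull H2 g1) ?RA1)) (Fo (pull H2 f1) (Fo (mor R X1) ?B1))"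
    "Fa (pull H2 f2) (theta R g2 A2)
      \<in> Hom (fib H2 T2) (Fo (pull H2 f2) (Fo (pull H2 g2) ?RA2)) (Fo (pull H2 f2) (Fo (mor R X2) ?B2))"
    using functor_Hom[OF H2.pull_functor[OF f(1)] thg(1)]
      functor_Hom[OF H2.pull_functor[OF f(2)] thg(2)] by auto
  have hexagon_g: "Fa (pull H2 ?f) (theta R ?g ?A)
      \<cdot>\<^bsub>fib H2 ?T\<^esub> Fa (pull H2 ?f) (Fa (pull H2 ?g) (\<rho> Y1 Y2 (A1, A2)))
      \<cdot>\<^bsub>fib H2 ?T\<^esub> Fa (pull H2 ?f) (mon E2 g1 g2 (?RA1, ?RA2))
    = Fa (pull H2 ?f) (Fa (mor R ?X) (mon E1 g1 g2 (A1, A2)))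
      \<cdot>\<^bsub>fib H2 ?T\<^esub> Fa (pull H2 ?f) (\<rho> X1 X2 (?B1, ?B2))
      \<cdot>\<^bsub>fib H2 ?T\<^esub> Fa (pull H2 ?f) (Fa (tens E2 X1 X2) (theta R g1 A1, theta R g2 A2))"
    using cg[unfolded compatible_iff[OF g]]
      functor_Comp3[OF H2.fib_category[OF PO(2)] pullf m2g functor_Hom[OF H2.pull_functor[OF pg] rhoA]
        theta_Hom[OF pg AO]]
      functor_Comp3[OF H2.fib_category[OF PO(2)] pullf
        bifunctor_Hom[OF E2.tens_functor[OF O(5,7)] thg] rho_Hom[OF O(5,7) B]
        functor_Hom[OF mor_functor[OF PO(2)] m1g]]
    by simp
  have theta_tens: "Fa (tens E2 T1 T2) (theta R f1 ?B1, theta R f2 ?B2)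
      \<cdot>\<^bsub>fib H2 ?T\<^esub> Fa (tens E2 T1 T2)
          (Fa (pull H2 f1) (theta R g1 A1), Fa (pull H2 f2) (theta R g2 A2))
      \<cdot>\<^bsub>fib H2 ?T\<^esub> Fa (tens E2 T1 T2) (conn H2 f1 g1 ?RA1, conn H2 f2 g2 ?RA2)
    = Fa (tens E2 T1 T2) (Fa (mor R T1) (conn H1 f1 g1 A1), Fa (mor R T2) (conn H1 f2 g2 A2))
      \<cdot>\<^bsub>fib H2 ?T\<^esub> Fa (tens E2 T1 T2) (theta R (g1 \<cdot> f1) A1, theta R (g2 \<cdot> f2) A2)"
    using bifunctor_Comp[OF t c2(1) fthg(1) c2(2) fthg(2)]
      bifunctor_Comp[OF t category.Comp_Hom[OF H2.fib_category[OF O(1)] c2(1) fthg(1)] thf(1)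
        category.Comp_Hom[OF H2.fib_category[OF O(3)] c2(2) fthg(2)] thf(2)]
      bifunctor_Comp[OF t thgf(1) functor_Hom[OF R1(1) c1(1)] thgf(2) functor_Hom[OF R1(2) c1(2)]]
      theta_comp[OF f(1) g(1) A(1)] theta_comp[OF f(2) g(2) A(2)]
    by simp
  have mon_R: "Fa (mor R ?T) (Fa (pull H1 ?f) (mon E1 g1 g2 (A1, A2)))
      \<cdot>\<^bsub>fib H2 ?T\<^esub> Fa (mor R ?T) (mon E1 f1 f2 (?B1, ?B2))
      \<cdot>\<^bsub>fib H2 ?T\<^esub> Fa (mor R ?T) (Fa (tens E1 T1 T2) (conn H1 f1 g1 A1, conn H1 f2 g2 A2))
    = Fa (mor R ?T) (conn H1 ?f ?g ?A) \<cdot>\<^bsub>fib H2 ?T\<^esub> Fa (mor R ?T) (mon E1 (g1 \<cdot> f1) (g2 \<cdot> f2) (A1, A2))"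
    using E1.mon_comp[OF f g A] functor_Comp[OF RT E1.mon_Hom[OF gf A, unfolded peq] H1.conn_Hom[OF pf pg AO]]
      functor_Comp3[OF H1.fib_category[OF PO(1)] RT bifunctor_Hom[OF E1.tens_functor[OF O(1,3)] c1]
        E1.mon_Hom[OF f B] functor_Hom[OF H1.pull_functor[OF pf] m1g]]
    by simp
  show ?thesis
    unfolding compatible_iff[OF gf] peq
    by (rule T.hexagon_pasting[OF
          bifunctor_Hom[OF t c2]
          E2.mon_Hom[OF gf RA, unfolded peq]
          functor_Hom[OF H2.pull_functor[OF pgf] rhoA]
          theta_Hom[OF pgf AO]
          bifunctor_Hom[OF t thgf]
          rho_Hom[OF O(1,3) gfA]
          functor_Hom[OF RT E1.mon_Hom[OF gf A, unfolded peq]]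
          functor_Hom[OF RT H1.conn_Hom[OF pf pg AO]]
          H2.conn_Hom[OF pf pg functor_Obj[OF mor_functor[OF PO(4)] AO]]
          functor_Hom[OF pullf theta_Hom[OF pg AO]]
          theta_Hom[OF pf gA]
          H2.conn_Hom[OF pf pg RAO]
          functor_Hom[OF pullf functor_Hom[OF H2.pull_functor[OF pg] rhoA]]
          E2.mon_Hom[OF f functor_Obj[OF H2.pull_functor[OF g(1)] RA(1)]
            functor_Obj[OF H2.pull_functor[OF g(2)] RA(2)]]
          functor_Hom[OF pullf m2g]
          functor_Hom[OF pullf bifunctor_Hom[OF E2.tens_functor[OF O(5,7)] thg]]
          functor_Hom[OF pullf rho_Hom[OF O(5,7) B]]
          functor_Hom[OF pullf functor_Hom[OF mor_functor[OF PO(2)] m1g]]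
          theta_Hom[OF pf BO]
          functor_Hom[OF RT functor_Hom[OF H1.pull_functor[OF pf] m1g]]
          bifunctor_Hom[OF t fthg]
          E2.mon_Hom[OF f functor_Obj[OF mor_functor[OF O(5)] B(1)]
            functor_Obj[OF mor_functor[OF O(7)] B(2)]]
          bifunctor_Hom[OF t thf]
          rho_Hom[OF O(1,3) functor_Obj[OF H1.pull_functor[OF f(1)] B(1)]
            functor_Obj[OF H1.pull_functor[OF f(2)] B(2)]]
          functor_Hom[OF RT E1.mon_Hom[OF f B]]
          bifunctor_Hom[OF t functor_Hom[OF R1(1) c1(1)] functor_Hom[OF R1(2) c1(2)]]
          functor_Hom[OF RT bifunctor_Hom[OF E1.tens_functor[OF O(1,3)] c1]]
          functor_is_iso[OF H1.fib_category[OF PO(1)] T.category_axioms RT H1.conn_is_iso[OF pf pg AO]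
            H1.conn_Hom[OF pf pg AO]]
          theta_comp[OF pf pg AO]
          H2.conn_natural[OF pf pg rhoA, symmetric]
          E2.mon_comp[OF f g RA, unfolded peq]
          hexagon_g
          theta_natural[OF pf m1g]
          E2.mon_natural[OF f thg]
          cf[unfolded compatible_iff[OF f]]
          theta_tens
          rho_natural[OF O(1,3) c1]
          mon_R])
qed

text \<open>Both sides of the hexagon are natural transformations with values in \<open>R (z\<^sup>*(A\<^sub>1 \<boxtimes> A\<^sub>2))\<close> for
\<open>z = z\<^sub>1 \<times> z\<^sub>2\<close>. Under the isomorphism \<open>m\<close> the effect of the units on \<open>z\<^sup>*(A\<^sub>1 \<boxtimes> A\<^sub>2)\<close> is the tensor product of the
maps \<open>z\<^sub>i\<^sup>*\<eta>\<close>, which are invertible. Two natural transformations that agree at the target of an arrow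
agree at its source if their common target functor sends the arrow to a monomorphism.\<close>

lemma compatible_if_at_units:
  assumes z: "z1 \<in> Hom S Z1 X1" "z2 \<in> Hom S Z2 X2"
    and stars: "has_star S H1 z1" "has_star S H1 z2"
    and ff: "fully_faithful (fib H1 Z1) (fib H1 X1) (star S H1 z1)"
      "fully_faithful (fib H1 Z2) (fib H1 X2) (star S H1 z2)"
    and A: "A1 \<in> Obj (fib H1 X1)" "A2 \<in> Obj (fib H1 X2)"
    and c: "compatible z1 z2 (Fo (star S H1 z1) (Fo (pull H1 z1) A1))
      (Fo (star S H1 z2) (Fo (pull H1 z2) A2))"
  shows "compatible z1 z2 A1 A2"
proof -
  let ?z = "prod_arr S z1 z2" and ?Z = "Prod S Z1 Z2"
  note O = Hom_Obj[OF z(1)] Hom_Obj[OF z(2)]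
  note pz = prod_arr_Hom[OF z]
  note PO = Hom_Obj[OF pz]
  interpret A1: adjoint_pair "fib H1 X1" "fib H1 Z1" "pull H1 z1" "star S H1 z1" "star_unit S H1 z1"
      "star_counit S H1 z1"
    using H1.star_adjoint_pair[OF stars(1) z(1) O(1,2)] .
  interpret A2: adjoint_pair "fib H1 X2" "fib H1 Z2" "pull H1 z2" "star S H1 z2" "star_unit S H1 z2"
      "star_counit S H1 z2"
    using H1.star_adjoint_pair[OF stars(2) z(2) O(3,4)] .
  interpret Z: category "fib H1 ?Z"
    using H1.fib_category[OF PO(1)] .
  interpret Z2: category "fib H2 ?Z"
    using H2.fib_category[OF PO(1)] .
  let ?B1 = "Fo (star S H1 z1) (Fo (pull H1 z1) A1)" and ?B2 = "Fo (star S H1 z2) (Fo (pull H1 z2) A2)"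
  note u = A1.unit_Hom[OF A(1)] A2.unit_Hom[OF A(2)]
  note B = A1.C.Hom_Obj(2)[OF u(1)] A2.C.Hom_Obj(2)[OF u(2)]
  note zu = functor_Hom[OF A1.left_functor u(1)] functor_Hom[OF A2.left_functor u(2)]
  let ?i = "Fa (pull H1 ?z) (Fa (tens E1 X1 X2) (star_unit S H1 z1 A1, star_unit S H1 z2 A2))"
  note i = functor_Hom[OF H1.pull_functor[OF pz] bifunctor_Hom[OF E1.tens_functor[OF O(2,4)] u]]
  have "is_iso (fib H1 ?Z) (Fa (tens E1 Z1 Z2)
      (Fa (pull H1 z1) (star_unit S H1 z1 A1), Fa (pull H1 z2) (star_unit S H1 z2 A2)))"
    using bifunctor_is_iso[OF A1.D.category_axioms A2.D.category_axioms Z.category_axioms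
        E1.tens_functor[OF O(1,3)] A1.left_unit_is_iso[OF ff(1) A(1)]
        A2.left_unit_is_iso[OF ff(2) A(2)] zu] .
  then have "is_iso (fib H1 ?Z) (?i \<cdot>\<^bsub>fib H1 ?Z\<^esub> mon E1 z1 z2 (A1, A2))"
    unfolding E1.mon_natural[OF z u]
    using Z.is_iso_Comp[OF _ E1.mon_is_iso[OF z B]
        bifunctor_Hom[OF E1.tens_functor[OF O(1,3)] zu] E1.mon_Hom[OF z B]] by blast
  then have "is_iso (fib H1 ?Z) ?i"
    using Z.is_iso_left_factor[OF _ E1.mon_is_iso[OF z A] E1.mon_Hom[OF z A] i] by blast
  then have iso: "is_iso (fib H2 ?Z) (Fa (mor R ?Z) ?i)"
    using functor_is_iso[OF Z.category_axioms Z2.category_axioms mor_functor[OF PO(1)] _ i] by blast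
  let ?u = "(star_unit S H1 z1 A1, star_unit S H1 z2 A2)"
  have u': "?u \<in> Hom (prod_cat (fib H1 X1) (fib H1 X2)) (A1, A2) (?B1, ?B2)"
    and A': "(A1, A2) \<in> Obj (prod_cat (fib H1 X1) (fib H1 X2))"
    using u A by auto
  note n = nat_trans_theta_rho_mon[OF z] nat_trans_mon_rho_theta[OF z]
  show ?thesis
    unfolding compatible_def
    using Z2.is_iso_mono[OF iso functor_Hom[OF mor_functor[OF PO(1)] i]
        nat_trans_Hom[OF n(1) A', unfolded comp_func_def prod_func_def, simplified]
        nat_trans_Hom[OF n(2) A', unfolded comp_func_def prod_func_def, simplified]]
      nat_trans_natural[OF n(1) u'] nat_trans_natural[OF n(2) u'] c
    unfolding compatible_def by (simp add: comp_func_def)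
qed

text \<open>Let \<open>z = z\<^sub>1 \<times> z\<^sub>2\<close>. After moving the inverse exchange maps to the other sides, both sides of the
condition on direct images are arrows \<open>R(z\<^sub>1\<^sub>*A\<^sub>1) \<boxtimes> R(z\<^sub>2\<^sub>*A\<^sub>2) \<rightarrow> z\<^sub>* R(A\<^sub>1 \<boxtimes> A\<^sub>2)\<close>, and they are equal if
and only if their left transposes are. These are \<open>R(\<epsilon> \<boxtimes> \<epsilon>) \<cdot> \<rho> \<cdot> (\<theta> \<boxtimes> \<theta>) \<cdot> m\<^sub>2\<^sup>-\<^sup>1\<close> and
\<open>R(\<epsilon> \<boxtimes> \<epsilon>) \<cdot> R(m\<^sub>1)\<^sup>-\<^sup>1 \<cdot> \<theta> \<cdot> z\<^sup>*\<rho>\<close>, that is, the two sides of the hexagon at the direct images with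
\<open>m\<^sub>1\<close> and \<open>m\<^sub>2\<close> moved across, followed by an invertible arrow.\<close>

lemma rho_star_iff_compatible:
  assumes z: "z1 \<in> Hom S Z1 X1" "z2 \<in> Hom S Z2 X2"
    and stars1: "has_star S H1 z1" "has_star S H1 z2" "has_star S H1 (prod_arr S z1 z2)"
    and stars2: "has_star S H2 z1" "has_star S H2 z2" "has_star S H2 (prod_arr S z1 z2)"
    and A: "A1 \<in> Obj (fib H1 Z1)" "A2 \<in> Obj (fib H1 Z2)"
    and counits: "is_iso (fib H1 Z1) (star_counit S H1 z1 A1)"
      "is_iso (fib H1 Z2) (star_counit S H1 z2 A2)"
    and bars: "is_iso (fib H2 X1) (theta_bar S H1 H2 R z1 A1)"
      "is_iso (fib H2 X2) (theta_bar S H1 H2 R z2 A2)"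
      "is_iso (fib H2 (Prod S X1 X2))
        (theta_bar S H1 H2 R (prod_arr S z1 z2) (Fo (tens E1 Z1 Z2) (A1, A2)))"
  shows "inv_arr (fib H2 (Prod S X1 X2))
          (theta_bar S H1 H2 R (prod_arr S z1 z2) (Fo (tens E1 Z1 Z2) (A1, A2)))
        \<cdot>\<^bsub>fib H2 (Prod S X1 X2)\<^esub> Fa (star S H2 (prod_arr S z1 z2)) (\<rho> Z1 Z2 (A1, A2))
        \<cdot>\<^bsub>fib H2 (Prod S X1 X2)\<^esub> mon_bar S H2 E2 z1 z2 (Fo (mor R Z1) A1, Fo (mor R Z2) A2)
      = Fa (mor R (Prod S X1 X2)) (mon_bar S H1 E1 z1 z2 (A1, A2))
        \<cdot>\<^bsub>fib H2 (Prod S X1 X2)\<^esub> \<rho> X1 X2 (Fo (star S H1 z1) A1, Fo (star S H1 z2) A2)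
        \<cdot>\<^bsub>fib H2 (Prod S X1 X2)\<^esub>
          Fa (tens E2 X1 X2) (inv_arr (fib H2 X1) (theta_bar S H1 H2 R z1 A1),
                              inv_arr (fib H2 X2) (theta_bar S H1 H2 R z2 A2))
    \<longleftrightarrow> compatible z1 z2 (Fo (star S H1 z1) A1) (Fo (star S H1 z2) A2)"
    (is "inv_arr _ ?bar \<cdot>\<^bsub>_\<^esub> ?starrho \<cdot>\<^bsub>_\<^esub> ?m2bar = ?Rm1bar \<cdot>\<^bsub>_\<^esub> ?rho \<cdot>\<^bsub>_\<^esub> _ \<longleftrightarrow> _")
proof -
  let ?z = "prod_arr S z1 z2" and ?Z = "Prod S Z1 Z2" and ?X = "Prod S X1 X2"
  note O = Hom_Obj[OF z(1)] Hom_Obj[OF z(2)]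
  note pz = prod_arr_Hom[OF z]
  note PO = Hom_Obj[OF pz]
  interpret M1: tensor_over_base S H1 E1
    by unfold_locales
  interpret M2: tensor_over_base S H2 E2
    by unfold_locales
  interpret A1: adjoint_pair "fib H1 X1" "fib H1 Z1" "pull H1 z1" "star S H1 z1" "star_unit S H1 z1"
      "star_counit S H1 z1"
    using H1.star_adjoint_pair[OF stars1(1) z(1) O(1,2)] .
  interpret A2: adjoint_pair "fib H1 X2" "fib H1 Z2" "pull H1 z2" "star S H1 z2" "star_unit S H1 z2"
      "star_counit S H1 z2"
    using H1.star_adjoint_pair[OF stars1(2) z(2) O(3,4)] .
  interpret P1: adjoint_pair "fib H1 ?X" "fib H1 ?Z" "pull H1 ?z" "star S H1 ?z" "star_unit S H1 ?z"
      "star_counit S H1 ?z"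
    using H1.star_adjoint_pair[OF stars1(3) pz PO] .
  interpret B1: adjoint_pair "fib H2 X1" "fib H2 Z1" "pull H2 z1" "star S H2 z1" "star_unit S H2 z1"
      "star_counit S H2 z1"
    using H2.star_adjoint_pair[OF stars2(1) z(1) O(1,2)] .
  interpret B2: adjoint_pair "fib H2 X2" "fib H2 Z2" "pull H2 z2" "star S H2 z2" "star_unit S H2 z2"
      "star_counit S H2 z2"
    using H2.star_adjoint_pair[OF stars2(2) z(2) O(3,4)] .
  interpret P: adjoint_pair "fib H2 ?X" "fib H2 ?Z" "pull H2 ?z" "star S H2 ?z" "star_unit S H2 ?z"
      "star_counit S H2 ?z"
    using H2.star_adjoint_pair[OF stars2(3) pz PO] .
  let ?zA1 = "Fo (star S H1 z1) A1" and ?zA2 = "Fo (star S H1 z2) A2"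
  let ?A = "Fo (tens E1 Z1 Z2) (A1, A2)"
  let ?RA1 = "Fo (mor R Z1) A1" and ?RA2 = "Fo (mor R Z2) A2"
  let ?bar1 = "theta_bar S H1 H2 R z1 A1" and ?bar2 = "theta_bar S H1 H2 R z2 A2"
  note zA = functor_Obj[OF A1.right_functor A(1)] functor_Obj[OF A2.right_functor A(2)]
  note RA = functor_Obj[OF mor_functor[OF O(1)] A(1)] functor_Obj[OF mor_functor[OF O(3)] A(2)]
  note RzA = functor_Obj[OF mor_functor[OF O(2)] zA(1)] functor_Obj[OF mor_functor[OF O(4)] zA(2)]
  note zzA = functor_Obj[OF A1.left_functor zA(1)] functor_Obj[OF A2.left_functor zA(2)]
  have AO: "?A \<in> Obj (fib H1 ?Z)"
    using functor_Obj[OF E1.tens_functor[OF O(1,3)], of "(A1, A2)"] A by auto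
  have RRO: "Fo (tens E2 Z1 Z2) (?RA1, ?RA2) \<in> Obj (fib H2 ?Z)"
    using functor_Obj[OF E2.tens_functor[OF O(1,3)], of "(?RA1, ?RA2)"] RA by auto
  note RAO = functor_Obj[OF mor_functor[OF PO(1)] AO]
  note tX = E2.tens_functor[OF O(2,4)] and tZ = E2.tens_functor[OF O(1,3)]
  note tZ1 = E1.tens_functor[OF O(1,3)]
  note RZ = mor_functor[OF PO(1)] and RX = mor_functor[OF PO(2)]
  note bar1 = theta_bar_Hom[OF z(1) stars1(1) stars2(1) A(1)]
    and bar2 = theta_bar_Hom[OF z(2) stars1(2) stars2(2) A(2)]
    and bar = theta_bar_Hom[OF pz stars1(3) stars2(3) AO]
  note rhoZ = rho_Hom[OF O(1,3) A] and rhoX = rho_Hom[OF O(2,4) zA]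
  note m1bar = M1.mon_bar_Hom[OF z stars1 A] and m2bar = M2.mon_bar_Hom[OF z stars2 RA]
  note starrho = functor_Hom[OF P.right_functor rhoZ]
  note Rm1bar = functor_Hom[OF RX m1bar]
  note bars_tens = bifunctor_Hom[OF tX bar1 bar2]
  note bars_iso = bifunctor_is_iso[OF B1.C.category_axioms B2.C.category_axioms P.C.category_axioms tX
      bars(1,2) bar1 bar2]
  let ?bars = "Fa (tens E2 X1 X2) (?bar1, ?bar2)"
  let ?L = "?starrho \<cdot>\<^bsub>fib H2 ?X\<^esub> ?m2bar \<cdot>\<^bsub>fib H2 ?X\<^esub> ?bars"
  let ?M = "?bar \<cdot>\<^bsub>fib H2 ?X\<^esub> ?Rm1bar \<cdot>\<^bsub>fib H2 ?X\<^esub> ?rho"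
  note L = P.C.Comp_Hom[OF P.C.Comp_Hom[OF bars_tens m2bar] starrho]
    and M = P.C.Comp_Hom[OF P.C.Comp_Hom[OF rhoX Rm1bar] bar]
  let ?\<epsilon> = "star_counit S H2 ?z (Fo (mor R ?Z) ?A)"

  note c1 = A1.counit_Hom[OF A(1)] and c2 = A2.counit_Hom[OF A(2)]
  note d1 = B1.counit_Hom[OF RA(1)] and d2 = B2.counit_Hom[OF RA(2)]
  note ts = theta_Hom[OF z(1) zA(1)] theta_Hom[OF z(2) zA(2)]
  let ?m1 = "mon E1 z1 z2 (?zA1, ?zA2)" and ?m2 = "mon E2 z1 z2 (Fo (mor R X1) ?zA1, Fo (mor R X2) ?zA2)"
  let ?m2' = "mon E2 z1 z2 (Fo (star S H2 z1) ?RA1, Fo (star S H2 z2) ?RA2)"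
  let ?c = "Fa (tens E1 Z1 Z2) (star_counit S H1 z1 A1, star_counit S H1 z2 A2)"
  let ?d = "Fa (tens E2 Z1 Z2) (star_counit S H2 z1 ?RA1, star_counit S H2 z2 ?RA2)"
  let ?t = "Fa (tens E2 Z1 Z2) (theta R z1 ?zA1, theta R z2 ?zA2)"
  let ?rho' = "\<rho> Z1 Z2 (Fo (pull H1 z1) ?zA1, Fo (pull H1 z2) ?zA2)"
  let ?zbars = "Fa (tens E2 Z1 Z2) (Fa (pull H2 z1) ?bar1, Fa (pull H2 z2) ?bar2)"
  let ?thz = "theta R ?z (Fo (tens E1 X1 X2) (?zA1, ?zA2))"
  note m1 = E1.mon_Hom[OF z zA] E1.mon_is_iso[OF z zA]
  note m2 = E2.mon_Hom[OF z RzA] E2.mon_is_iso[OF z RzA]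
  note sRA = functor_Obj[OF B1.right_functor RA(1)] functor_Obj[OF B2.right_functor RA(2)]
  note m2' = E2.mon_Hom[OF z sRA] E2.mon_is_iso[OF z sRA]
  note im1 = P1.D.is_iso_Hom(1)[OF m1(2,1)] and im2 = P.D.is_iso_Hom(1)[OF m2(2,1)]
    and im2' = P.D.is_iso_Hom(1)[OF m2'(2,1)]
  note c = bifunctor_Hom[OF tZ1 c1 c2] and d = bifunctor_Hom[OF tZ d1 d2]
  note Rc = functor_Hom[OF RZ c]
  note Rc1 = functor_Hom[OF mor_functor[OF O(1)] c1] and Rc2 = functor_Hom[OF mor_functor[OF O(3)] c2]
  note RcRc = bifunctor_Hom[OF tZ Rc1 Rc2]
  note t = bifunctor_Hom[OF tZ ts]
  note zb1 = functor_Hom[OF B1.left_functor bar1] and zb2 = functor_Hom[OF B2.left_functor bar2]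
  note zbars = bifunctor_Hom[OF tZ zb1 zb2]
  note zbars' = functor_Hom[OF P.left_functor bars_tens]
  note zrho = functor_Hom[OF P.left_functor rhoX]
  have zAO: "Fo (tens E1 X1 X2) (?zA1, ?zA2) \<in> Obj (fib H1 ?X)"
    using functor_Obj[OF E1.tens_functor[OF O(2,4)], of "(?zA1, ?zA2)"] zA by auto
  note thz = theta_Hom[OF pz zAO]
  note szA = functor_Obj[OF P1.right_functor AO]
  note rho' = rho_Hom[OF O(1,3) zzA]
  note Rm1 = functor_Hom[OF RZ m1(1)] and Rim1 = functor_Hom[OF RZ im1]
  note Rm1_iso = functor_is_iso[OF P1.D.category_axioms P.D.category_axioms RZ m1(2,1)]
    functor_inv_arr[OF P1.D.category_axioms P.D.category_axioms RZ m1(2,1)]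
  note pm1bar = functor_Hom[OF P1.left_functor m1bar]
  note Rcz = functor_Hom[OF RZ P1.counit_Hom[OF AO]]

  \<comment> \<open>The transpose of the side through \<open>\<rho>\<close> on \<open>Z\<^sub>1 \<times> Z\<^sub>2\<close>: the transposed exchange maps
    turn the counits of \<open>H2\<close> into those of \<open>H1\<close>, which naturality moves to the left of \<open>\<rho>\<close>.\<close>
  have L_eq: "?\<epsilon> \<cdot>\<^bsub>fib H2 ?Z\<^esub> Fa (pull H2 ?z) ?L
      = Fa (mor R ?Z) ?c \<cdot>\<^bsub>fib H2 ?Z\<^esub> (?rho' \<cdot>\<^bsub>fib H2 ?Z\<^esub> ?t) \<cdot>\<^bsub>fib H2 ?Z\<^esub> inv_arr (fib H2 ?Z) ?m2"
  proof -
    note e = P.counit_Hom[OF RAO]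
    note zsr = functor_Hom[OF P.left_functor starrho]
    note zm = functor_Hom[OF P.left_functor m2bar]
    note simps = P.D.normalize zsr[unfolded Hom_def, simplified] zm[unfolded Hom_def, simplified]
      e[unfolded Hom_def, simplified] zbars'[unfolded Hom_def, simplified]
      P.counit_Hom[OF RRO, unfolded Hom_def, simplified]
      rhoZ[unfolded Hom_def, simplified] d[unfolded Hom_def, simplified]
      zbars[unfolded Hom_def, simplified] im2[unfolded Hom_def, simplified]
      im2'[unfolded Hom_def, simplified] RcRc[unfolded Hom_def, simplified]
      t[unfolded Hom_def, simplified] rho'[unfolded Hom_def, simplified] Rc[unfolded Hom_def, simplified]
    let ?e' = "star_counit S H2 ?z (Fo (tens E2 Z1 Z2) (?RA1, ?RA2))"
    have "?\<epsilon> \<cdot>\<^bsub>fib H2 ?Z\<^esub> Fa (pull H2 ?z) ?L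
        = (?\<epsilon> \<cdot>\<^bsub>fib H2 ?Z\<^esub> Fa (pull H2 ?z) ?starrho) \<cdot>\<^bsub>fib H2 ?Z\<^esub> Fa (pull H2 ?z) ?m2bar
          \<cdot>\<^bsub>fib H2 ?Z\<^esub> Fa (pull H2 ?z) ?bars"
      using functor_Comp3[OF P.C.category_axioms P.left_functor bars_tens m2bar starrho]
      by (simp add: simps)
    also have "\<dots> = \<rho> Z1 Z2 (A1, A2) \<cdot>\<^bsub>fib H2 ?Z\<^esub> (?e' \<cdot>\<^bsub>fib H2 ?Z\<^esub> Fa (pull H2 ?z) ?m2bar)
          \<cdot>\<^bsub>fib H2 ?Z\<^esub> Fa (pull H2 ?z) ?bars"
      using P.counit_natural[OF rhoZ, symmetric] by (simp add: simps)
    also have "\<dots> = \<rho> Z1 Z2 (A1, A2) \<cdot>\<^bsub>fib H2 ?Z\<^esub> ?d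
          \<cdot>\<^bsub>fib H2 ?Z\<^esub> (inv_arr (fib H2 ?Z) ?m2' \<cdot>\<^bsub>fib H2 ?Z\<^esub> Fa (pull H2 ?z) ?bars)"
      unfolding M2.mon_bar_transpose[OF z stars2 RA] by (simp add: simps)
    also have "inv_arr (fib H2 ?Z) ?m2' \<cdot>\<^bsub>fib H2 ?Z\<^esub> Fa (pull H2 ?z) ?bars
        = ?zbars \<cdot>\<^bsub>fib H2 ?Z\<^esub> inv_arr (fib H2 ?Z) ?m2"
      using P.D.inv_square_iff[OF m2(2) m2'(2) m2(1) m2'(1) zbars' zbars]
        E2.mon_natural[OF z bar1 bar2] by blast
    also have "\<rho> Z1 Z2 (A1, A2) \<cdot>\<^bsub>fib H2 ?Z\<^esub> ?d \<cdot>\<^bsub>fib H2 ?Z\<^esub> \<dots>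
        = \<rho> Z1 Z2 (A1, A2) \<cdot>\<^bsub>fib H2 ?Z\<^esub> (?d \<cdot>\<^bsub>fib H2 ?Z\<^esub> ?zbars)
          \<cdot>\<^bsub>fib H2 ?Z\<^esub> inv_arr (fib H2 ?Z) ?m2"
      by (simp add: simps)
    also have "?d \<cdot>\<^bsub>fib H2 ?Z\<^esub> ?zbars = Fa (tens E2 Z1 Z2)
        (Fa (mor R Z1) (star_counit S H1 z1 A1), Fa (mor R Z2) (star_counit S H1 z2 A2))
        \<cdot>\<^bsub>fib H2 ?Z\<^esub> ?t"
      using bifunctor_Comp[OF tZ zb1 d1 zb2 d2] bifunctor_Comp[OF tZ ts(1) Rc1 ts(2) Rc2]
        theta_bar_transpose[OF z(1) stars1(1) stars2(1) A(1)]
        theta_bar_transpose[OF z(2) stars1(2) stars2(2) A(2)] by simp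
    also have "\<rho> Z1 Z2 (A1, A2) \<cdot>\<^bsub>fib H2 ?Z\<^esub> (\<dots>) \<cdot>\<^bsub>fib H2 ?Z\<^esub> inv_arr (fib H2 ?Z) ?m2
        = (\<rho> Z1 Z2 (A1, A2) \<cdot>\<^bsub>fib H2 ?Z\<^esub> Fa (tens E2 Z1 Z2)
        (Fa (mor R Z1) (star_counit S H1 z1 A1), Fa (mor R Z2) (star_counit S H1 z2 A2)))
        \<cdot>\<^bsub>fib H2 ?Z\<^esub> ?t \<cdot>\<^bsub>fib H2 ?Z\<^esub> inv_arr (fib H2 ?Z) ?m2"
      by (simp add: simps)
    also have "\<dots> = Fa (mor R ?Z) ?c \<cdot>\<^bsub>fib H2 ?Z\<^esub> (?rho' \<cdot>\<^bsub>fib H2 ?Z\<^esub> ?t)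
        \<cdot>\<^bsub>fib H2 ?Z\<^esub> inv_arr (fib H2 ?Z) ?m2"
      unfolding rho_natural[OF O(1,3) c1 c2, symmetric] by (simp add: simps)
    finally show ?thesis .
  qed
  \<comment> \<open>The transpose of the side through \<open>\<rho>\<close> on \<open>X\<^sub>1 \<times> X\<^sub>2\<close>: the transposed exchange map of \<open>R\<close> comes
    first, then naturality of \<open>\<theta>\<close> brings out the transposed exchange map of \<open>\<boxtimes>\<^sub>1\<close>.\<close>
  have M_eq: "?\<epsilon> \<cdot>\<^bsub>fib H2 ?Z\<^esub> Fa (pull H2 ?z) ?M
      = Fa (mor R ?Z) ?c \<cdot>\<^bsub>fib H2 ?Z\<^esub> inv_arr (fib H2 ?Z) (Fa (mor R ?Z) ?m1)
        \<cdot>\<^bsub>fib H2 ?Z\<^esub> ?thz \<cdot>\<^bsub>fib H2 ?Z\<^esub> Fa (pull H2 ?z) ?rho"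
  proof -
    let ?cz = "star_counit S H1 ?z ?A"
    note zbar = functor_Hom[OF P.left_functor bar] and zRm = functor_Hom[OF P.left_functor Rm1bar]
    note simps = P.D.normalize P.counit_Hom[OF RAO, unfolded Hom_def, simplified]
      zbar[unfolded Hom_def, simplified] zRm[unfolded Hom_def, simplified]
      zrho[unfolded Hom_def, simplified] Rcz[unfolded Hom_def, simplified]
      theta_Hom[OF pz szA, unfolded Hom_def, simplified] thz[unfolded Hom_def, simplified]
      functor_Hom[OF RZ pm1bar, unfolded Hom_def, simplified] Rc[unfolded Hom_def, simplified]
      Rim1[unfolded Hom_def, simplified]
    have "?\<epsilon> \<cdot>\<^bsub>fib H2 ?Z\<^esub> Fa (pull H2 ?z) ?M
        = (?\<epsilon> \<cdot>\<^bsub>fib H2 ?Z\<^esub> Fa (pull H2 ?z) ?bar) \<cdot>\<^bsub>fib H2 ?Z\<^esub> Fa (pull H2 ?z) ?Rm1bar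
          \<cdot>\<^bsub>fib H2 ?Z\<^esub> Fa (pull H2 ?z) ?rho"
      using functor_Comp3[OF P.C.category_axioms P.left_functor rhoX Rm1bar bar] by (simp add: simps)
    also have "\<dots> = Fa (mor R ?Z) ?cz
          \<cdot>\<^bsub>fib H2 ?Z\<^esub> (theta R ?z (Fo (star S H1 ?z) ?A) \<cdot>\<^bsub>fib H2 ?Z\<^esub> Fa (pull H2 ?z) ?Rm1bar)
          \<cdot>\<^bsub>fib H2 ?Z\<^esub> Fa (pull H2 ?z) ?rho"
      unfolding theta_bar_transpose[OF pz stars1(3) stars2(3) AO] by (simp add: simps)
    also have "\<dots> = (Fa (mor R ?Z) ?cz
          \<cdot>\<^bsub>fib H2 ?Z\<^esub> Fa (mor R ?Z) (Fa (pull H1 ?z) (mon_bar S H1 E1 z1 z2 (A1, A2))))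
          \<cdot>\<^bsub>fib H2 ?Z\<^esub> ?thz \<cdot>\<^bsub>fib H2 ?Z\<^esub> Fa (pull H2 ?z) ?rho"
      unfolding theta_natural[OF pz m1bar, symmetric] by (simp add: simps)
    also have "Fa (mor R ?Z) ?cz
          \<cdot>\<^bsub>fib H2 ?Z\<^esub> Fa (mor R ?Z) (Fa (pull H1 ?z) (mon_bar S H1 E1 z1 z2 (A1, A2)))
        = Fa (mor R ?Z) ?c \<cdot>\<^bsub>fib H2 ?Z\<^esub> Fa (mor R ?Z) (inv_arr (fib H1 ?Z) ?m1)"
      using functor_Comp[OF RZ pm1bar P1.counit_Hom[OF AO]] functor_Comp[OF RZ im1 c]
        M1.mon_bar_transpose[OF z stars1 A] by simp
    finally show ?thesis
      unfolding Rm1_iso(2) by (simp add: simps)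
  qed

  have "inv_arr (fib H2 ?X) ?bar \<cdot>\<^bsub>fib H2 ?X\<^esub> ?starrho \<cdot>\<^bsub>fib H2 ?X\<^esub> ?m2bar
      = ?Rm1bar \<cdot>\<^bsub>fib H2 ?X\<^esub> ?rho \<cdot>\<^bsub>fib H2 ?X\<^esub>
          Fa (tens E2 X1 X2) (inv_arr (fib H2 X1) ?bar1, inv_arr (fib H2 X2) ?bar2)
    \<longleftrightarrow> inv_arr (fib H2 ?X) ?bar \<cdot>\<^bsub>fib H2 ?X\<^esub> (?starrho \<cdot>\<^bsub>fib H2 ?X\<^esub> ?m2bar)
      = (?Rm1bar \<cdot>\<^bsub>fib H2 ?X\<^esub> ?rho) \<cdot>\<^bsub>fib H2 ?X\<^esub> inv_arr (fib H2 ?X) ?bars"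
    using P.C.Comp_assoc[OF P.C.is_iso_Hom(1)[OF bars_iso bars_tens] rhoX Rm1bar]
      bifunctor_inv_arr[OF B1.C.category_axioms B2.C.category_axioms P.C.category_axioms tX
        bars(1,2) bar1 bar2] by simp
  also have "\<dots> \<longleftrightarrow> (?starrho \<cdot>\<^bsub>fib H2 ?X\<^esub> ?m2bar) \<cdot>\<^bsub>fib H2 ?X\<^esub> ?bars = ?M"
    using P.C.inv_square_iff[OF bars_iso bars(3) bars_tens bar P.C.Comp_Hom[OF m2bar starrho]
        P.C.Comp_Hom[OF rhoX Rm1bar]] .
  also have "\<dots> \<longleftrightarrow> ?L = ?M"
    using P.C.Comp_assoc[OF bars_tens m2bar starrho] by simp
  also have "\<dots> \<longleftrightarrow> ?\<epsilon> \<cdot>\<^bsub>fib H2 ?Z\<^esub> Fa (pull H2 ?z) ?L = ?\<epsilon> \<cdot>\<^bsub>fib H2 ?Z\<^esub> Fa (pull H2 ?z) ?M"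
    using P.left_transpose_inject[OF RAO L M] by auto
  also have "\<dots> \<longleftrightarrow> (?rho' \<cdot>\<^bsub>fib H2 ?Z\<^esub> ?t) \<cdot>\<^bsub>fib H2 ?Z\<^esub> inv_arr (fib H2 ?Z) ?m2
      = inv_arr (fib H2 ?Z) (Fa (mor R ?Z) ?m1) \<cdot>\<^bsub>fib H2 ?Z\<^esub> (?thz \<cdot>\<^bsub>fib H2 ?Z\<^esub> Fa (pull H2 ?z) ?rho)"
    unfolding L_eq M_eq
    using P.D.is_iso_mono[OF functor_is_iso[OF P1.D.category_axioms P.D.category_axioms RZ _ c] Rc
        P.D.Comp_Hom[OF im2 P.D.Comp_Hom[OF t rho']]
        P.D.Comp_Hom[OF P.D.Comp_Hom[OF zrho thz] P.D.is_iso_Hom(1)[OF Rm1_iso(1) Rm1]]]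
      bifunctor_is_iso[OF A1.D.category_axioms A2.D.category_axioms P1.D.category_axioms tZ1
        counits c1 c2] by auto
  also have "\<dots> \<longleftrightarrow> (?thz \<cdot>\<^bsub>fib H2 ?Z\<^esub> Fa (pull H2 ?z) ?rho) \<cdot>\<^bsub>fib H2 ?Z\<^esub> ?m2
      = Fa (mor R ?Z) ?m1 \<cdot>\<^bsub>fib H2 ?Z\<^esub> (?rho' \<cdot>\<^bsub>fib H2 ?Z\<^esub> ?t)"
    using P.D.inv_square_iff[OF m2(2) Rm1_iso(1) m2(1) Rm1 P.D.Comp_Hom[OF zrho thz]
        P.D.Comp_Hom[OF t rho']] by auto
  also have "\<dots> \<longleftrightarrow> compatible z1 z2 ?zA1 ?zA2"
    unfolding compatible_iff[OF z] using P.D.Comp_assoc[OF m2(1) zrho thz] by simp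
  finally show ?thesis .
qed

end


section \<open>Vanishing and the invertibility of the exchange maps\<close>

context additive_category
begin

lemma Zero_Hom:
  assumes "X \<in> Obj C" "Y \<in> Obj C"
  shows "Zero C X Y \<in> Hom C X Y"
proof -
  interpret G: comm_group "hom_group C X Y"
    using hom_comm_group[OF assms] .
  show ?thesis
    using G.one_closed by (simp add: hom_group_def)
qed

lemma Add_idem_Zero:
  assumes "f \<in> Hom C X Y" "Add C f f = f"
  shows "f = Zero C X Y"
proof -
  interpret G: comm_group "hom_group C X Y"
    using hom_comm_group[OF Hom_Obj[OF assms(1)]] .
  show ?thesis
    using G.l_cancel_one[of f f] assms by (simp add: hom_group_def)
qed

lemma Add_Zero_Zero:
  assumes "X \<in> Obj C" "Y \<in> Obj C"
  shows "Add C (Zero C X Y) (Zero C X Y) = Zero C X Y"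
proof -
  interpret G: comm_group "hom_group C X Y"
    using hom_comm_group[OF assms] .
  show ?thesis
    using G.l_one[OF G.one_closed] by (simp add: hom_group_def)
qed

lemma Zero_Comp:
  assumes "f \<in> Hom C X Y" "Z \<in> Obj C"
  shows "Zero C Y Z \<cdot> f = Zero C X Z"
proof -
  note O = Hom_Obj[OF assms(1)]
  note z = Zero_Hom[OF O(2) assms(2)]
  show ?thesis
    using Add_idem_Zero[OF Comp_Hom[OF assms(1) z]] Comp_Add_left[OF assms(1) z z]
      Add_Zero_Zero[OF O(2) assms(2)] by simp
qed

lemma Comp_Zero:
  assumes "f \<in> Hom C Y Z" "X \<in> Obj C"
  shows "f \<cdot> Zero C X Y = Zero C X Z"
proof -
  note O = Hom_Obj[OF assms(1)]
  note z = Zero_Hom[OF assms(2) O(1)]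
  show ?thesis
    using Add_idem_Zero[OF Comp_Hom[OF z assms(1)]] Comp_Add_right[OF z z assms(1)]
      Add_Zero_Zero[OF assms(2) O(1)] by simp
qed

text \<open>Vanishing of an object is expressed by the equality of its identity with its zero endomorphism, a
condition that passes along isomorphisms and additive functors by computation alone.\<close>

lemma Id_Zero_transport:
  assumes "is_iso C i" "i \<in> Hom C P Q" "Id C Q = Zero C Q Q"
  shows "Id C P = Zero C P P"
proof -
  note O = Hom_Obj[OF assms(2)] and j = is_iso_Hom[OF assms(1,2)]
  have "Id C P = inv_arr C i \<cdot> Id C Q \<cdot> i"
    using Id_Comp[OF assms(2)] j by simp
  then show ?thesis
    using assms(3) Zero_Comp[OF assms(2) O(2)] Comp_Zero[OF j(1) O(1)] by simp
qed

lemma is_iso_between_zero_objects: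
  assumes "Id C P = Zero C P P" "Id C Q = Zero C Q Q" "a \<in> Hom C P Q"
  shows "is_iso C a"
proof -
  note O = Hom_Obj[OF assms(3)]
  show ?thesis
    using is_isoI[OF assms(3) Zero_Hom[OF O(2,1)]] Zero_Comp[OF assms(3) O(1)]
      Comp_Zero[OF assms(3) O(2)] assms(1,2) by simp
qed

end

lemma additive_func_Id_Zero:
  assumes "additive_category C" "additive_category D" "is_functor C D F" "additive_func C D F"
    and X: "X \<in> Obj C" "Id C X = Zero C X X"
  shows "Id D (Fo F X) = Zero D (Fo F X) (Fo F X)"
proof -
  interpret C: additive_category C by fact
  interpret D: additive_category D by fact
  note id = C.Id_Hom[OF X(1)]
  have "Add C (Id C X) (Id C X) = Id C X"
    using C.Add_Zero_Zero[OF X(1) X(1)] X(2) by simp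
  then have "Add D (Fa F (Id C X)) (Fa F (Id C X)) = Fa F (Id C X)"
    using assms(4) X(1) id unfolding additive_func_def by metis
  then show ?thesis
    using D.Add_idem_Zero[OF functor_Hom[OF assms(3) id]] functor_Id[OF assms(3) X(1)] by simp
qed

locale localic_over_base = base_category S + localic S H
  for S :: "('s, 'a) base" (structure) and H :: "('s, 'a, 'o, 'm) fibcat"
begin

lemma initial_arr_Hom: "X \<in> Obj S \<Longrightarrow> initial_arr S (Empt S) X \<in> Hom S (Empt S) X"
  unfolding initial_arr_def using initial theI'[of "\<lambda>f. f \<in> Hom S (Empt S) X"]
  by (simp add: is_initial_def)

lemma exchange_Hom:
  assumes p: "p \<in> Sm S" and sq: "is_cartesian S f' p' p f" and A: "A \<in> Obj (fib H (Dom S p))"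
  shows "exchange S H f' p' p f A \<in> Hom (fib H (Dom S f))
    (Fo (sharp S H p') (Fo (pull H f') A)) (Fo (pull H f) (Fo (sharp S H p) A))"
proof -
  let ?P = "Dom S p" and ?X = "Cod S p" and ?T = "Dom S f" and ?P' = "Dom S p'"
  have h: "p \<in> Hom S ?P ?X" "f \<in> Hom S ?T ?X" "p' \<in> Hom S ?P' ?T" "f' \<in> Hom S ?P' ?P"
    and comm: "p \<cdot> f' = f \<cdot> p'"
    using sq unfolding is_cartesian_def Hom_def by auto
  note O = Hom_Obj[OF h(1)] Hom_Obj[OF h(3)]
  interpret p: adjoint_pair "fib H ?P" "fib H ?X" "sharp S H p" "pull H p" "sharp_unit S H p"
      "sharp_counit S H p"
    using sharp_adjoint_pair[OF Sm_has_sharp[OF p] h(1) O(1,2)] .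
  interpret p': adjoint_pair "fib H ?P'" "fib H ?T" "sharp S H p'" "pull H p'" "sharp_unit S H p'"
      "sharp_counit S H p'"
    using sharp_adjoint_pair[OF Sm_has_sharp[OF Sm_base_change[OF p sq]] h(3) O(3,4)] .
  note pA = functor_Obj[OF p.left_functor A]
  note fpA = functor_Obj[OF pull_functor[OF h(2)] pA]
  note u = functor_Hom[OF pull_functor[OF h(4)] p.unit_Hom[OF A]]
  note c = p'.C.is_iso_Hom(1)[OF conn_is_iso[OF h(4,1) pA] conn_Hom[OF h(4,1) pA]]
  note c' = conn_Hom[OF h(3,2) pA, folded comm]
  have "Cod S p' = ?T"
    using h(3) by (simp add: Hom_def)
  then show ?thesis
    using p'.D.Comp_Hom[OF functor_Hom[OF p'.left_functor p'.C.Comp_Hom[OF p'.C.Comp_Hom[OF u c] c']]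
        p'.counit_Hom[OF fpA]]
    by (simp add: exchange_def Let_def)
qed

text \<open>The identity of the complement \<open>U\<close> corresponds to \<open>u\<close> itself under the universal property.\<close>

lemma complement_square:
  assumes "z \<in> Cl S"
  shows "is_cartesian S (initial_arr S (Empt S) (Dom S (Compl S z))) (initial_arr S (Empt S) (Dom S z))
    (Compl S z) z"
proof -
  let ?u = "Compl S z" let ?U = "Dom S ?u"
  have "?u \<in> Arr S" "Cod S ?u = Cod S z"
    using Compl_Sm[OF assms] Sm_subcategory unfolding wide_subcategory_def by auto
  then have u: "?u \<in> Hom S ?U (Cod S z)"
    by (simp add: Hom_def)
  note U = Hom_Obj(1)[OF u]
  have "?u \<cdot> Id S ?U \<in> {f \<in> Hom S ?U (Cod S z). is_cartesian S (initial_arr S (Empt S) ?U)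
      (initial_arr S (Empt S) (Dom S z)) f z}"
    using Compl_universal[OF assms U] Id_Hom[OF U] by (metis (no_types, lifting) bij_betwE)
  then show ?thesis
    using Comp_Id[OF u] by simp
qed

text \<open>This says \<open>u\<^sup>*z\<^sub>* = 0\<close> for the open immersion \<open>u\<close> complementary to \<open>z\<close>. Arrows \<open>B \<rightarrow> u\<^sup>*z\<^sub>*A\<close> correspond
to arrows \<open>z\<^sup>*u\<^sub>#B \<rightarrow> A\<close> by the two adjunctions. Base change along the empty intersection identifies
\<open>z\<^sup>*u\<^sub>#B\<close> with \<open>q\<^sub>#N\<close>, where \<open>q : \<emptyset> \<rightarrow> Z\<close> is smooth and \<open>N\<close> lies over \<open>\<emptyset>\<close>; and arrows \<open>q\<^sub>#N \<rightarrow> A\<close>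
correspond to arrows out of the zero object \<open>N\<close>.\<close>

lemma pull_complement_star_unique:
  assumes z: "z \<in> Cl S" and A: "A \<in> Obj (fib H (Dom S z))"
    and g: "g \<in> Hom (fib H (Dom S (Compl S z))) B (Fo (pull H (Compl S z)) (Fo (star S H z) A))"
    and g': "g' \<in> Hom (fib H (Dom S (Compl S z))) B (Fo (pull H (Compl S z)) (Fo (star S H z) A))"
  shows "g = g'"
proof -
  let ?u = "Compl S z" let ?U = "Dom S ?u" and ?Z = "Dom S z" and ?X = "Cod S z"
  let ?f = "initial_arr S (Empt S) ?U" and ?q = "initial_arr S (Empt S) ?Z"
  note sq = complement_square[OF z]
  have uSm: "?u \<in> Sm S"
    using Compl_Sm[OF z] by simp
  have h: "z \<in> Hom S ?Z ?X" "?u \<in> Hom S ?U ?X"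
    using sq unfolding is_cartesian_def Hom_def by auto
  note O = Hom_Obj[OF h(1)] Hom_Obj[OF h(2)]
  note q = initial_arr_Hom[OF O(1)] and f = initial_arr_Hom[OF O(3)]
  note E = Hom_Obj(1)[OF q]
  interpret u: adjoint_pair "fib H ?U" "fib H ?X" "sharp S H ?u" "pull H ?u" "sharp_unit S H ?u"
      "sharp_counit S H ?u"
    using sharp_adjoint_pair[OF Sm_has_sharp[OF uSm] h(2) O(3,4)] .
  interpret q: adjoint_pair "fib H (Empt S)" "fib H ?Z" "sharp S H ?q" "pull H ?q" "sharp_unit S H ?q"
      "sharp_counit S H ?q"
    using sharp_adjoint_pair[OF Sm_has_sharp[OF Sm_base_change[OF uSm sq]] q E O(1)] .
  interpret z: adjoint_pair "fib H ?X" "fib H ?Z" "pull H z" "star S H z" "star_unit S H z"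
      "star_counit S H z"
    using star_adjoint_pair[OF Cl_has_star[OF z] h(1) O(1,2)] .
  note B = u.C.Hom_Obj(1)[OF g]
  let ?N = "Fo (pull H ?f) B"
  note zA = functor_Obj[OF z.right_functor A]
  note N = functor_Obj[OF pull_functor[OF f] B]
  note ex = exchange_iso[OF uSm sq B] exchange_Hom[OF uSm sq B]
  have from_N: "x = x'" if x: "x \<in> Hom (fib H ?Z) (Fo (sharp S H ?q) ?N) A"
      "x' \<in> Hom (fib H ?Z) (Fo (sharp S H ?q) ?N) A" for x x'
  proof (rule q.right_transpose_inject[OF N x])
    have "is_initial (fib H (Empt S)) ?N"
      using fib_Empt[OF N] unfolding is_zero_obj_def by blast
    then show "Fa (pull H ?q) x \<cdot>\<^bsub>fib H (Empt S)\<^esub> sharp_unit S H ?q ?N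
        = Fa (pull H ?q) x' \<cdot>\<^bsub>fib H (Empt S)\<^esub> sharp_unit S H ?q ?N"
      using q.right_transpose_Hom[OF N x(1)] q.right_transpose_Hom[OF N x(2)]
        functor_Obj[OF q.right_functor A] unfolding is_initial_def by blast
  qed
  have from_uB: "y = y'" if y: "y \<in> Hom (fib H ?Z) (Fo (pull H z) (Fo (sharp S H ?u) B)) A"
      "y' \<in> Hom (fib H ?Z) (Fo (pull H z) (Fo (sharp S H ?u) B)) A" for y y'
    using q.D.is_iso_epi[OF ex y from_N[OF q.D.Comp_Hom[OF ex(2) y(1)] q.D.Comp_Hom[OF ex(2) y(2)]]] .
  note Fg = functor_Hom[OF u.left_functor g] functor_Hom[OF u.left_functor g']
  note k = u.D.Comp_Hom[OF Fg(1) u.counit_Hom[OF zA]] u.D.Comp_Hom[OF Fg(2) u.counit_Hom[OF zA]]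
  note Fk = functor_Hom[OF z.left_functor k(1)] functor_Hom[OF z.left_functor k(2)]
  show ?thesis
    using u.left_transpose_inject[OF zA g g'] z.left_transpose_inject[OF A k]
      from_uB[OF q.D.Comp_Hom[OF Fk(1) z.counit_Hom[OF A]] q.D.Comp_Hom[OF Fk(2) z.counit_Hom[OF A]]]
    by blast
qed

end

locale localic_morphism = base_category S + H1: localic S H1 + H2: localic S H2 +
    triangulated_fibered_morphism S H1 H2 R
  for S :: "('s, 'a) base" (structure)
    and H1 :: "('s, 'a, 'o, 'm) fibcat" and H2 :: "('s, 'a, 'p, 'n) fibcat"
    and R :: "('s, 'a, 'o, 'm, 'p, 'n) fibmor"
begin

sublocale morphism_over_base S H1 H2 R
  by unfold_locales

text \<open>By joint conservativity of \<open>z\<^sup>*\<close> and \<open>u\<^sup>*\<close>. The counit composed with the \<open>z\<^sup>*\<close>-image of the exchange map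
is \<open>R \<epsilon> \<cdot> \<theta>\<close>, and both counits are invertible. The \<open>u\<^sup>*\<close>-image goes between zero objects: its target
is \<open>u\<^sup>*z\<^sub>*\<close> of something, and its source is isomorphic to \<open>R\<close> of such an object.\<close>

lemma theta_bar_is_iso:
  assumes z: "z \<in> Cl S" and A: "A \<in> Obj (fib H1 (Dom S z))"
  shows "is_iso (fib H2 (Cod S z)) (theta_bar S H1 H2 R z A)"
proof -
  interpret L1: localic_over_base S H1 by unfold_locales
  interpret L2: localic_over_base S H2 by unfold_locales
  let ?u = "Compl S z" let ?U = "Dom S ?u" and ?Z = "Dom S z" and ?X = "Cod S z"
  let ?bar = "theta_bar S H1 H2 R z A"
  have h: "z \<in> Hom S ?Z ?X" "?u \<in> Hom S ?U ?X"
    using L1.complement_square[OF z] unfolding is_cartesian_def Hom_def by auto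
  note O = Hom_Obj[OF h(1)] Hom_Obj[OF h(2)]
  note stars = H1.Cl_has_star[OF z] H2.Cl_has_star[OF z]
  interpret A1: adjoint_pair "fib H1 ?X" "fib H1 ?Z" "pull H1 z" "star S H1 z" "star_unit S H1 z"
      "star_counit S H1 z"
    using H1.star_adjoint_pair[OF stars(1) h(1) O(1,2)] .
  interpret A2: adjoint_pair "fib H2 ?X" "fib H2 ?Z" "pull H2 z" "star S H2 z" "star_unit S H2 z"
      "star_counit S H2 z"
    using H2.star_adjoint_pair[OF stars(2) h(1) O(1,2)] .
  interpret U1: triangulated_category "fib H1 ?U"
    using H1.fib_triangulated[OF O(3)] .
  interpret U2: triangulated_category "fib H2 ?U"
    using H2.fib_triangulated[OF O(3)] .
  note bar = theta_bar_Hom[OF h(1) stars A]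
  note zA = functor_Obj[OF A1.right_functor A]
  note RA = functor_Obj[OF mor_functor[OF O(1)] A]
  note c = A1.counit_Hom[OF A]
  show ?thesis
  proof (rule H2.jointly_conservative[OF z])
    show "?bar \<in> Arr (fib H2 ?X)"
      using bar by (simp add: Hom_def)
    have "is_iso (fib H2 ?Z) (Fa (mor R ?Z) (star_counit S H1 z A)
        \<cdot>\<^bsub>fib H2 ?Z\<^esub> theta R z (Fo (star S H1 z) A))"
      using A2.D.is_iso_Comp[OF theta_is_iso[OF h(1) zA] functor_is_iso[OF A1.D.category_axioms
          A2.D.category_axioms mor_functor[OF O(1)]
          A1.counit_is_iso[OF H1.star_fully_faithful[OF z] A] c]
          theta_Hom[OF h(1) zA] functor_Hom[OF mor_functor[OF O(1)] c]] .
    then show "is_iso (fib H2 ?Z) (Fa (pull H2 z) ?bar)"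
      unfolding theta_bar_transpose[OF h(1) stars A, symmetric]
      using A2.D.is_iso_right_factor[OF _ A2.counit_is_iso[OF H2.star_fully_faithful[OF z] RA]
          functor_Hom[OF A2.left_functor bar] A2.counit_Hom[OF RA]] by blast
    show "is_iso (fib H2 ?U) (Fa (pull H2 ?u) ?bar)"
    proof (rule U2.is_iso_between_zero_objects[OF _ _
          functor_Hom[OF H2.pull_functor[OF h(2)] bar]])
      let ?uzA = "Fo (pull H1 ?u) (Fo (star S H1 z) A)"
      let ?uzRA = "Fo (pull H2 ?u) (Fo (star S H2 z) (Fo (mor R ?Z) A))"
      note uzA = functor_Obj[OF H1.pull_functor[OF h(2)] zA]
      note uzRA = functor_Obj[OF H2.pull_functor[OF h(2)] functor_Obj[OF A2.right_functor RA]]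
      show "Id (fib H2 ?U) ?uzRA = Zero (fib H2 ?U) ?uzRA ?uzRA"
        using L2.pull_complement_star_unique[OF z RA U2.Id_Hom[OF uzRA] U2.Zero_Hom[OF uzRA uzRA]] .
      have "Id (fib H1 ?U) ?uzA = Zero (fib H1 ?U) ?uzA ?uzA"
        using L1.pull_complement_star_unique[OF z A U1.Id_Hom[OF uzA] U1.Zero_Hom[OF uzA uzA]] .
      then have "Id (fib H2 ?U) (Fo (mor R ?U) ?uzA)
          = Zero (fib H2 ?U) (Fo (mor R ?U) ?uzA) (Fo (mor R ?U) ?uzA)"
        using additive_func_Id_Zero[OF U1.additive_category_axioms U2.additive_category_axioms
            mor_functor[OF O(3)] _ uzA] mor_triangulated[OF O(3)]
        unfolding triangulated_functor_def by blast
      then show "Id (fib H2 ?U) (Fo (pull H2 ?u) (Fo (mor R ?X) (Fo (star S H1 z) A)))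
          = Zero (fib H2 ?U) (Fo (pull H2 ?u) (Fo (mor R ?X) (Fo (star S H1 z) A)))
              (Fo (pull H2 ?u) (Fo (mor R ?X) (Fo (star S H1 z) A)))"
        using U2.Id_Zero_transport[OF theta_is_iso[OF h(2) zA] theta_Hom[OF h(2) zA]] by blast
    qed
  qed
qed

end


section \<open>Cores and structures over the whole base\<close>

locale localic_tensor_family = localic_morphism S H1 H2 R + tensor_family S H1 H2 E1 E2 R \<rho>
  for S :: "('s, 'a) base" (structure)
    and H1 :: "('s, 'a, 'o, 'm) fibcat" and H2 :: "('s, 'a, 'p, 'n) fibcat"
    and E1 :: "('s, 'a, 'o, 'm) ext_tensor" and E2 :: "('s, 'a, 'p, 'n) ext_tensor"
    and R :: "('s, 'a, 'o, 'm, 'p, 'n) fibmor" and \<rho> :: "'s \<Rightarrow> 's \<Rightarrow> 'o \<times> 'o \<Rightarrow> 'n" +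
  assumes closed_products: "closed_products_adjointable S H1 H2 R"
begin

text \<open>For closed immersions everything that the transposition argument asks for is available; the
adjunction and exchange map of \<open>z\<^sub>1 \<times> z\<^sub>2\<close> come from \<open>closed_products\<close>.\<close>

lemma rho_star_iff:
  assumes cl: "z1 \<in> Cl S" "z2 \<in> Cl S" and z: "z1 \<in> Hom S Z1 X1" "z2 \<in> Hom S Z2 X2"
    and A: "A1 \<in> Obj (fib H1 Z1)" "A2 \<in> Obj (fib H1 Z2)"
  shows "inv_arr (fib H2 (Prod S X1 X2))
          (theta_bar S H1 H2 R (prod_arr S z1 z2) (Fo (tens E1 Z1 Z2) (A1, A2)))
        \<cdot>\<^bsub>fib H2 (Prod S X1 X2)\<^esub> Fa (star S H2 (prod_arr S z1 z2)) (\<rho> Z1 Z2 (A1, A2))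
        \<cdot>\<^bsub>fib H2 (Prod S X1 X2)\<^esub> mon_bar S H2 E2 z1 z2 (Fo (mor R Z1) A1, Fo (mor R Z2) A2)
      = Fa (mor R (Prod S X1 X2)) (mon_bar S H1 E1 z1 z2 (A1, A2))
        \<cdot>\<^bsub>fib H2 (Prod S X1 X2)\<^esub> \<rho> X1 X2 (Fo (star S H1 z1) A1, Fo (star S H1 z2) A2)
        \<cdot>\<^bsub>fib H2 (Prod S X1 X2)\<^esub>
          Fa (tens E2 X1 X2) (inv_arr (fib H2 X1) (theta_bar S H1 H2 R z1 A1),
                              inv_arr (fib H2 X2) (theta_bar S H1 H2 R z2 A2))
    \<longleftrightarrow> compatible z1 z2 (Fo (star S H1 z1) A1) (Fo (star S H1 z2) A2)"
proof -
  have D: "Dom S z1 = Z1" "Cod S z1 = X1" "Dom S z2 = Z2" "Cod S z2 = X2"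
    using z by (auto simp: Hom_def)
  note O = Hom_Obj[OF z(1)] Hom_Obj[OF z(2)]
  have "Fo (tens E1 Z1 Z2) (A1, A2) \<in> Obj (fib H1 (Prod S Z1 Z2))"
    using functor_Obj[OF E1.tens_functor[OF O(1,3)], of "(A1, A2)"] A by simp
  then have bar: "is_iso (fib H2 (Prod S X1 X2))
      (theta_bar S H1 H2 R (prod_arr S z1 z2) (Fo (tens E1 Z1 Z2) (A1, A2)))"
    and stars: "has_star S H1 (prod_arr S z1 z2)" "has_star S H2 (prod_arr S z1 z2)"
    using closed_products cl D unfolding closed_products_adjointable_def by auto
  have counit: "is_iso (fib H1 Z) (star_counit S H1 z A)"
    if "z \<in> Cl S" "z \<in> Hom S Z X" "A \<in> Obj (fib H1 Z)" for z Z X A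
    using adjoint_pair.counit_is_iso[OF
        H1.star_adjoint_pair[OF H1.Cl_has_star[OF that(1)] that(2) Hom_Obj[OF that(2)]] _ that(3)]
      H1.star_fully_faithful[OF that(1)] that(2) by (simp add: Hom_def)
  show ?thesis
    using rho_star_iff_compatible[OF z H1.Cl_has_star[OF cl(1)] H1.Cl_has_star[OF cl(2)] stars(1)
        H2.Cl_has_star[OF cl(1)] H2.Cl_has_star[OF cl(2)] stars(2) A
        counit[OF cl(1) z(1) A(1)] counit[OF cl(2) z(2) A(2)] _ _ bar]
      theta_bar_is_iso[OF cl(1)] theta_bar_is_iso[OF cl(2)] A by (simp add: D)
qed

lemma mor_tensor_over_iff:
  assumes "M \<subseteq> Arr S"
  shows "mor_tensor_over M S H1 H2 E1 E2 R \<rho> \<longleftrightarrow>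
    (\<forall>f1\<in>M. \<forall>f2\<in>M. \<forall>A1\<in>Obj (fib H1 (Cod S f1)). \<forall>A2\<in>Obj (fib H1 (Cod S f2)). compatible f1 f2 A1 A2)"
proof
  assume "mor_tensor_over M S H1 H2 E1 E2 R \<rho>"
  then interpret N: mor_tensor_over M S H1 H2 E1 E2 R \<rho> .
  show "\<forall>f1\<in>M. \<forall>f2\<in>M. \<forall>A1\<in>Obj (fib H1 (Cod S f1)). \<forall>A2\<in>Obj (fib H1 (Cod S f2)). compatible f1 f2 A1 A2"
  proof (intro ballI)
    fix f1 f2 A1 A2
    assume f: "f1 \<in> M" "f2 \<in> M" and A: "A1 \<in> Obj (fib H1 (Cod S f1))" "A2 \<in> Obj (fib H1 (Cod S f2))"
    then have h: "f1 \<in> Hom S (Dom S f1) (Cod S f1)" "f2 \<in> Hom S (Dom S f2) (Cod S f2)"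
      using assms by (auto simp: Hom_def)
    show "compatible f1 f2 A1 A2"
      unfolding compatible_iff[OF h] using N.rho_pull[OF f h A] .
  qed
next
  assume c: "\<forall>f1\<in>M. \<forall>f2\<in>M. \<forall>A1\<in>Obj (fib H1 (Cod S f1)). \<forall>A2\<in>Obj (fib H1 (Cod S f2)).
    compatible f1 f2 A1 A2"
  show "mor_tensor_over M S H1 H2 E1 E2 R \<rho>"
  proof unfold_locales
    fix f1 f2 T1 X1 T2 X2 A1 A2
    assume f: "f1 \<in> M" "f2 \<in> M" and h: "f1 \<in> Hom S T1 X1" "f2 \<in> Hom S T2 X2"
      and A: "A1 \<in> Obj (fib H1 X1)" "A2 \<in> Obj (fib H1 X2)"
    have "compatible f1 f2 A1 A2"
      using c f A h by (auto simp: Hom_def)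
    then show "theta R (prod_arr S f1 f2) (Fo (tens E1 X1 X2) (A1, A2))
        \<cdot>\<^bsub>fib H2 (Prod S T1 T2)\<^esub> Fa (pull H2 (prod_arr S f1 f2)) (\<rho> X1 X2 (A1, A2))
        \<cdot>\<^bsub>fib H2 (Prod S T1 T2)\<^esub> mon E2 f1 f2 (Fo (mor R X1) A1, Fo (mor R X2) A2)
      = Fa (mor R (Prod S T1 T2)) (mon E1 f1 f2 (A1, A2))
        \<cdot>\<^bsub>fib H2 (Prod S T1 T2)\<^esub> \<rho> T1 T2 (Fo (pull H1 f1) A1, Fo (pull H1 f2) A2)
        \<cdot>\<^bsub>fib H2 (Prod S T1 T2)\<^esub> Fa (tens E2 T1 T2) (theta R f1 A1, theta R f2 A2)"
      unfolding compatible_iff[OF h] .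
  qed
qed

text \<open>From left to right, an arbitrary pair \<open>(A\<^sub>1, A\<^sub>2)\<close> is reached by way of the direct images
\<open>z\<^sub>i\<^sub>*z\<^sub>i\<^sup>*A\<^sub>i\<close>.\<close>

lemma mor_tensor_Cl_op_iff:
  "mor_tensor_Cl_op S H1 H2 E1 E2 R \<rho> \<longleftrightarrow> mor_tensor_over (Cl S) S H1 H2 E1 E2 R \<rho>"
proof -
  have ClArr: "Cl S \<subseteq> Arr S"
    using Cl_subcategory unfolding wide_subcategory_def by blast
  show ?thesis
    unfolding mor_tensor_over_iff[OF ClArr]
  proof
    assume "mor_tensor_Cl_op S H1 H2 E1 E2 R \<rho>"
    then interpret N: mor_tensor_Cl_op S H1 H2 E1 E2 R \<rho> .
    show "\<forall>z1\<in>Cl S. \<forall>z2\<in>Cl S. \<forall>A1\<in>Obj (fib H1 (Cod S z1)). \<forall>A2\<in>Obj (fib H1 (Cod S z2)).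
        compatible z1 z2 A1 A2"
    proof (intro ballI)
      fix z1 z2 A1 A2
      assume cl: "z1 \<in> Cl S" "z2 \<in> Cl S"
        and A: "A1 \<in> Obj (fib H1 (Cod S z1))" "A2 \<in> Obj (fib H1 (Cod S z2))"
      then have z: "z1 \<in> Hom S (Dom S z1) (Cod S z1)" "z2 \<in> Hom S (Dom S z2) (Cod S z2)"
        using ClArr by (auto simp: Hom_def)
      note zA = functor_Obj[OF H1.pull_functor[OF z(1)] A(1)] functor_Obj[OF H1.pull_functor[OF z(2)] A(2)]
      show "compatible z1 z2 A1 A2"
        using compatible_if_at_units[OF z H1.Cl_has_star[OF cl(1)] H1.Cl_has_star[OF cl(2)]
            H1.star_fully_faithful[OF cl(1)] H1.star_fully_faithful[OF cl(2)] A]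
          rho_star_iff[OF cl z zA] N.rho_star[OF cl z zA] by blast
    qed
  next
    assume c: "\<forall>z1\<in>Cl S. \<forall>z2\<in>Cl S. \<forall>A1\<in>Obj (fib H1 (Cod S z1)). \<forall>A2\<in>Obj (fib H1 (Cod S z2)).
        compatible z1 z2 A1 A2"
    have c': "compatible z1 z2 (Fo (star S H1 z1) A1) (Fo (star S H1 z2) A2)"
      if cl: "z1 \<in> Cl S" "z2 \<in> Cl S" and z: "z1 \<in> Hom S Z1 X1" "z2 \<in> Hom S Z2 X2"
        and A: "A1 \<in> Obj (fib H1 Z1)" "A2 \<in> Obj (fib H1 Z2)" for z1 z2 Z1 X1 Z2 X2 A1 A2
    proof -
      have "Fo (star S H1 z) A \<in> Obj (fib H1 (Cod S z))"
        if "z \<in> Cl S" "z \<in> Hom S Z X" "A \<in> Obj (fib H1 Z)" for z Z X A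
        using functor_Obj[OF adjoint_pair.right_functor[OF H1.star_adjoint_pair[OF
              H1.Cl_has_star[OF that(1)] that(2) Hom_Obj[OF that(2)]]] that(3)] that(2)
        by (simp add: Hom_def)
      then show ?thesis
        using c cl z A by blast
    qed
    show "mor_tensor_Cl_op S H1 H2 E1 E2 R \<rho>"
      by unfold_locales (simp only: rho_star_iff c')
  qed
qed

text \<open>The factorization of an arrow into a closed immersion \<open>t\<close> and a smooth arrow \<open>p\<close>, and pasting of
hexagons along \<open>p\<^sub>i \<cdot> t\<^sub>i\<close>.\<close>

lemma mor_tensor_over_Arr_iff:
  "mor_tensor_over (Arr S) S H1 H2 E1 E2 R \<rho> \<longleftrightarrow>
    mor_tensor_over (Sm S) S H1 H2 E1 E2 R \<rho> \<and> mor_tensor_over (Cl S) S H1 H2 E1 E2 R \<rho>"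
proof -
  have sub: "Sm S \<subseteq> Arr S" "Cl S \<subseteq> Arr S"
    using Sm_subcategory Cl_subcategory unfolding wide_subcategory_def by blast+
  note iff = mor_tensor_over_iff[OF sub(1)] mor_tensor_over_iff[OF sub(2)]
    mor_tensor_over_iff[OF subset_refl]
  show ?thesis
    unfolding iff
  proof (intro iffI conjI ballI)
    fix f1 f2 A1 A2
    assume c: "(\<forall>f1\<in>Sm S. \<forall>f2\<in>Sm S. \<forall>A1\<in>Obj (fib H1 (Cod S f1)). \<forall>A2\<in>Obj (fib H1 (Cod S f2)).
          compatible f1 f2 A1 A2) \<and>
        (\<forall>f1\<in>Cl S. \<forall>f2\<in>Cl S. \<forall>A1\<in>Obj (fib H1 (Cod S f1)). \<forall>A2\<in>Obj (fib H1 (Cod S f2)).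
          compatible f1 f2 A1 A2)"
      and f: "f1 \<in> Arr S" "f2 \<in> Arr S"
      and A: "A1 \<in> Obj (fib H1 (Cod S f1))" "A2 \<in> Obj (fib H1 (Cod S f2))"
    obtain t1 p1 where 1: "t1 \<in> Cl S" "p1 \<in> Sm S" "Cod S t1 = Dom S p1" "f1 = p1 \<cdot> t1"
      using factorization[OF f(1)] by blast
    obtain t2 p2 where 2: "t2 \<in> Cl S" "p2 \<in> Sm S" "Cod S t2 = Dom S p2" "f2 = p2 \<cdot> t2"
      using factorization[OF f(2)] by blast
    have "t1 \<in> Arr S" "p1 \<in> Arr S" "t2 \<in> Arr S" "p2 \<in> Arr S"
      using 1 2 sub by auto
    then have t: "t1 \<in> Hom S (Dom S t1) (Cod S t1)" "t2 \<in> Hom S (Dom S t2) (Cod S t2)"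
      and p: "p1 \<in> Hom S (Cod S t1) (Cod S f1)" "p2 \<in> Hom S (Cod S t2) (Cod S f2)"
      using 1 2 by (auto simp: Hom_def Comp_Arr)
    have "Cod S p1 = Cod S f1" "Cod S p2 = Cod S f2"
      using p by (auto simp: Hom_def)
    then show "compatible f1 f2 A1 A2"
      using compatible_Comp[OF t p A] c 1 2 A
        functor_Obj[OF H1.pull_functor[OF p(1)] A(1)] functor_Obj[OF H1.pull_functor[OF p(2)] A(2)]
      by simp
  qed (use sub in auto)
qed

end

theorem theorem5p7:
  fixes S :: "('s, 'a) base"
    and H1 :: "('s, 'a, 'o, 'm) fibcat" and H2 :: "('s, 'a, 'p, 'n) fibcat"
    and E1 :: "('s, 'a, 'o, 'm) ext_tensor" and E2 :: "('s, 'a, 'p, 'n) ext_tensor"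
    and R :: "('s, 'a, 'o, 'm, 'p, 'n) fibmor"
    and \<rho> :: "'s \<Rightarrow> 's \<Rightarrow> 'o \<times> 'o \<Rightarrow> 'n"
  assumes "base_category S"
    and "localic S H1" and "localic S H2"
    and "triangulated_external_tensor S H1 E1" and "smooth_adjointable_tensor S H1 E1"
    and "triangulated_external_tensor S H2 E2" and "smooth_adjointable_tensor S H2 E2"
    and "triangulated_fibered_morphism S H1 H2 R" and "smooth_adjointable_morphism S H1 H2 R"
    and "closed_products_adjointable S H1 H2 R"
  shows "external_tensor_core S H1 H2 E1 E2 R \<rho> \<rho> \<longleftrightarrow>
         triangulated_mor_tensor S H1 H2 E1 E2 R \<rho>"
proof (cases "mor_tensor_family S H1 H2 E1 E2 R \<rho>")
  case True
  interpret base_category S by fact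
  interpret H1: localic S H1 by fact
  interpret H2: localic S H2 by fact
  interpret E1: triangulated_external_tensor S H1 E1 by fact
  interpret E2: triangulated_external_tensor S H2 E2 by fact
  interpret triangulated_fibered_morphism S H1 H2 R by fact
  interpret mor_tensor_family S H1 H2 E1 E2 R \<rho> by fact
  interpret localic_tensor_family S H1 H2 E1 E2 R \<rho>
    using assms(10) by unfold_locales
  show ?thesis
    unfolding external_tensor_core_def triangulated_mor_tensor_def triangulated_mor_tensor_Sm_def
      triangulated_mor_tensor_Cl_op_def mor_tensor_Cl_op_iff mor_tensor_over_Arr_iff by blast
next
  case False
  \<comment> \<open>Both sides contain the assertion that \<open>\<rho>\<close> consists of natural isomorphisms.\<close>
  then show ?thesis
    unfolding external_tensor_core_def triangulated_mor_tensor_def triangulated_mor_tensor_Sm_def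
      mor_tensor_over_def by blast
qed

end
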